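(* For every real $\lambda>0$ and every $n\in\mathbb{N}$ there exist integers $d_0>d_1>\cdots>d_{n-1}>0$ and a sequence of finite graphs $(G_s)_{s\ge 1}$ such that: every $G_s$ is $(d_0,d_1,\ldots,d_{n-1})$-regular, the number of vertices of $G_s$ tends to infinity as $s\to\infty$, and every $G_s$ is a $\lambda$-local spectral expander.
   Context: A finite graph $G=(V,E)$ is $(d_0,d_1,\ldots,d_{n-1})$-regular (for integers $d_0>d_1>\cdots>d_{n-1}>0$) if $G$ is $d_0$-regular and, for every $1\le i\le n-1$, for every clique $C$ of $G$ with $|C|=i$, the subgraph induced on the joint neighbourhood of $C$ (the set of vertices adjacent to all vertices of $C$) is $d_i$-regular. The clique complex $X(G)$ is the simplicial complex whose faces are the cliques of $G$; $X(i)$ denotes the set of faces with $i+1$ vertices. It is $d$-dimensional if the largest face has $d+1$ vertices, and pure if every face is contained in a face with $d+1$ vertices. For a face $\tau$, the link is $X_\tau=\{T\setminus\tau:\tau\subseteq T\in X\}$ (for $\tau=\emptyset$ it is $X$ itself). For a pure $d$-dimensional complex $X$, $\tau\in X(k)$ ($-1\le k\le d-2$, with $X(-1)=\{\emptyset\}$), the 1-skeleton of $X_\tau$ is weighted by $w(\{u,v\})=(d-k-2)!\,\bigl|\{\pi\in X_\tau(d-k-1):\{u,v\}\subseteq\pi\}\bigr|$, and its transition matrix is $T(v,u)=w(\{u,v\})/\sum_{x:\{x,v\}\in X_\tau(1)}w(\{x,v\})$ for edges $\{u,v\}$ and $0$ otherwise. For a weighted graph, $\lambda_2$ denotes the second largest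 eigenvalue (with multiplicity) of its transition matrix; the graph is a one-sided $\lambda$-spectral expander if $\lambda_2\le\lambda$. A pure $d$-dimensional simplicial complex $X$ is a one-sided $\lambda$-high-dimensional expander if the weighted 1-skeleton of $X$ and, for every $i\le d-2$ and every $s\in X(i)$, the weighted 1-skeleton of $X_s$ are one-sided $\lambda$-spectral expanders. A graph $G$ is a $\lambda$-local spectral expander if its clique complex $X(G)$ is pure and is a one-sided $\lambda$-high-dimensional expander. *)

theory Defs
  imports Complex_Main "Jordan_Normal_Form.Char_Poly"
begin

definition graph :: "nat set \<Rightarrow> nat set set \<Rightarrow> bool" where
  "graph V E \<longleftrightarrow> finite V \<and> (\<forall>e\<in>E. card e = 2 \<and> e \<subseteq> V)"

definition clique :: "nat set \<Rightarrow> nat set set \<Rightarrow> nat set \<Rightarrow> bool" where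
  "clique V E C \<longleftrightarrow> C \<subseteq> V \<and> (\<forall>u\<in>C. \<forall>v\<in>C. u \<noteq> v \<longrightarrow> {u, v} \<in> E)"

definition joint_nbhd :: "nat set \<Rightarrow> nat set set \<Rightarrow> nat set \<Rightarrow> nat set" where
  "joint_nbhd V E C = {v \<in> V. \<forall>u\<in>C. {u, v} \<in> E}"

definition induced_regular :: "nat set \<Rightarrow> nat set set \<Rightarrow> nat \<Rightarrow> bool" where
  "induced_regular W E d \<longleftrightarrow> (\<forall>v\<in>W. card {u \<in> W. {u, v} \<in> E} = d)"

text \<open>(d_0,...,d_{n-1})-regularity, with ds = [d_0,...,d_{n-1}]. The case i = 0
  (the empty clique, whose joint neighbourhood is V) is exactly d_0-regularity of G.\<close>
definition multi_regular :: "nat set \<Rightarrow> nat set set \<Rightarrow> nat list \<Rightarrow> bool" where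
  "multi_regular V E ds \<longleftrightarrow>
     (\<forall>i < length ds. \<forall>C. clique V E C \<and> card C = i \<longrightarrow>
        induced_regular (joint_nbhd V E C) E (ds ! i))"

definition clique_complex :: "nat set \<Rightarrow> nat set set \<Rightarrow> nat set set" where
  "clique_complex V E = {C. finite C \<and> clique V E C}"

definition pure_dim :: "nat set set \<Rightarrow> nat \<Rightarrow> bool" where
  "pure_dim X d \<longleftrightarrow> (\<forall>F\<in>X. card F \<le> d + 1) \<and>
      (\<forall>F\<in>X. \<exists>T\<in>X. F \<subseteq> T \<and> card T = d + 1)"

definition link :: "nat set set \<Rightarrow> nat set \<Rightarrow> nat set set" where
  "link X \<tau> = {T - \<tau> | T. T \<in> X \<and> \<tau> \<subseteq> T}"

text \<open>Faces with i+1 vertices (X(i)); we index by cardinality m = i + 1.\<close>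
definition faces_card :: "nat set set \<Rightarrow> nat \<Rightarrow> nat set set" where
  "faces_card X m = {F \<in> X. card F = m}"

text \<open>Weight of edge {u,v} in the 1-skeleton of the link Y = X_tau of a face tau of
  X(k) in a pure d-dimensional complex: (d-k-2)! times the number of top faces
  of Y (elements of Y(d-k-1), i.e. of cardinality d-k) containing {u,v}.
  Here dk = d - k is passed directly.\<close>
definition skel_weight :: "nat set set \<Rightarrow> nat \<Rightarrow> nat \<Rightarrow> nat \<Rightarrow> real" where
  "skel_weight Y dk u v =
     real (fact (dk - 2)) * real (card {\<pi> \<in> faces_card Y dk. {u, v} \<subseteq> \<pi>})"

definition skel_vertices :: "nat set set \<Rightarrow> nat set" where
  "skel_vertices Y = {v. {v} \<in> Y}"

definition transition :: "nat set set \<Rightarrow> nat \<Rightarrow> nat \<Rightarrow> nat \<Rightarrow> real" where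
  "transition Y dk v u =
     (if {u, v} \<in> faces_card Y 2
      then skel_weight Y dk u v /
           (\<Sum>x\<in>{x. {x, v} \<in> faces_card Y 2}. skel_weight Y dk x v)
      else 0)"

definition transition_mat :: "nat set set \<Rightarrow> nat \<Rightarrow> real mat" where
  "transition_mat Y dk =
     (let vs = sorted_list_of_set (skel_vertices Y)
      in mat (length vs) (length vs) (\<lambda>(i, j). transition Y dk (vs ! i) (vs ! j)))"

text \<open>Eigenvalues with multiplicity (roots of the characteristic polynomial; the
  transition matrix of a weighted graph is similar to a symmetric matrix, so all
  eigenvalues are real), sorted in decreasing order.\<close>
definition eigenvalues_desc :: "real mat \<Rightarrow> real list" where
  "eigenvalues_desc A = rev (sorted_list_of_multiset (proots (char_poly A)))"

definition lambda2 :: "real mat \<Rightarrow> real" where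
  "lambda2 A = eigenvalues_desc A ! 1"

definition one_sided_spectral_expander :: "nat set set \<Rightarrow> nat \<Rightarrow> real \<Rightarrow> bool" where
  "one_sided_spectral_expander Y dk lam \<longleftrightarrow> lambda2 (transition_mat Y dk) \<le> lam"

text \<open>One-sided lambda-high-dimensional expander, for a pure d-dimensional complex X.
  A face tau in X(k), -1 \<le> k \<le> d-2, has card tau = k+1 \<le> d-1, and
  d - k = d + 1 - card tau. The case tau = {} is X itself (its link).\<close>
definition hd_expander :: "nat set set \<Rightarrow> nat \<Rightarrow> real \<Rightarrow> bool" where
  "hd_expander X d lam \<longleftrightarrow> pure_dim X d \<and>
     (\<forall>\<tau>\<in>X. card \<tau> + 1 \<le> d \<longrightarrow>
        one_sided_spectral_expander (link X \<tau>) (d + 1 - card \<tau>) lam)"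

definition local_spectral_expander :: "nat set \<Rightarrow> nat set set \<Rightarrow> real \<Rightarrow> bool" where
  "local_spectral_expander V E lam \<longleftrightarrow>
     (\<exists>d. hd_expander (clique_complex V E) d lam)"

end

(* The graphs are the 1-skeleta of coset complexes. Take the algebra of words in letters 0..d over a
   finite field of q elements, truncated at length L and with every word killed in which two equal
   letters are at distance at most d; the unit group elements 1 + a x_i generate a finite group. Killing
   all words that contain a letter i is a group retraction, and these d + 1 commuting retractions make the
   coset complex of their images H_0, ..., H_d a flag complex, so that it is a clique complex. Permuting
   letters shows that intersections of k of the H_i have the same order, which for k > 0 does not depend
   on L because words avoiding a letter have length at most d; this gives the regularity, with degrees
   independent of L, while the order of the group grows with L. The links of codimension 2 are incidence
   graphs of an affine plane minus a parallel class, with second singular value 1 / sqrt q, and a version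
   of Oppenheim's trickling-down theorem for pairs of subgroups bounds all other links. *)

theory Submission
  imports Defs "HOL-Algebra.Algebraic_Closure_Type" "HOL-Algebra.Generated_Groups" "HOL-Library.Z2"
    "HOL-Combinatorics.Permutations" "Jordan_Normal_Form.Schur_Decomposition"
begin

section \<open>Finite fields of unbounded size\<close>

text \<open>The relation on words is chosen to do several things at once. The periodic words, with
  equal letters d + 1 apart, survive at every length, so the group is unbounded. Each x_i squares to
  zero, so the elements 1 + a x_i form a copy of the additive group. As d is at least 2, x_s x_t x_s
  vanishes too, and the group on two letters is the Heisenberg group over the field, which is where
  the plane comes from. The relation is symmetric in the letters.

  Links are treated through pairs of subgroups because they are partite: in the quadratic form of
  the walk, the means over the single types contribute a non-positive term, and the rest is a sum
  over pairs of types. This is why the bound is one-sided. Trickling down replaces lam by lam / (1 -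
  lam), that is, lowers 1 / lam by one; fewer than d rounds lead from 1 / sqrt q to at most 1 /
  (sqrt q - d), which dictates the size of q. Each round needs an a priori angle below 1, which
  generation supplies without quantitative control.\<close>

lemma exists_finite_subfield:
  "\<exists>R :: bit alg_closure set. finite R \<and> N \<le> card R \<and> 0 \<in> R \<and> 1 \<in> R \<and>
     (\<forall>x\<in>R. \<forall>y\<in>R. x + y \<in> R \<and> x * y \<in> R) \<and> (\<forall>x\<in>R. - x \<in> R)"
proof -
  define q :: nat where "q = 2 ^ (Suc N)"
  \<comment> \<open>The fixed points of a power of Frobenius in an algebraic closure of the field
    with two elements. Closure under sums is \<open>frob\<close>, and there are exactly
    \<open>q\<close> of them because \<open>P\<close> = X^q - X has derivative -1 and hence no
    multiple root.\<close>
  define R where "R = {x :: bit alg_closure. x ^ q = x}"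
  define P :: "bit alg_closure poly" where "P = Polynomial.monom 1 q - [:0, 1:]"
  have two: "(1::bit alg_closure) + 1 = 0"
  proof -
    have "to_ac (1 + 1 :: bit) = 0" by simp
    then show ?thesis by (simp only: to_ac_add to_ac_1)
  qed
  have dbl: "x + x = 0" for x :: "bit alg_closure"
    using two by (metis distrib_right mult_1 mult_zero_left)
  have frob: "(x + y) ^ (2 ^ k) = x ^ (2 ^ k) + y ^ (2 ^ k)" for x y :: "bit alg_closure" and k :: nat
  proof (induction k)
    case (Suc k)
    have "(u + v)^2 = u^2 + v^2" for u v :: "bit alg_closure"
      using dbl[of "u * v"] by (simp add: power2_eq_square algebra_simps)
    with Suc show ?case by (simp add: power_mult mult.commute[of 2])
  qed simp
  have q2: "q \<ge> 2" unfolding q_def by simp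
  have degP: "Polynomial.degree P = q"
    using q2 unfolding P_def by (simp only: diff_conv_add_uminus, subst degree_add_eq_left) (auto simp: Polynomial.degree_monom_eq)
  have P0: "P \<noteq> 0" using degP q2 by auto
  have polyP: "poly P x = x ^ q - x" for x unfolding P_def by (simp add: poly_monom)
  have "of_nat q = (0 :: bit alg_closure)"
    unfolding q_def using two by simp
  then have "pderiv P = - 1"
    unfolding P_def by (simp add: pderiv_diff pderiv_monom pderiv_pCons one_pCons)
  then have pd: "poly (pderiv P) a \<noteq> 0" for a by simp
  have simple: "Polynomial.order a P \<le> 1" for a
  proof (rule ccontr)
    assume "\<not> Polynomial.order a P \<le> 1"
    then have "[:- a, 1:] ^ 2 dvd P" by (simp add: order_divides)
    then obtain Q where "P = [:- a, 1:] ^ 2 * Q" by (rule dvdE)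
    then have "P = [:- a, 1:] * ([:- a, 1:] * Q)" by (simp only: power2_eq_square mult.assoc)
    then have "poly (pderiv P) a = 0" by (simp add: pderiv_mult del: mult_pCons_left)
    then show False using pd by simp
  qed
  obtain A where A: "size A = q" "P = Polynomial.smult (Polynomial.lead_coeff P) (\<Prod>x\<in>#A. [:-x, 1:])"
    using alg_closed_imp_factorization[OF P0] degP by auto
  have "(\<Prod>x\<in>#B. [:- x, 1:]) \<noteq> 0 \<and> proots (\<Prod>x\<in>#B. [:- x, 1:]) = B" for B :: "bit alg_closure multiset"
    by (induction B) (simp_all add: proots_mult del: mult_pCons_left)
  then have pr: "proots P = A"
    using A(2) P0 by (metis leading_coeff_0_iff proots_smult)
  have "count A x = 1" if "x \<in># A" for x
  proof -
    have "count A x = Polynomial.order x P" using pr P0 by auto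
    moreover have "count A x > 0" using that by simp
    ultimately show ?thesis using simple[of x] by simp
  qed
  then have "size A = card (set_mset A)"
    by (simp add: size_multiset_overloaded_eq)
  moreover have "set_mset A = R"
    using pr P0 set_count_proots[of P] by (auto simp: R_def polyP)
  ultimately have card: "card R = q" using A(1) by simp
  have "N \<le> q" unfolding q_def by (meson le_SucI less_exp less_imp_le_nat order.trans power_increasing_iff lessI)
  moreover have "finite R" using card q2 by (metis card.infinite not_numeral_le_zero)
  moreover have "- x = x" for x :: "bit alg_closure" using dbl by (simp add: eq_neg_iff_add_eq_0 minus_unique)
  ultimately show ?thesis
    using card q2 frob[of _ _ "Suc N"] by (intro exI[of _ R]) (auto simp: R_def q_def power_mult_distrib)
qed

section \<open>The second eigenvalue of a symmetric matrix\<close>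

text \<open>Guarantees that the list of real roots has all n entries, so that its entry 1 is a
  genuine second eigenvalue. A complex root a with eigenvector v is real because the Hermitian form
  of A at v is invariant under conjugation and equals a times the positive number |v|^2; the
  factorisation then descends along the injective map of polynomials.\<close>

lemma symmetric_char_poly_splits:
  fixes A :: "real mat"
  assumes A: "A \<in> carrier_mat n n"
    and sym: "\<And>i j. i < n \<Longrightarrow> j < n \<Longrightarrow> A $$ (i, j) = A $$ (j, i)"
  shows "\<exists>rs. char_poly A = (\<Prod>r\<leftarrow>rs. [:- r, 1:]) \<and> length rs = n"
proof -
  let ?C = "map_mat complex_of_real A"
  have C: "?C \<in> carrier_mat n n" using A by auto
  obtain as where as: "char_poly ?C = (\<Prod>a\<leftarrow>as. [:- a, 1:])" "length as = n"
    using char_poly_factorized[OF C] by auto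
  have real: "a = complex_of_real (Re a)" if "a \<in> set as" for a
  proof -
    have "poly (char_poly ?C) a = 0"
      unfolding as(1) poly_prod_list using that by (auto simp: prod_list_zero_iff image_iff)
    then have "eigenvalue ?C a" using eigenvalue_root_char_poly[OF C] by simp
    then obtain v where v: "v \<in> carrier_vec n" "v \<noteq> 0\<^sub>v n" "?C *\<^sub>v v = a \<cdot>\<^sub>v v"
      using A unfolding eigenvalue_def eigenvector_def by auto
    have ev: "(\<Sum>j<n. complex_of_real (A $$ (i, j)) * v $ j) = a * v $ i" if "i < n" for i
    proof -
      have "(?C *\<^sub>v v) $ i = a * v $ i" using v that by simp
      moreover have "(?C *\<^sub>v v) $ i = (\<Sum>j<n. complex_of_real (A $$ (i, j)) * v $ j)"
        using A v(1) that by (auto simp: scalar_prod_def lessThan_atLeast0 intro!: sum.cong)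
      ultimately show ?thesis by simp
    qed
    define N where "N = (\<Sum>i<n. cnj (v $ i) * v $ i)"
    define S where "S = (\<Sum>i<n. \<Sum>j<n. cnj (v $ i) * complex_of_real (A $$ (i, j)) * v $ j)"
    have "S = (\<Sum>i<n. cnj (v $ i) * (a * v $ i))"
      unfolding S_def by (intro sum.cong refl) (simp add: ev[symmetric] sum_distrib_left mult.assoc)
    then have SN: "S = a * N" unfolding N_def by (simp add: sum_distrib_left algebra_simps)
    have "cnj S = (\<Sum>i<n. \<Sum>j<n. v $ i * complex_of_real (A $$ (i, j)) * cnj (v $ j))"
      unfolding S_def by (simp add: cnj_sum)
    also have "\<dots> = (\<Sum>j<n. \<Sum>i<n. v $ i * complex_of_real (A $$ (i, j)) * cnj (v $ j))"
      by (rule sum.swap)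
    also have "\<dots> = S" unfolding S_def
      by (intro sum.cong refl) (simp add: sym algebra_simps)
    finally have cS: "cnj S = S" .
    have Nr: "N = complex_of_real (\<Sum>i<n. (cmod (v $ i))\<^sup>2)"
      unfolding N_def of_real_sum
      by (intro sum.cong refl) (metis complex_norm_square mult.commute of_real_power)
    obtain i where i: "i < n" "v $ i \<noteq> 0" using v(1,2) by (metis eq_vecI index_zero_vec carrier_vecD)
    have "(\<Sum>i<n. (cmod (v $ i))\<^sup>2) > 0"
      by (rule sum_pos2[of _ i]) (use i in auto)
    then have N0: "N \<noteq> 0" unfolding Nr by (metis less_irrefl of_real_eq_0_iff)
    have "cnj a * N = a * N" using cS SN Nr by (metis complex_cnj_complex_of_real complex_cnj_mult)
    then have "cnj a = a" using N0 by simp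
    then show ?thesis by (simp add: complex_eq_iff)
  qed
  define rs where "rs = map Re as"
  interpret mp: map_poly_inj_comm_ring_hom complex_of_real ..
  have "map_poly complex_of_real (char_poly A) = char_poly ?C"
    by (rule of_real_hom.char_poly_hom[OF A, symmetric])
  also have "\<dots> = (\<Prod>r\<leftarrow>rs. [:- complex_of_real r, 1:])"
    unfolding as(1) rs_def map_map o_def
    by (rule arg_cong[where f = prod_list], rule map_cong[OF refl]) (metis real)
  also have "\<dots> = map_poly complex_of_real (\<Prod>r\<leftarrow>rs. [:- r, 1:])"
    by (simp add: mp.hom_prod_list o_def)
  finally have "char_poly A = (\<Prod>r\<leftarrow>rs. [:- r, 1:])" by (rule mp.injectivity)
  moreover have "length rs = n" using as(2) unfolding rs_def by simp
  ultimately show ?thesis by blast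
qed

text \<open>The second root, counted with multiplicity, has to be reached from a bound on sum-zero
  functions. A Schur form with the roots in decreasing order supplies columns \<open>v0\<close> and
  \<open>v1\<close>; if the second root exceeded \<open>c\<close>, so would the first, which forces
  \<open>v0\<close> to be constant, and then \<open>v1\<close> minus its mean would be a sum-zero
  eigenvector violating the bound.\<close>

lemma lambda2_le:
  fixes A :: "real mat"
  assumes A: "A \<in> carrier_mat n n" and n: "2 \<le> n"
    and sym: "\<And>i j. i < n \<Longrightarrow> j < n \<Longrightarrow> A $$ (i, j) = A $$ (j, i)"
    and rows: "\<And>i. i < n \<Longrightarrow> (\<Sum>j<n. A $$ (i, j)) = 1"
    and quad: "\<And>f. (\<Sum>i<n. f i) = 0 \<Longrightarrow>
      (\<Sum>i<n. \<Sum>j<n. f i * A $$ (i, j) * f j) \<le> c * (\<Sum>i<n. (f i)\<^sup>2)"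
    and c: "c < 1"
  shows "lambda2 A \<le> c"
proof -
  obtain rs where rs: "char_poly A = (\<Prod>r\<leftarrow>rs. [:- r, 1:])" "length rs = n"
    using symmetric_char_poly_splits[OF A sym] by auto
  have "(\<Prod>r\<leftarrow>xs. [:- r, 1:]) \<noteq> 0 \<and> proots (\<Prod>r\<leftarrow>xs. [:- r, 1:]) = mset xs" for xs :: "real list"
    by (induction xs) (simp_all add: proots_mult del: mult_pCons_left)
  then have pr: "proots (char_poly A) = mset rs" using rs(1) by simp
  define es where "es = eigenvalues_desc A"
  have es: "es = rev (sort rs)" unfolding es_def eigenvalues_desc_def pr by simp
  have len: "length es = n" using es rs by simp
  have "sorted_wrt (\<ge>) es" unfolding es by (simp add: sorted_wrt_rev)
  then have ord: "es ! 1 \<le> es ! 0" using n len by (auto simp: sorted_wrt_iff_nth_less)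
  have "mset es = mset rs" unfolding es by simp
  then have "prod_mset (mset (map (\<lambda>r. [:- r, 1:]) es)) = prod_mset (mset (map (\<lambda>r. [:- r, 1:]) rs))"
    by simp
  then have ces: "char_poly A = (\<Prod>r\<leftarrow>es. [:- r, 1:])"
    unfolding rs(1) prod_mset_prod_list by simp
  obtain B P Q where BPQ: "schur_decomposition A es = (B, P, Q)" by (cases "schur_decomposition A es") auto
  from schur_decomposition[OF A ces BPQ]
  have sim: "similar_mat_wit A B P Q" and ut: "upper_triangular B" and dg: "diag_mat B = es" by auto
  from similar_mat_witD2[OF A sim]
  have QP: "Q * P = 1\<^sub>m n" and APBQ: "A = P * B * Q"
    and B: "B \<in> carrier_mat n n" and P: "P \<in> carrier_mat n n" and Q: "Q \<in> carrier_mat n n"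
    by auto
  have "A * P = P * B * (Q * P)" unfolding APBQ using B P Q by (simp add: assoc_mult_mat[of _ n n _ n _ n])
  then have AP: "A * P = P * B" using QP B P by simp
  have AP': "(\<Sum>j<n. A $$ (i, j) * P $$ (j, k)) = (\<Sum>j<n. P $$ (i, j) * B $$ (j, k))"
    if "i < n" "k < n" for i k
  proof -
    have "(A * P) $$ (i, k) = (P * B) $$ (i, k)" using AP by simp
    then show ?thesis using A P B that
      by (simp add: scalar_prod_def lessThan_atLeast0)
  qed
  have QP': "(\<Sum>j<n. Q $$ (i, j) * P $$ (j, k)) = (if i = k then 1 else 0)"
    if "i < n" "k < n" for i k
  proof -
    have "(Q * P) $$ (i, k) = (1\<^sub>m n) $$ (i, k)" using QP by simp
    then show ?thesis using P Q that
      by (simp add: scalar_prod_def lessThan_atLeast0)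
  qed
  have Bd: "B $$ (k, k) = es ! k" if "k < n" for k
    unfolding dg[symmetric] diag_mat_def using B that by simp
  have Bl: "B $$ (j, k) = 0" if "k < j" "j < n" for j k
    using ut B that unfolding upper_triangular_def by auto
  define v0 v1 where "v0 i = P $$ (i, 0)" and "v1 i = P $$ (i, 1)" for i
  \<comment> \<open>\<open>P\<close> is only known to be invertible, so its second column is an
    eigenvector merely up to the multiple \<open>b\<close> of the first.\<close>
  define b where "b = B $$ (0, 1)"
  have A0: "(\<Sum>j<n. A $$ (i, j) * v0 j) = es ! 0 * v0 i" if "i < n" for i
  proof -
    have "(\<Sum>j<n. A $$ (i, j) * v0 j) = (\<Sum>j<n. P $$ (i, j) * B $$ (j, 0))"
      unfolding v0_def using AP'[of i 0] that n by simp
    also have "\<dots> = (\<Sum>j\<in>{0}. P $$ (i, j) * B $$ (j, 0))"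
      by (rule sum.mono_neutral_right) (use n Bl in auto)
    finally show ?thesis using Bd[of 0] n by (simp add: v0_def)
  qed
  have A1: "(\<Sum>j<n. A $$ (i, j) * v1 j) = b * v0 i + es ! 1 * v1 i" if "i < n" for i
  proof -
    have "(\<Sum>j<n. A $$ (i, j) * v1 j) = (\<Sum>j<n. P $$ (i, j) * B $$ (j, 1))"
      unfolding v1_def using AP'[of i 1] that n by simp
    also have "\<dots> = (\<Sum>j\<in>{0, 1}. P $$ (i, j) * B $$ (j, 1))"
      by (rule sum.mono_neutral_right) (use n Bl in auto)
    finally show ?thesis using Bd[of 1] n by (simp add: v0_def v1_def b_def)
  qed
  have colsum: "(\<Sum>i<n. \<Sum>j<n. A $$ (i, j) * f j) = (\<Sum>j<n. f j)" for f
  proof -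
    have "(\<Sum>i<n. \<Sum>j<n. A $$ (i, j) * f j) = (\<Sum>j<n. (\<Sum>i<n. A $$ (i, j)) * f j)"
      by (subst sum.swap) (simp add: sum_distrib_right)
    also have "\<dots> = (\<Sum>j<n. f j)"
    proof (rule sum.cong[OF refl])
      fix j assume "j \<in> {..<n}"
      then have "(\<Sum>i<n. A $$ (i, j)) = (\<Sum>i<n. A $$ (j, i))" by (intro sum.cong) (auto simp: sym)
      then show "(\<Sum>i<n. A $$ (i, j)) * f j = f j" using rows[of j] \<open>j \<in> {..<n}\<close> by simp
    qed
    finally show ?thesis .
  qed
  have key: "e \<le> c" if g: "(\<Sum>i<n. g i) = 0" and Ag: "\<And>i. i < n \<Longrightarrow> (\<Sum>j<n. A $$ (i, j) * g j) = e * g i"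
    and g0: "\<exists>i<n. g i \<noteq> 0" for e g
  proof -
    have "(\<Sum>i<n. \<Sum>j<n. g i * A $$ (i, j) * g j) = (\<Sum>i<n. g i * (\<Sum>j<n. A $$ (i, j) * g j))"
      by (simp add: sum_distrib_left mult.assoc)
    also have "\<dots> = e * (\<Sum>i<n. (g i)\<^sup>2)"
      using Ag by (simp add: sum_distrib_left power2_eq_square algebra_simps)
    finally have "e * (\<Sum>i<n. (g i)\<^sup>2) \<le> c * (\<Sum>i<n. (g i)\<^sup>2)" using quad[OF g] by simp
    moreover obtain i where "i < n" "g i \<noteq> 0" using g0 by auto
    then have "(\<Sum>i<n. (g i)\<^sup>2) > 0" by (intro sum_pos2[of _ i]) auto
    ultimately show ?thesis by simp
  qed
  have A_shift: "(\<Sum>j<n. A $$ (i, j) * (f j - m)) = (\<Sum>j<n. A $$ (i, j) * f j) - m" if "i < n" for f m i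
    using rows[OF that] by (simp add: right_diff_distrib sum_subtractf flip: sum_distrib_right)
  have centred: "(\<Sum>i<n. f i - (\<Sum>i<n. f i) / n) = 0" for f
    using n by (simp add: sum_subtractf)
  have "es ! 1 \<le> c"
  proof (rule ccontr)
    assume "\<not> es ! 1 \<le> c"
    then have e1: "es ! 1 > c" and e0: "es ! 0 > c" using ord by auto
    have v0n: "\<exists>i<n. v0 i \<noteq> 0"
    proof (rule ccontr)
      assume "\<not> ?thesis"
      then have "(\<Sum>j<n. Q $$ (0, j) * P $$ (j, 0)) = 0" unfolding v0_def by (intro sum.neutral) auto
      then show False using QP'[of 0 0] n by simp
    qed
    \<comment> \<open>\<open>A\<close> preserves sums, so an eigenvector for any other eigenvalue
      has sum zero and \<open>key\<close> applies to it.\<close>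
    have "es ! 0 = 1"
    proof (rule ccontr)
      assume "es ! 0 \<noteq> 1"
      moreover have "(\<Sum>i<n. v0 i) = es ! 0 * (\<Sum>i<n. v0 i)"
        using colsum[of v0] A0 by (simp add: sum_distrib_left)
      ultimately have "(\<Sum>i<n. v0 i) = 0" by (metis mult_cancel_right1)
      then show False using key[OF _ A0 v0n] e0 by simp
    qed
    define m where "m = (\<Sum>i<n. v0 i) / n"
    have v0m: "v0 i = m" if "i < n" for i
    proof (rule ccontr)
      assume "v0 i \<noteq> m"
      then have ex: "\<exists>i<n. v0 i - m \<noteq> 0" using that by auto
      have "(\<Sum>j<n. A $$ (i, j) * (v0 j - m)) = 1 * (v0 i - m)" if "i < n" for i
        using A_shift[OF that, of v0 m] A0[OF that] \<open>es ! 0 = 1\<close> by simp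
      from key[OF _ this ex] show False using centred[of v0] c unfolding m_def by simp
    qed
    have m0: "m \<noteq> 0" using v0n v0m by auto
    define m1 where "m1 = (\<Sum>i<n. v1 i) / n"
    have Ag: "(\<Sum>j<n. A $$ (i, j) * (v1 j - m1)) = es ! 1 * (v1 i - m1) + (b * m + es ! 1 * m1 - m1)"
      if "i < n" for i
      using A_shift[OF that, of v1 m1] A1[OF that] v0m[OF that] by (simp add: algebra_simps)
    \<comment> \<open>Both sums of the centred function vanish, so the additive constant in
      \<open>Ag\<close> does too.\<close>
    have "0 = (\<Sum>i<n. \<Sum>j<n. A $$ (i, j) * (v1 j - m1))"
      using colsum[of "\<lambda>j. v1 j - m1"] centred[of v1] unfolding m1_def by simp
    also have "\<dots> = (\<Sum>i<n. es ! 1 * (v1 i - m1) + (b * m + es ! 1 * m1 - m1))"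
      using Ag by simp
    also have "\<dots> = es ! 1 * (\<Sum>i<n. v1 i - m1) + n * (b * m + es ! 1 * m1 - m1)"
      by (simp only: sum.distrib sum_distrib_left) simp
    also have "(\<Sum>i<n. v1 i - m1) = 0" using centred[of v1] unfolding m1_def .
    finally have "b * m + es ! 1 * m1 - m1 = 0" using n by simp
    with Ag have Ag': "(\<Sum>j<n. A $$ (i, j) * (v1 j - m1)) = es ! 1 * (v1 i - m1)" if "i < n" for i
      using that by simp
    \<comment> \<open>Otherwise the first two columns of \<open>P\<close> would be proportional,
      contradicting \<open>QP\<close>.\<close>
    have "\<exists>i<n. v1 i - m1 \<noteq> 0"
    proof (rule ccontr)
      assume "\<not> ?thesis"
      then have v1m: "v1 i = m1" if "i < n" for i using that by auto
      have "(\<Sum>j<n. Q $$ (1, j) * v0 j) = 0" "(\<Sum>j<n. Q $$ (1, j) * v1 j) = 1"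
        using QP'[of 1 0] QP'[of 1 1] n unfolding v0_def v1_def by auto
      then have "(\<Sum>j<n. Q $$ (1, j)) * m = 0" "(\<Sum>j<n. Q $$ (1, j)) * m1 = 1"
        using v0m v1m by (auto simp: sum_distrib_right)
      then show False using m0 by auto
    qed
    from key[OF _ Ag' this] show False using centred[of v1] e1 unfolding m1_def by simp
  qed
  then show ?thesis unfolding lambda2_def es_def .
qed

section \<open>Clique complexes of chamber systems\<close>

lemma sum_constant_fibres:
  fixes f :: "'b \<Rightarrow> real"
  assumes A: "finite A" and fib: "\<And>y. y \<in> A \<Longrightarrow> card {z \<in> A. \<phi> z = \<phi> y} = m"
  shows "(\<Sum>y\<in>A. f (\<phi> y)) = m * (\<Sum>p\<in>\<phi> ` A. f p)"
proof -
  have "(\<Sum>y\<in>A. f (\<phi> y)) = (\<Sum>p\<in>\<phi> ` A. \<Sum>y\<in>{y \<in> A. \<phi> y = p}. f (\<phi> y))"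
    by (rule sum.image_gen[OF A])
  also have "\<dots> = (\<Sum>p\<in>\<phi> ` A. m * f p)"
    by (intro sum.cong refl) (use fib in auto)
  finally show ?thesis by (simp add: sum_distrib_left)
qed

lemma card_constant_fibres:
  assumes A: "finite A" and fib: "\<And>y. y \<in> A \<Longrightarrow> card {z \<in> A. \<phi> z = \<phi> y} = m"
  shows "card A = m * card (\<phi> ` A)"
proof -
  have "real (card A) = real (m * card (\<phi> ` A))"
    using sum_constant_fibres[where f = "\<lambda>_. 1" and \<phi> = \<phi>, OF assms] by simp
  then show ?thesis by (rule of_nat_eq_iff[THEN iffD1])
qed

text \<open>\<open>v i x\<close> is the vertex of type \<open>i\<close> of the chamber \<open>x\<close>, so two chambers span a common face of type
  \<open>S\<close> iff their values \<open>v i\<close> agree for \<open>i \<in> S\<close>.\<close>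
locale chamber_system =
  fixes Om :: "'c set" and d :: nat and v :: "nat \<Rightarrow> 'c \<Rightarrow> nat" and h :: "nat \<Rightarrow> nat" and c :: real
  assumes finite_Om: "finite Om" and Om_ne: "Om \<noteq> {}"
    and vertex_type: "\<And>i j x y. i \<le> d \<Longrightarrow> j \<le> d \<Longrightarrow> x \<in> Om \<Longrightarrow> y \<in> Om \<Longrightarrow> v i x = v j y \<Longrightarrow> i = j"
    and card_residue: "\<And>S x. S \<subseteq> {..d} \<Longrightarrow> x \<in> Om \<Longrightarrow> card {y \<in> Om. \<forall>i\<in>S. v i y = v i x} = h (card S)"
    and h_top: "h (d + 1) = 1"
    and flag: "\<And>T g. T \<subseteq> {..d} \<Longrightarrow> (\<And>i. i \<in> T \<Longrightarrow> g i \<in> Om) \<Longrightarrow>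
      (\<And>i j. i \<in> T \<Longrightarrow> j \<in> T \<Longrightarrow> \<exists>z\<in>Om. v i z = v i (g i) \<and> v j z = v j (g j)) \<Longrightarrow>
      \<exists>z\<in>Om. \<forall>i\<in>T. v i z = v i (g i)"
    and angle: "\<And>S x s t F F'. S \<subseteq> {..d} \<Longrightarrow> x \<in> Om \<Longrightarrow> s \<in> {..d} - S \<Longrightarrow> t \<in> {..d} - S \<Longrightarrow> s \<noteq> t \<Longrightarrow>
      (\<Sum>y\<in>{y \<in> Om. \<forall>i\<in>S. v i y = v i x}. F (v s y) * F' (v t y)) \<le>
      (\<Sum>y\<in>{y \<in> Om. \<forall>i\<in>S. v i y = v i x}. F (v s y)) *
      (\<Sum>y\<in>{y \<in> Om. \<forall>i\<in>S. v i y = v i x}. F' (v t y)) / h (card S) +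
      c / 2 * ((\<Sum>y\<in>{y \<in> Om. \<forall>i\<in>S. v i y = v i x}. (F (v s y))\<^sup>2) +
               (\<Sum>y\<in>{y \<in> Om. \<forall>i\<in>S. v i y = v i x}. (F' (v t y))\<^sup>2))"
    and c_lt: "c < 1"
begin

definition residue :: "nat set \<Rightarrow> 'c \<Rightarrow> 'c set" where
  "residue S x = {y \<in> Om. \<forall>i\<in>S. v i y = v i x}"

definition face :: "nat set \<Rightarrow> 'c \<Rightarrow> nat set" where
  "face S x = (\<lambda>i. v i x) ` S"

definition verts :: "nat set" where
  "verts = (\<Union>i\<in>{..d}. v i ` Om)"

definition edges :: "nat set set" where
  "edges = {{v i x, v j x} | i j x. i \<le> d \<and> j \<le> d \<and> i \<noteq> j \<and> x \<in> Om}"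

definition nbhd :: "nat set \<Rightarrow> 'c \<Rightarrow> nat set" where
  "nbhd S x = (\<Union>t\<in>{..d} - S. v t ` residue S x)"

text \<open>The number of vertices of one given type in the link of a face with \<open>i\<close>
  vertices (\<open>card_image_residue\<close>).\<close>

definition ratio :: "nat \<Rightarrow> nat" where
  "ratio i = h i div h (Suc i)"

text \<open>A vertex in the link of a face with \<open>i\<close> vertices leaves
  \<open>d - i\<close> types, with \<open>ratio (Suc i)\<close> neighbours of each.\<close>

definition deg :: "nat \<Rightarrow> nat" where
  "deg i = (d - i) * ratio (Suc i)"

section \<open>Counting chambers and vertices in residues\<close>

lemma card_residue': "S \<subseteq> {..d} \<Longrightarrow> x \<in> Om \<Longrightarrow> card (residue S x) = h (card S)"
  unfolding residue_def by (rule card_residue)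

lemma residue_subset: "residue S x \<subseteq> Om" unfolding residue_def by auto

lemma finite_residue: "finite (residue S x)"
  using finite_subset[OF residue_subset finite_Om] .

lemma residue_self: "x \<in> Om \<Longrightarrow> x \<in> residue S x" unfolding residue_def by auto

lemma residue_insert: "y \<in> residue S x \<Longrightarrow> residue (insert t S) y = {z \<in> residue S x. v t z = v t y}"
  unfolding residue_def by auto

lemma h_pos: "i \<le> d + 1 \<Longrightarrow> h i > 0"
proof -
  assume "i \<le> d + 1"
  then have S: "{..<i} \<subseteq> {..d}" by auto
  obtain x where x: "x \<in> Om" using Om_ne by auto
  have "card (residue {..<i} x) > 0" using residue_self[OF x] finite_residue by (auto simp: card_gt_0_iff)
  then show ?thesis using card_residue'[OF S x] by simp
qed

lemma card_insert_type: "S \<subseteq> {..d} \<Longrightarrow> t \<in> {..d} - S \<Longrightarrow> card (insert t S) = Suc (card S)"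
  by (metis DiffE card_insert_disjoint finite_atMost finite_subset)

lemma residue_fibre:
  assumes "S \<subseteq> {..d}" "x \<in> Om" "t \<in> {..d} - S" "y \<in> residue S x"
  shows "card {z \<in> residue S x. v t z = v t y} = h (Suc (card S))"
proof -
  have "y \<in> Om" using assms(4) residue_subset by auto
  then have "card (residue (insert t S) y) = h (card (insert t S))"
    using assms by (intro card_residue') auto
  then show ?thesis using residue_insert[OF assms(4)] card_insert_type[OF assms(1,3)] by simp
qed

lemma h_eq_card_image:
  assumes "S \<subseteq> {..d}" "x \<in> Om" "t \<in> {..d} - S"
  shows "h (card S) = h (Suc (card S)) * card (v t ` residue S x)"
  using card_constant_fibres[OF finite_residue residue_fibre[OF assms]] card_residue'[OF assms(1,2)] by simp

lemma card_less_type: "S \<subseteq> {..d} \<Longrightarrow> t \<in> {..d} - S \<Longrightarrow> card S \<le> d"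
proof -
  assume *: "S \<subseteq> {..d}" "t \<in> {..d} - S"
  then have "S \<subseteq> {..d} - {t}" by auto
  then have "card S \<le> card ({..d} - {t})" by (intro card_mono) auto
  then show ?thesis using * by simp
qed

lemma card_image_residue:
  assumes "S \<subseteq> {..d}" "x \<in> Om" "t \<in> {..d} - S"
  shows "card (v t ` residue S x) = ratio (card S)"
  unfolding ratio_def using h_eq_card_image[OF assms] h_pos[of "Suc (card S)"] card_less_type[OF assms(1,3)]
  by simp

lemma h_eq: "i \<le> d \<Longrightarrow> h i = ratio i * h (Suc i)"
proof -
  assume i: "i \<le> d"
  then have S: "{..<i} \<subseteq> {..d}" "i \<in> {..d} - {..<i}" by auto
  obtain x where x: "x \<in> Om" using Om_ne by auto
  show ?thesis
    using h_eq_card_image[OF S(1) x S(2)] card_image_residue[OF S(1) x S(2)] by simp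
qed

lemma ratio_pos: "i \<le> d \<Longrightarrow> ratio i > 0"
  using h_eq[of i] h_pos[of i] by (cases "ratio i") auto

text \<open>Enlarging a face shrinks its residue and hence the set of vertices of type
  \<open>Suc i\<close> in it. The strict decrease of \<open>deg\<close> then comes from the factor
  \<open>d - i\<close>.\<close>

lemma ratio_antimono: "Suc i \<le> d \<Longrightarrow> ratio (Suc i) \<le> ratio i"
proof -
  assume i: "Suc i \<le> d"
  let ?S = "{..<i}"
  have S: "?S \<subseteq> {..d}" "Suc i \<in> {..d} - ?S" "insert i ?S \<subseteq> {..d}" "Suc i \<in> {..d} - insert i ?S" using i by auto
  obtain x where x: "x \<in> Om" using Om_ne by auto
  have "card (v (Suc i) ` residue (insert i ?S) x) \<le> card (v (Suc i) ` residue ?S x)"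
    by (intro card_mono finite_imageI finite_residue image_mono) (auto simp: residue_def)
  then show ?thesis
    using card_image_residue[OF S(1) x S(2)] card_image_residue[OF S(3) x S(4)] by simp
qed

lemma deg_pos: "i < d \<Longrightarrow> deg i > 0"
  unfolding deg_def using ratio_pos[of "Suc i"] by simp

lemma deg_decreasing:
  assumes "j < i" "i < d"
  shows "deg i < deg j"
  using assms
proof (induction i)
  case (Suc i)
  have "deg (Suc i) < deg i"
    unfolding deg_def
  proof (rule mult_less_le_imp_less)
    show "d - Suc i < d - i" using Suc by simp
    show "ratio (Suc (Suc i)) \<le> ratio (Suc i)" using Suc by (intro ratio_antimono) simp
    show "0 < ratio (Suc (Suc i))" using Suc by (intro ratio_pos) simp
  qed simp
  then show ?case using Suc by (cases "j = i") auto
qed simp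

section \<open>Faces, cliques and regularity\<close>

lemma edge_iff:
  assumes "i \<le> d" "j \<le> d" "x \<in> Om" "y \<in> Om"
  shows "{v i x, v j y} \<in> edges \<longleftrightarrow> i \<noteq> j \<and> (\<exists>z\<in>Om. v i z = v i x \<and> v j z = v j y)"
proof
  assume "{v i x, v j y} \<in> edges"
  then obtain k l z where z: "{v i x, v j y} = {v k z, v l z}" "k \<le> d" "l \<le> d" "k \<noteq> l" "z \<in> Om"
    unfolding edges_def by auto
  then consider "v i x = v k z" "v j y = v l z" | "v i x = v l z" "v j y = v k z"
    by (auto simp: doubleton_eq_iff)
  then show "i \<noteq> j \<and> (\<exists>z\<in>Om. v i z = v i x \<and> v j z = v j y)"
  proof cases
    case 1
    then have "i = k" "j = l" using vertex_type[OF assms(1) z(2) assms(3) z(5)] vertex_type[OF assms(2) z(3) assms(4) z(5)] by auto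
    then show ?thesis using 1 z by auto
  next
    case 2
    then have "i = l" "j = k" using vertex_type[OF assms(1) z(3) assms(3) z(5)] vertex_type[OF assms(2) z(2) assms(4) z(5)] by auto
    then show ?thesis using 2 z by auto
  qed
next
  assume "i \<noteq> j \<and> (\<exists>z\<in>Om. v i z = v i x \<and> v j z = v j y)"
  then obtain z where z: "i \<noteq> j" "z \<in> Om" "v i z = v i x" "v j z = v j y" by auto
  then have "{v i z, v j z} \<in> edges" unfolding edges_def using assms by blast
  then show "{v i x, v j y} \<in> edges" using z by simp
qed

lemma graph: "graph verts edges"
proof -
  have "card e = 2 \<and> e \<subseteq> verts" if "e \<in> edges" for e
  proof -
    from that obtain i j x where e: "e = {v i x, v j x}" "i \<le> d" "j \<le> d" "i \<noteq> j" "x \<in> Om"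
      unfolding edges_def by auto
    then have "v i x \<noteq> v j x" using vertex_type by blast
    then show ?thesis using e unfolding verts_def by auto
  qed
  then show ?thesis unfolding graph_def verts_def using finite_Om by auto
qed

lemma inj_on_face: "S \<subseteq> {..d} \<Longrightarrow> x \<in> Om \<Longrightarrow> inj_on (\<lambda>i. v i x) S"
  by (intro inj_onI) (metis atMost_iff subsetD vertex_type)

lemma card_face: "S \<subseteq> {..d} \<Longrightarrow> x \<in> Om \<Longrightarrow> card (face S x) = card S"
  unfolding face_def by (rule card_image[OF inj_on_face])

lemma face_subset_iff:
  assumes "S \<subseteq> {..d}" "T \<subseteq> {..d}" "x \<in> Om" "y \<in> Om"
  shows "face S x \<subseteq> face T y \<longleftrightarrow> S \<subseteq> T \<and> y \<in> residue S x"
proof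
  assume sub: "face S x \<subseteq> face T y"
  have "i \<in> T \<and> v i y = v i x" if i: "i \<in> S" for i
  proof -
    from sub i obtain j where j: "j \<in> T" "v i x = v j y" unfolding face_def by auto
    then have "i = j" using vertex_type[of i j x y] assms i by auto
    then show ?thesis using j by auto
  qed
  then show "S \<subseteq> T \<and> y \<in> residue S x" unfolding residue_def using assms by auto
next
  assume "S \<subseteq> T \<and> y \<in> residue S x"
  then show "face S x \<subseteq> face T y" unfolding face_def residue_def by force
qed

lemma face_eq: "y \<in> residue S x \<Longrightarrow> face S y = face S x"
  unfolding face_def residue_def by auto

lemma clique_face:
  assumes "S \<subseteq> {..d}" "x \<in> Om"
  shows "clique verts edges (face S x)"
  unfolding clique_def face_def
proof (intro conjI ballI impI)
  show "(\<lambda>i. v i x) ` S \<subseteq> verts" unfolding verts_def using assms by auto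
  fix u w assume "u \<in> (\<lambda>i. v i x) ` S" "w \<in> (\<lambda>i. v i x) ` S" "u \<noteq> w"
  then obtain i j where "i \<in> S" "j \<in> S" "u = v i x" "w = v j x" "i \<noteq> j" by auto
  then show "{u, w} \<in> edges" unfolding edges_def using assms by auto
qed

text \<open>Here \<open>flag\<close> enters. Vertices of one type are never adjacent, so a clique
  has at most one vertex per type; with a chamber \<open>g i\<close> chosen through each, adjacency
  is exactly the pairwise condition of \<open>flag\<close>.\<close>

lemma clique_imp_face:
  assumes "clique verts edges C"
  shows "\<exists>S x. S \<subseteq> {..d} \<and> x \<in> Om \<and> C = face S x"
proof -
  define T where "T = {i. i \<le> d \<and> (\<exists>y\<in>Om. v i y \<in> C)}"
  define g where "g i = (SOME y. y \<in> Om \<and> v i y \<in> C)" for i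
  have g: "g i \<in> Om \<and> v i (g i) \<in> C" if "i \<in> T" for i
    unfolding g_def by (rule someI_ex) (use that in \<open>auto simp: T_def\<close>)
  have adj: "{u, w} \<in> edges" if "u \<in> C" "w \<in> C" "u \<noteq> w" for u w
    using assms that unfolding clique_def by auto
  have "\<exists>z\<in>Om. \<forall>i\<in>T. v i z = v i (g i)"
  proof (rule flag)
    show "T \<subseteq> {..d}" unfolding T_def by auto
    show "g i \<in> Om" if "i \<in> T" for i using g that by auto
    fix i j assume ij: "i \<in> T" "j \<in> T"
    then have ijd: "i \<le> d" "j \<le> d" unfolding T_def by auto
    show "\<exists>z\<in>Om. v i z = v i (g i) \<and> v j z = v j (g j)"
    proof (cases "i = j")
      case True
      then show ?thesis using g ij by auto
    next
      case False
      then have "v i (g i) \<noteq> v j (g j)" using vertex_type ijd g ij by blast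
      then have "{v i (g i), v j (g j)} \<in> edges" using adj g ij by auto
      then show ?thesis using edge_iff[OF ijd, of "g i" "g j"] g ij by auto
    qed
  qed
  then obtain z where z: "z \<in> Om" "\<And>i. i \<in> T \<Longrightarrow> v i z = v i (g i)" by auto
  have "C = face T z"
  proof (intro equalityI subsetI)
    fix u assume u: "u \<in> C"
    then have "u \<in> verts" using assms unfolding clique_def by auto
    then obtain i y where i: "i \<le> d" "y \<in> Om" "u = v i y" unfolding verts_def by auto
    then have iT: "i \<in> T" unfolding T_def using u by auto
    have "u = v i (g i)"
    proof (rule ccontr)
      assume "u \<noteq> v i (g i)"
      then have "{v i y, v i (g i)} \<in> edges" using adj u g[OF iT] i by auto
      then show False using edge_iff[OF i(1) i(1) i(2)] g[OF iT] by auto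
    qed
    then show "u \<in> face T z" unfolding face_def using z(2)[OF iT] iT by (metis image_eqI)
  next
    fix u assume "u \<in> face T z"
    then show "u \<in> C" unfolding face_def using z g by auto
  qed
  moreover have "T \<subseteq> {..d}" unfolding T_def by auto
  ultimately show ?thesis using z(1) by blast
qed

lemma clique_complex_eq: "clique_complex verts edges = {face S x | S x. S \<subseteq> {..d} \<and> x \<in> Om}"
proof -
  have "finite (face S x)" if "S \<subseteq> {..d}" for S x
    unfolding face_def using finite_subset[OF that] by auto
  then show ?thesis unfolding clique_complex_def using clique_face clique_imp_face by blast
qed

lemma insert_clique:
  assumes C: "clique verts edges C" and u: "u \<in> verts" "\<And>w. w \<in> C \<Longrightarrow> {w, u} \<in> edges"
  shows "clique verts edges (insert u C)"
proof -
  have "{u, w} \<in> edges" if "w \<in> C" for w using u(2)[OF that] by (simp add: insert_commute)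
  then show ?thesis using assms unfolding clique_def by auto
qed

text \<open>A common neighbour extends the face to a larger clique, which is again a face and so
  comes from a chamber of the residue.\<close>

lemma joint_nbhd_face:
  assumes S: "S \<subseteq> {..d}" and x: "x \<in> Om"
  shows "joint_nbhd verts edges (face S x) = nbhd S x"
proof (intro equalityI subsetI)
  fix u assume "u \<in> joint_nbhd verts edges (face S x)"
  then have u: "u \<in> verts" "\<And>w. w \<in> face S x \<Longrightarrow> {w, u} \<in> edges" unfolding joint_nbhd_def by auto
  obtain T z where T: "T \<subseteq> {..d}" "z \<in> Om" "insert u (face S x) = face T z"
    using clique_imp_face[OF insert_clique[OF clique_face[OF S x] u]] by auto
  have "S \<subseteq> T \<and> z \<in> residue S x" using face_subset_iff[OF S T(1) x T(2)] T(3) by auto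
  moreover obtain t where t: "t \<in> T" "u = v t z" using T(3) unfolding face_def by auto
  moreover have "t \<notin> S"
  proof
    assume tS: "t \<in> S"
    then have "{v t x, v t z} \<in> edges" using u(2)[of "v t x"] t unfolding face_def by auto
    then show False using edge_iff[of t t x z] tS S x T(2) by auto
  qed
  ultimately show "u \<in> nbhd S x" unfolding nbhd_def using T(1) by auto
next
  fix u assume "u \<in> nbhd S x"
  then obtain t z where t: "t \<le> d" "t \<notin> S" "z \<in> residue S x" "u = v t z" unfolding nbhd_def by auto
  then have z: "z \<in> Om" using residue_subset by auto
  have "{w, u} \<in> edges" if w: "w \<in> face S x" for w
  proof -
    obtain i where i: "i \<in> S" "w = v i z" using w face_eq[OF t(3)] unfolding face_def by auto
    then show ?thesis unfolding edges_def using t z S by auto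
  qed
  then show "u \<in> joint_nbhd verts edges (face S x)"
    unfolding joint_nbhd_def verts_def using t z by auto
qed

text \<open>The link of a vertex within a link is the link of the enlarged face, which reduces every
  degree to the size of a neighbourhood.\<close>

lemma nbhd_adjacent:
  assumes S: "S \<subseteq> {..d}" and x: "x \<in> Om" and t: "t \<in> {..d} - S" and y: "y \<in> residue S x"
  shows "{u \<in> nbhd S x. {u, v t y} \<in> edges} = nbhd (insert t S) y"
proof -
  have yO: "y \<in> Om" using y residue_subset by auto
  have "face (insert t S) y = insert (v t y) (face S x)"
    using face_eq[OF y] unfolding face_def by auto
  then have "joint_nbhd verts edges (face (insert t S) y) = {u \<in> joint_nbhd verts edges (face S x). {u, v t y} \<in> edges}"
    unfolding joint_nbhd_def by (auto simp: insert_commute)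
  then show ?thesis using joint_nbhd_face[OF S x] joint_nbhd_face[OF _ yO, of "insert t S"] S t by auto
qed

lemma disjoint_images:
  "i \<le> d \<Longrightarrow> j \<le> d \<Longrightarrow> i \<noteq> j \<Longrightarrow> v i ` residue S x \<inter> v j ` residue S x = {}"
  using vertex_type residue_subset by blast

lemma card_nbhd:
  assumes S: "S \<subseteq> {..d}" and x: "x \<in> Om"
  shows "card (nbhd S x) = (d + 1 - card S) * ratio (card S)"
proof -
  have "card (nbhd S x) = (\<Sum>t\<in>{..d} - S. card (v t ` residue S x))"
    unfolding nbhd_def
    by (rule card_UN_disjoint) (auto simp: finite_residue disjoint_images simp del: Int_iff)
  also have "\<dots> = (\<Sum>t\<in>{..d} - S. ratio (card S))"
    by (intro sum.cong refl card_image_residue[OF S x])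
  finally show ?thesis using S by (simp add: card_Diff_subset finite_subset)
qed

text \<open>Each vertex of the link lies in \<open>h (Suc (card S))\<close> chambers of the residue.
  This moves sums from vertices to chambers, where the hypothesis \<open>angle\<close> is
  formulated.\<close>

lemma sum_nbhd:
  fixes f :: "nat \<Rightarrow> real"
  assumes S: "S \<subseteq> {..d}" and x: "x \<in> Om"
  shows "h (Suc (card S)) * (\<Sum>u\<in>nbhd S x. f u) = (\<Sum>t\<in>{..d} - S. \<Sum>y\<in>residue S x. f (v t y))"
proof -
  have "(\<Sum>u\<in>nbhd S x. f u) = (\<Sum>t\<in>{..d} - S. \<Sum>u\<in>v t ` residue S x. f u)"
    unfolding nbhd_def
    by (rule sum.UNION_disjoint) (auto simp: finite_residue disjoint_images simp del: Int_iff)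
  moreover have "(\<Sum>y\<in>residue S x. f (v t y)) = h (Suc (card S)) * (\<Sum>u\<in>v t ` residue S x. f u)"
    if "t \<in> {..d} - S" for t
    by (rule sum_constant_fibres[OF finite_residue residue_fibre[OF S x that]])
  ultimately show ?thesis by (simp add: sum_distrib_left)
qed

lemma card_adjacent:
  assumes S: "S \<subseteq> {..d}" and x: "x \<in> Om" and w: "w \<in> nbhd S x"
  shows "card {u \<in> nbhd S x. {u, w} \<in> edges} = deg (card S)"
proof -
  obtain t y where t: "t \<in> {..d} - S" "y \<in> residue S x" "w = v t y" using w unfolding nbhd_def by auto
  then have "y \<in> Om" using residue_subset by auto
  then show ?thesis
    unfolding t(3) nbhd_adjacent[OF S x t(1,2)] deg_def
    using S t card_insert_type[OF S t(1)] by (subst card_nbhd) auto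
qed

lemma multi_regular:
  assumes "n \<le> d"
  shows "multi_regular verts edges (map deg [0..<n])"
  unfolding multi_regular_def
proof (intro allI impI, elim conjE)
  fix i C assume i: "i < length (map deg [0..<n])" and C: "clique verts edges C" "card C = i"
  obtain S x where S: "S \<subseteq> {..d}" "x \<in> Om" "C = face S x" using clique_imp_face[OF C(1)] by auto
  then have "card S = i" using card_face C by auto
  then show "induced_regular (joint_nbhd verts edges C) edges (map deg [0..<n] ! i)"
    unfolding induced_regular_def S(3) joint_nbhd_face[OF S(1,2)]
    using card_adjacent[OF S(1,2)] i by auto
qed

lemma pure: "pure_dim (clique_complex verts edges) d"
  unfolding pure_dim_def clique_complex_eq
proof (intro conjI ballI)
  fix F assume "F \<in> {face S x |S x. S \<subseteq> {..d} \<and> x \<in> Om}"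
  then obtain S x where S: "S \<subseteq> {..d}" "x \<in> Om" "F = face S x" by auto
  have "card F = card S" using card_face S by simp
  moreover have "card S \<le> card {..d}" using S by (intro card_mono) auto
  ultimately show "card F \<le> d + 1" by simp
  have "F \<subseteq> face {..d} x" unfolding S(3) face_def using S(1) by auto
  moreover have "card (face {..d} x) = d + 1" using card_face S(2) by simp
  ultimately show "\<exists>T\<in>{face S x |S x. S \<subseteq> {..d} \<and> x \<in> Om}. F \<subseteq> T \<and> card T = d + 1"
    using S(2) by blast
qed

lemma link_face:
  assumes S: "S \<subseteq> {..d}" and x: "x \<in> Om"
  shows "link (clique_complex verts edges) (face S x) = {face T y | T y. T \<subseteq> {..d} - S \<and> y \<in> residue S x}"
proof -
  have diff: "face T y - face S x = face (T - S) y" if "T \<subseteq> {..d}" "y \<in> residue S x" for T y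
  proof -
    have "y \<in> Om" using that residue_subset by auto
    then have "inj_on (\<lambda>i. v i y) (T \<union> S)" using inj_on_face that S by auto
    then have "face (T - S) y = face T y - face S y"
      unfolding face_def by (rule inj_on_image_set_diff) auto
    then show ?thesis using face_eq[OF that(2)] by simp
  qed
  show ?thesis
  proof (intro equalityI subsetI)
    fix F assume "F \<in> link (clique_complex verts edges) (face S x)"
    then obtain T y where T: "T \<subseteq> {..d}" "y \<in> Om" "face S x \<subseteq> face T y" "F = face T y - face S x"
      unfolding link_def clique_complex_eq by auto
    then have "y \<in> residue S x" using face_subset_iff[OF S T(1) x T(2)] by auto
    then show "F \<in> {face T y | T y. T \<subseteq> {..d} - S \<and> y \<in> residue S x}"
      using diff[OF T(1)] T by blast
  next
    fix F assume "F \<in> {face T y | T y. T \<subseteq> {..d} - S \<and> y \<in> residue S x}"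
    then obtain T y where T: "T \<subseteq> {..d} - S" "y \<in> residue S x" "F = face T y" by auto
    then have y: "y \<in> Om" using residue_subset by auto
    have "T \<union> S - S = T" using T(1) by auto
    then have "F = face (T \<union> S) y - face S x" using diff[of "T \<union> S" y] T S by auto
    moreover have "face S x \<subseteq> face (T \<union> S) y" using face_subset_iff[OF S _ x y, of "T \<union> S"] T S by auto
    moreover have "face (T \<union> S) y \<in> clique_complex verts edges"
      unfolding clique_complex_eq using T S y by auto
    ultimately show "F \<in> link (clique_complex verts edges) (face S x)" unfolding link_def by auto
  qed
qed

section \<open>The weighted walk on the link of a face\<close>

context
  fixes S :: "nat set" and x :: 'c
  assumes S: "S \<subseteq> {..d}" and x: "x \<in> Om" and card_S: "card S + 1 \<le> d"
begin

abbreviation "Y \<equiv> link (clique_complex verts edges) (face S x)"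

lemma Y_eq: "Y = {face T y | T y. T \<subseteq> {..d} - S \<and> y \<in> residue S x}"
  by (rule link_face[OF S x])

lemma skel_vertices_Y: "skel_vertices Y = nbhd S x"
proof (intro equalityI subsetI)
  fix u assume "u \<in> skel_vertices Y"
  then obtain T y where T: "{u} = face T y" "T \<subseteq> {..d} - S" "y \<in> residue S x"
    unfolding skel_vertices_def Y_eq by auto
  then obtain t where "t \<in> T" "u = v t y" unfolding face_def by auto
  then show "u \<in> nbhd S x" unfolding nbhd_def using T by auto
next
  fix u assume "u \<in> nbhd S x"
  then obtain t y where t: "t \<in> {..d} - S" "y \<in> residue S x" "u = v t y" unfolding nbhd_def by auto
  then have "{u} = face {t} y" unfolding face_def by auto
  then show "u \<in> skel_vertices Y" unfolding skel_vertices_def Y_eq using t by blast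
qed

lemma edge_Y_obtain:
  assumes "{u, w} \<in> faces_card Y 2"
  obtains t t' y where "t \<in> {..d} - S" "t' \<in> {..d} - S" "t \<noteq> t'" "y \<in> residue S x" "u = v t y" "w = v t' y"
proof -
  obtain T y where T: "{u, w} = face T y" "T \<subseteq> {..d} - S" "y \<in> residue S x"
    using assms unfolding faces_card_def Y_eq by auto
  have "u \<noteq> w" using assms unfolding faces_card_def by auto
  moreover have "u \<in> face T y" "w \<in> face T y" using T(1) by auto
  ultimately show ?thesis using that T(2,3) unfolding face_def by blast
qed

lemma edge_Y_iff: "{u, w} \<in> faces_card Y 2 \<longleftrightarrow> u \<in> nbhd S x \<and> w \<in> nbhd S x \<and> {u, w} \<in> edges"
proof
  assume "{u, w} \<in> faces_card Y 2"
  then obtain t t' y where t: "t \<in> {..d} - S" "t' \<in> {..d} - S" "t \<noteq> t'" "y \<in> residue S x" "u = v t y" "w = v t' y"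
    by (rule edge_Y_obtain)
  moreover have "y \<in> Om" using t residue_subset by auto
  ultimately show "u \<in> nbhd S x \<and> w \<in> nbhd S x \<and> {u, w} \<in> edges"
    unfolding nbhd_def edges_def by auto
next
  assume a: "u \<in> nbhd S x \<and> w \<in> nbhd S x \<and> {u, w} \<in> edges"
  then obtain t y where t: "t \<in> {..d} - S" "y \<in> residue S x" "u = v t y" unfolding nbhd_def by auto
  have "w \<in> nbhd (insert t S) y" using nbhd_adjacent[OF S x t(1,2)] a t by (auto simp: insert_commute)
  then obtain t' z where t': "t' \<in> {..d} - insert t S" "z \<in> residue (insert t S) y" "w = v t' z"
    unfolding nbhd_def by auto
  then have z: "z \<in> residue S x" "v t z = v t y" using residue_insert[OF t(2)] by auto
  have zO: "z \<in> Om" using z residue_subset by auto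
  have eq: "{u, w} = face {t, t'} z" unfolding face_def using t t' z by auto
  moreover have "card (face {t, t'} z) = 2" using card_face[OF _ zO, of "{t, t'}"] t t' by auto
  ultimately show "{u, w} \<in> faces_card Y 2" unfolding faces_card_def Y_eq using z(1) t(1) t'(1) by auto
qed

text \<open>The top faces over an edge of the link correspond to the chambers of a residue with two
  more types, so every edge has the same weight.\<close>

lemma skel_weight_Y:
  assumes "{u, w} \<in> faces_card Y 2"
  shows "skel_weight Y (d + 1 - card S) u w = fact (d + 1 - card S - 2) * h (card S + 2)"
proof -
  from assms obtain t t' y where t: "t \<in> {..d} - S" "t' \<in> {..d} - S" "t \<noteq> t'" "y \<in> residue S x" "u = v t y" "w = v t' y"
    by (rule edge_Y_obtain)
  have y: "y \<in> Om" using t residue_subset by auto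
  let ?S = "insert t (insert t' S)" and ?I = "{..d} - S"
  have finS: "finite S" using S finite_subset by auto
  have "{\<pi> \<in> faces_card Y (d + 1 - card S). {u, w} \<subseteq> \<pi>} = face ?I ` residue ?S y"
  proof (intro equalityI subsetI)
    fix \<pi> assume "\<pi> \<in> {\<pi> \<in> faces_card Y (d + 1 - card S). {u, w} \<subseteq> \<pi>}"
    then obtain T z where T: "\<pi> = face T z" "T \<subseteq> ?I" "z \<in> residue S x" "card \<pi> = d + 1 - card S" "{u, w} \<subseteq> \<pi>"
      unfolding faces_card_def Y_eq by auto
    have z: "z \<in> Om" using T(3) residue_subset by auto
    have "T \<subseteq> {..d}" using T(2) by auto
    then have "card T = card ?I"
      using T(1,2,4) card_face[of T z] z finS S by (auto simp: card_Diff_subset)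
    then have TI: "T = ?I" using T(2) by (simp add: card_subset_eq)
    have "face {t, t'} y \<subseteq> face T z" using T(1,5) t unfolding face_def by auto
    then have "z \<in> residue {t, t'} y" using face_subset_iff[of "{t, t'}" T y z] t y z T(2) by auto
    then have "z \<in> residue ?S y" using T(3) t(4) unfolding residue_def by auto
    then show "\<pi> \<in> face ?I ` residue ?S y" using T(1) TI by auto
  next
    fix \<pi> assume "\<pi> \<in> face ?I ` residue ?S y"
    then obtain z where z: "z \<in> residue ?S y" "\<pi> = face ?I z" by auto
    have zO: "z \<in> Om" using z residue_subset by auto
    have zS: "z \<in> residue S x" using z(1) t(4) unfolding residue_def by auto
    have "u \<in> \<pi>" "w \<in> \<pi>" using z t unfolding face_def residue_def by (auto intro: rev_image_eqI)
    moreover have "card \<pi> = d + 1 - card S"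
      unfolding z(2) using card_face[OF _ zO, of ?I] finS S by (simp add: card_Diff_subset)
    ultimately show "\<pi> \<in> {\<pi> \<in> faces_card Y (d + 1 - card S). {u, w} \<subseteq> \<pi>}"
      unfolding faces_card_def Y_eq using zS z(2) by auto
  qed
  moreover have "inj_on (face ?I) (residue ?S y)"
  proof (rule inj_onI)
    fix z z' assume z: "z \<in> residue ?S y" "z' \<in> residue ?S y" "face ?I z = face ?I z'"
    then have zO: "z \<in> Om" "z' \<in> Om" using residue_subset by auto
    have "z' \<in> residue ?I z" using face_subset_iff[of ?I ?I z z'] z zO by auto
    then have "z' \<in> residue {..d} z" using z unfolding residue_def by fastforce
    \<comment> \<open>\<open>h_top\<close> says that a chamber is determined by its
      vertices.\<close>
    moreover have "card (residue {..d} z) = 1" using card_residue'[OF _ zO(1), of "{..d}"] h_top by simp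
    then obtain q where "residue {..d} z = {q}" by (auto simp: card_1_singleton_iff)
    ultimately show "z = z'" using residue_self[OF zO(1), of "{..d}"] by auto
  qed
  moreover have "card ?S = card S + 2" using t finS by auto
  ultimately show ?thesis unfolding skel_weight_def
    using card_image[of "face ?I" "residue ?S y"] card_residue'[OF _ y, of ?S] S t by auto
qed

text \<open>The constant weight cancels, leaving the simple random walk on a regular graph; its
  matrix is therefore symmetric.\<close>

lemma transition_Y:
  assumes u: "u \<in> nbhd S x"
  shows "transition Y (d + 1 - card S) u w =
    (if w \<in> nbhd S x \<and> {u, w} \<in> edges then 1 / deg (card S) else 0)"
proof (cases "w \<in> nbhd S x \<and> {u, w} \<in> edges")
  case True
  define W where "W = fact (d + 1 - card S - 2) * real (h (card S + 2))"
  have W: "W > 0" unfolding W_def using h_pos[of "card S + 2"] card_S by simp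
  have wt: "skel_weight Y (d + 1 - card S) a b = W" if "{a, b} \<in> faces_card Y 2" for a b
    using skel_weight_Y[OF that] unfolding W_def by simp
  have set: "{y. {y, u} \<in> faces_card Y 2} = {y \<in> nbhd S x. {y, u} \<in> edges}" using edge_Y_iff u by auto
  have "(\<Sum>y\<in>{y. {y, u} \<in> faces_card Y 2}. skel_weight Y (d + 1 - card S) y u) = (\<Sum>y\<in>{y. {y, u} \<in> faces_card Y 2}. W)"
    by (intro sum.cong refl) (use wt in auto)
  also have "\<dots> = deg (card S) * W" unfolding set using card_adjacent[OF S x u] by simp
  finally have s: "(\<Sum>y\<in>{y. {y, u} \<in> faces_card Y 2}. skel_weight Y (d + 1 - card S) y u) = deg (card S) * W" .
  have f: "{w, u} \<in> faces_card Y 2" using True u edge_Y_iff by (auto simp: insert_commute)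
  show ?thesis unfolding transition_def s wt[OF f] using True W f by (simp add: insert_commute)
next
  case False
  then have "{w, u} \<notin> faces_card Y 2" using edge_Y_iff by (auto simp: insert_commute)
  then show ?thesis unfolding transition_def using False by (auto simp: insert_commute)
qed

text \<open>Ordered edges are split by the types of their ends. An edge of types \<open>t\<close>
  and \<open>t'\<close> arises from \<open>h (card S + 2)\<close> chambers of the residue.\<close>

lemma sum_adjacent_pairs:
  fixes g :: "nat \<Rightarrow> real"
  shows "h (card S + 2) * (\<Sum>u\<in>nbhd S x. \<Sum>w\<in>{w \<in> nbhd S x. {u, w} \<in> edges}. g u * g w) =
    (\<Sum>t\<in>{..d} - S. \<Sum>t'\<in>{..d} - S - {t}. \<Sum>y\<in>residue S x. g (v t y) * g (v t' y))"
proof -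
  let ?I = "{..d} - S"
  let ?PI = "SIGMA t:?I. ?I - {t}"
  let ?\<phi> = "\<lambda>t t' y. (v t y, v t' y)"
  have finN: "finite (nbhd S x)" unfolding nbhd_def using finite_residue by auto
  have pairs: "(SIGMA u:nbhd S x. {w \<in> nbhd S x. {u, w} \<in> edges}) =
      (\<Union>p\<in>?PI. ?\<phi> (fst p) (snd p) ` residue S x)"
  proof (intro equalityI subsetI)
    fix q assume "q \<in> (SIGMA u:nbhd S x. {w \<in> nbhd S x. {u, w} \<in> edges})"
    then obtain u w where q: "q = (u, w)" "{u, w} \<in> faces_card Y 2" using edge_Y_iff by auto
    from q(2) obtain t t' y where "t \<in> ?I" "t' \<in> ?I" "t \<noteq> t'" "y \<in> residue S x" "u = v t y" "w = v t' y"
      by (rule edge_Y_obtain)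
    then show "q \<in> (\<Union>p\<in>?PI. ?\<phi> (fst p) (snd p) ` residue S x)" unfolding q(1)
      by (intro UN_I[of "(t, t')"]) auto
  next
    fix q assume "q \<in> (\<Union>p\<in>?PI. ?\<phi> (fst p) (snd p) ` residue S x)"
    then obtain t t' y where t: "t \<in> ?I" "t' \<in> ?I" "t \<noteq> t'" "y \<in> residue S x" "q = (v t y, v t' y)" by auto
    moreover have "y \<in> Om" using t residue_subset by auto
    ultimately show "q \<in> (SIGMA u:nbhd S x. {w \<in> nbhd S x. {u, w} \<in> edges})"
      unfolding nbhd_def edges_def by auto
  qed
  have fib: "card {z \<in> residue S x. ?\<phi> t t' z = ?\<phi> t t' y} = h (card S + 2)"
    if "t \<in> ?I" "t' \<in> ?I - {t}" "y \<in> residue S x" for t t' y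
  proof -
    have y: "y \<in> Om" using that residue_subset by auto
    have "{z \<in> residue S x. ?\<phi> t t' z = ?\<phi> t t' y} = residue (insert t' (insert t S)) y"
      using that(3) unfolding residue_def by auto
    moreover have "card (insert t' (insert t S)) = card S + 2"
      using that S finite_subset[OF S] by auto
    ultimately show ?thesis using card_residue'[OF _ y, of "insert t' (insert t S)"] S that by auto
  qed
  have "(\<Sum>u\<in>nbhd S x. \<Sum>w\<in>{w \<in> nbhd S x. {u, w} \<in> edges}. g u * g w) =
      (\<Sum>q\<in>(SIGMA u:nbhd S x. {w \<in> nbhd S x. {u, w} \<in> edges}). g (fst q) * g (snd q))"
    using finN by (subst sum.Sigma) (auto simp: case_prod_unfold)
  also have "\<dots> = (\<Sum>p\<in>?PI. \<Sum>q\<in>?\<phi> (fst p) (snd p) ` residue S x. g (fst q) * g (snd q))"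
    unfolding pairs
  proof (rule sum.UNION_disjoint)
    show "\<forall>p\<in>?PI. \<forall>p'\<in>?PI. p \<noteq> p' \<longrightarrow>
      ?\<phi> (fst p) (snd p) ` residue S x \<inter> ?\<phi> (fst p') (snd p') ` residue S x = {}"
    proof (intro ballI impI)
      fix p p' assume p: "p \<in> ?PI" "p' \<in> ?PI" "p \<noteq> p'"
      show "?\<phi> (fst p) (snd p) ` residue S x \<inter> ?\<phi> (fst p') (snd p') ` residue S x = {}"
      proof (rule ccontr)
        assume "\<not> ?thesis"
        then obtain y z where "y \<in> Om" "z \<in> Om" "v (fst p) y = v (fst p') z" "v (snd p) y = v (snd p') z"
          using residue_subset by blast
        then show False using vertex_type[of "fst p" "fst p'" y z] vertex_type[of "snd p" "snd p'" y z] p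
          by (auto simp: prod_eq_iff)
      qed
    qed
  qed (auto simp: finite_residue)
  finally have "(\<Sum>u\<in>nbhd S x. \<Sum>w\<in>{w \<in> nbhd S x. {u, w} \<in> edges}. g u * g w) =
     (\<Sum>p\<in>?PI. \<Sum>q\<in>?\<phi> (fst p) (snd p) ` residue S x. g (fst q) * g (snd q))" .
  then have "h (card S + 2) * (\<Sum>u\<in>nbhd S x. \<Sum>w\<in>{w \<in> nbhd S x. {u, w} \<in> edges}. g u * g w) =
     (\<Sum>p\<in>?PI. h (card S + 2) * (\<Sum>q\<in>?\<phi> (fst p) (snd p) ` residue S x. g (fst q) * g (snd q)))"
    by (simp add: sum_distrib_left)
  also have "\<dots> = (\<Sum>p\<in>?PI. \<Sum>y\<in>residue S x. g (v (fst p) y) * g (v (snd p) y))"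
  proof (intro sum.cong refl)
    fix p assume "p \<in> ?PI"
    then have p: "fst p \<in> ?I" "snd p \<in> ?I - {fst p}" by auto
    show "h (card S + 2) * (\<Sum>q\<in>?\<phi> (fst p) (snd p) ` residue S x. g (fst q) * g (snd q)) =
      (\<Sum>y\<in>residue S x. g (v (fst p) y) * g (v (snd p) y))"
      using sum_constant_fibres[OF finite_residue fib[OF p], where f = "\<lambda>q. g (fst q) * g (snd q)"] by simp
  qed
  also have "\<dots> = (\<Sum>t\<in>?I. \<Sum>t'\<in>?I - {t}. \<Sum>y\<in>residue S x. g (v t y) * g (v t' y))"
    by (subst sum.Sigma) (auto simp: case_prod_unfold)
  finally show ?thesis .
qed

lemma sum_adjacent_pairs_le:
  fixes g :: "nat \<Rightarrow> real"
  assumes g: "(\<Sum>u\<in>nbhd S x. g u) = 0"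
  shows "(\<Sum>u\<in>nbhd S x. \<Sum>w\<in>{w \<in> nbhd S x. {u, w} \<in> edges}. g u * g w) \<le>
    c * deg (card S) * (\<Sum>u\<in>nbhd S x. (g u)\<^sup>2)"
proof -
  let ?I = "{..d} - S" and ?R = "residue S x"
  define M where "M t = (\<Sum>y\<in>?R. g (v t y))" for t
  define Q where "Q t = (\<Sum>y\<in>?R. (g (v t y))\<^sup>2)" for t
  have cI: "card ?I = d + 1 - card S" using S by (simp add: card_Diff_subset finite_subset)
  have hpos: "h (card S) > 0" "h (card S + 2) > 0" using h_pos card_S by auto
  have sM: "(\<Sum>t\<in>?I. M t) = 0" using sum_nbhd[OF S x, of g] g unfolding M_def by simp
  have sQ: "(\<Sum>t\<in>?I. Q t) = h (Suc (card S)) * (\<Sum>u\<in>nbhd S x. (g u)\<^sup>2)"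
    using sum_nbhd[OF S x, of "\<lambda>u. (g u)\<^sup>2"] unfolding Q_def by simp
  have "(\<Sum>t\<in>?I. \<Sum>t'\<in>?I - {t}. \<Sum>y\<in>?R. g (v t y) * g (v t' y)) \<le>
      (\<Sum>t\<in>?I. \<Sum>t'\<in>?I - {t}. M t * M t' / h (card S) + c / 2 * (Q t + Q t'))"
    by (intro sum_mono) (use angle[OF S x, of _ _ g g] in \<open>auto simp: M_def Q_def residue_def\<close>)
  also have "\<dots> = (\<Sum>t\<in>?I. M t * ((\<Sum>t'\<in>?I. M t') - M t) / h (card S) +
      c / 2 * ((card ?I - 1) * Q t + ((\<Sum>t'\<in>?I. Q t') - Q t)))"
  proof (intro sum.cong refl)
    fix t assume t: "t \<in> ?I"
    have rem: "(\<Sum>t'\<in>?I - {t}. f t') = (\<Sum>t'\<in>?I. f t') - f t" for f :: "nat \<Rightarrow> real"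
      using sum.remove[of ?I t f] t by simp
    have ct: "real (card (?I - {t})) = card ?I - 1" using t by (simp add: card_Diff_singleton)
    show "(\<Sum>t'\<in>?I - {t}. M t * M t' / h (card S) + c / 2 * (Q t + Q t')) =
      M t * ((\<Sum>t'\<in>?I. M t') - M t) / h (card S) + c / 2 * ((card ?I - 1) * Q t + ((\<Sum>t'\<in>?I. Q t') - Q t))"
      unfolding rem[symmetric] ct[symmetric]
      by (simp add: sum.distrib sum_distrib_left[symmetric] sum_divide_distrib[symmetric])
  qed
  also have "\<dots> = - (\<Sum>t\<in>?I. (M t)\<^sup>2) / h (card S) + c / 2 * (2 * (real (card ?I) - 1) * (\<Sum>t\<in>?I. Q t))"
  proof -
    have k1: "real (card ?I - 1) = real (card ?I) - 1" using cI card_S by simp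
    have "(\<Sum>t\<in>?I. M t * ((\<Sum>t'\<in>?I. M t') - M t) / h (card S) +
      c / 2 * ((card ?I - 1) * Q t + ((\<Sum>t'\<in>?I. Q t') - Q t)))
      = (\<Sum>t\<in>?I. - (M t)\<^sup>2 / h (card S)) + (\<Sum>t\<in>?I. c / 2 * ((card ?I - 1) * Q t + ((\<Sum>t'\<in>?I. Q t') - Q t)))"
      unfolding sM by (simp add: sum.distrib sum_subtractf sum_negf power2_eq_square)
    also have "(\<Sum>t\<in>?I. - (M t)\<^sup>2 / h (card S)) = - (\<Sum>t\<in>?I. (M t)\<^sup>2) / h (card S)"
      by (simp add: sum_negf sum_divide_distrib)
    also have "(\<Sum>t\<in>?I. c / 2 * ((card ?I - 1) * Q t + ((\<Sum>t'\<in>?I. Q t') - Q t)))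
      = c / 2 * (real (card ?I - 1) * (\<Sum>t\<in>?I. Q t) + (card ?I * (\<Sum>t'\<in>?I. Q t') - (\<Sum>t\<in>?I. Q t)))"
      by (simp only: sum_distrib_left[symmetric] sum.distrib sum_subtractf sum_constant of_nat_id)
    finally show ?thesis unfolding k1 by (simp add: algebra_simps)
  qed
  also have "\<dots> \<le> c / 2 * (2 * (real (card ?I) - 1) * (\<Sum>t\<in>?I. Q t))"
    by (simp add: sum_nonneg)
  also have "\<dots> = c * (real (d - card S) * real (h (Suc (card S)))) * (\<Sum>u\<in>nbhd S x. (g u)\<^sup>2)"
    unfolding sQ using cI card_S by simp
  \<comment> \<open>The factor \<open>h (card S + 2)\<close> is split off to match
    \<open>sum_adjacent_pairs\<close>; what remains is \<open>deg (card S)\<close>.\<close>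
  also have "h (Suc (card S)) = ratio (Suc (card S)) * h (card S + 2)" using h_eq[of "Suc (card S)"] card_S by simp
  finally have "h (card S + 2) * (\<Sum>u\<in>nbhd S x. \<Sum>w\<in>{w \<in> nbhd S x. {u, w} \<in> edges}. g u * g w) \<le>
      h (card S + 2) * (c * deg (card S) * (\<Sum>u\<in>nbhd S x. (g u)\<^sup>2))"
    unfolding sum_adjacent_pairs deg_def by (simp add: mult_ac)
  then show ?thesis using hpos by simp
qed

lemma expander_Y: "one_sided_spectral_expander Y (d + 1 - card S) c"
proof -
  let ?N = "nbhd S x"
  define vs where "vs = sorted_list_of_set ?N"
  define n where "n = card ?N"
  have finN: "finite ?N" unfolding nbhd_def using finite_residue by auto
  have vs: "length vs = n" "distinct vs" "set vs = ?N" unfolding vs_def n_def using finN by auto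
  have bij: "bij_betw ((!) vs) {..<n} ?N" using bij_betw_nth[OF vs(2)] vs by auto
  \<comment> \<open>\<open>lambda2\<close> reads entry 1 of the list of eigenvalues, so two vertices
    must exist: at least two types remain.\<close>
  have n2: "2 \<le> n"
  proof -
    have "2 \<le> d + 1 - card S" using card_S by simp
    moreover have "1 \<le> ratio (card S)" using ratio_pos[of "card S"] card_S by simp
    ultimately have "2 * 1 \<le> (d + 1 - card S) * ratio (card S)" by (rule mult_le_mono)
    then show ?thesis unfolding n_def card_nbhd[OF S x] by simp
  qed
  have D: "deg (card S) > 0" using deg_pos card_S by simp
  define A where "A = transition_mat Y (d + 1 - card S)"
  have A: "A = mat n n (\<lambda>(i, j). transition Y (d + 1 - card S) (vs ! i) (vs ! j))"
    unfolding A_def transition_mat_def skel_vertices_Y Let_def vs_def[symmetric] vs(1) by simp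
  have mem: "vs ! i \<in> ?N" if "i < n" for i using vs that nth_mem by metis
  have Aij: "A $$ (i, j) = (if {vs ! i, vs ! j} \<in> edges then 1 / deg (card S) else 0)" if "i < n" "j < n" for i j
    using that transition_Y[OF mem[OF that(1)], of "vs ! j"] mem unfolding A by simp
  have tr: "(\<Sum>i<n. f (vs ! i)) = (\<Sum>u\<in>?N. f u)" for f :: "nat \<Rightarrow> real"
    by (rule sum.reindex_bij_betw[OF bij])
  have "lambda2 A \<le> c"
  proof (rule lambda2_le)
    show "A \<in> carrier_mat n n" unfolding A by simp
    show "A $$ (i, j) = A $$ (j, i)" if "i < n" "j < n" for i j
      using Aij that by (simp add: insert_commute)
    show "(\<Sum>j<n. A $$ (i, j)) = 1" if i: "i < n" for i
    proof -
      have "(\<Sum>j<n. A $$ (i, j)) = (\<Sum>j<n. if {vs ! i, vs ! j} \<in> edges then 1 / deg (card S) else 0)"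
        using Aij i by simp
      also have "\<dots> = (\<Sum>w\<in>?N. if {vs ! i, w} \<in> edges then 1 / deg (card S) else 0)" by (rule tr)
      also have "\<dots> = (\<Sum>w\<in>{w \<in> ?N. {vs ! i, w} \<in> edges}. 1 / deg (card S))"
        by (rule sum.inter_filter[OF finN, symmetric])
      also have "{w \<in> ?N. {vs ! i, w} \<in> edges} = {w \<in> ?N. {w, vs ! i} \<in> edges}" by (simp add: insert_commute)
      finally show ?thesis using card_adjacent[OF S x mem[OF i]] D by simp
    qed
    fix f :: "nat \<Rightarrow> real" assume f: "(\<Sum>i<n. f i) = 0"
    define g where "g u = f (the_inv_into {..<n} ((!) vs) u)" for u
    have g: "g (vs ! i) = f i" if "i < n" for i
      unfolding g_def using bij that by (simp add: the_inv_into_f_f bij_betw_def)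
    have "(\<Sum>u\<in>?N. g u) = 0" using f g tr[of g] by simp
    note le = sum_adjacent_pairs_le[OF this]
    have "(\<Sum>i<n. \<Sum>j<n. f i * A $$ (i, j) * f j) =
        (\<Sum>i<n. \<Sum>j<n. g (vs ! i) * (if {vs ! i, vs ! j} \<in> edges then 1 / deg (card S) else 0) * g (vs ! j))"
      by (intro sum.cong refl) (simp add: Aij g)
    also have "\<dots> = (\<Sum>u\<in>?N. \<Sum>w\<in>?N. g u * (if {u, w} \<in> edges then 1 / deg (card S) else 0) * g w)"
      by (simp only: tr[of "\<lambda>w. g _ * (if {_, w} \<in> edges then 1 / deg (card S) else 0) * g w"]
          tr[of "\<lambda>u. \<Sum>w\<in>?N. g u * (if {u, w} \<in> edges then 1 / deg (card S) else 0) * g w"])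
    also have "\<dots> = (\<Sum>u\<in>?N. \<Sum>w\<in>?N. if {u, w} \<in> edges then g u * g w / deg (card S) else 0)"
      by (intro sum.cong refl) simp
    also have "\<dots> = (\<Sum>u\<in>?N. \<Sum>w\<in>{w \<in> ?N. {u, w} \<in> edges}. g u * g w) / deg (card S)"
      unfolding sum_divide_distrib by (intro sum.cong refl sum.inter_filter[OF finN, symmetric])
    also have "\<dots> \<le> c * (\<Sum>u\<in>?N. (g u)\<^sup>2)"
      using le D by (simp add: pos_divide_le_eq mult_ac)
    also have "(\<Sum>u\<in>?N. (g u)\<^sup>2) = (\<Sum>i<n. (f i)\<^sup>2)"
      using tr[of "\<lambda>u. (g u)\<^sup>2"] g by simp
    finally show "(\<Sum>i<n. \<Sum>j<n. f i * A $$ (i, j) * f j) \<le> c * (\<Sum>i<n. (f i)\<^sup>2)" .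
  qed (use n2 c_lt in auto)
  then show ?thesis unfolding one_sided_spectral_expander_def A_def .
qed

end

lemma local_spectral_expander:
  assumes "c \<le> lam"
  shows "local_spectral_expander verts edges lam"
  unfolding local_spectral_expander_def hd_expander_def
proof (intro exI[of _ d] conjI ballI impI)
  show "pure_dim (clique_complex verts edges) d" by (rule pure)
  fix F assume F: "F \<in> clique_complex verts edges" "card F + 1 \<le> d"
  then obtain S x where S: "S \<subseteq> {..d}" "x \<in> Om" "F = face S x" unfolding clique_complex_eq by auto
  have "card F = card S" using card_face S by simp
  then show "one_sided_spectral_expander (link (clique_complex verts edges) F) (d + 1 - card F) lam"
    using expander_Y[OF S(1,2)] F(2) assms unfolding S(3) one_sided_spectral_expander_def by simp
qed

text \<open>With \<open>h 1\<close> fixed, a growing number \<open>h 0\<close> of chambers forces a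
  growing graph; counting the vertices of type 0 suffices.\<close>

lemma card_verts_ge: "h 0 \<le> h 1 * card verts"
proof -
  obtain x where x: "x \<in> Om" using Om_ne by auto
  have "h 0 = h 1 * card (v 0 ` residue {} x)" using h_eq_card_image[of "{}" x 0] x by simp
  moreover have "card (v 0 ` residue {} x) \<le> card verts"
    by (intro card_mono) (auto simp: verts_def residue_def finite_Om)
  ultimately show ?thesis by simp
qed

end

section \<open>Angles between subgroups\<close>

context group
begin

lemma sum_mult_left:
  assumes "subgroup K G" "k \<in> K"
  shows "(\<Sum>x\<in>K. F (k \<otimes> x)) = (\<Sum>x\<in>K. F x)"
proof -
  interpret K: subgroup K G by fact
  show ?thesis
    by (rule sum.reindex_bij_witness[where i = "\<lambda>x. inv k \<otimes> x" and j = "\<lambda>x. k \<otimes> x"])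
       (use assms(2) in \<open>auto simp: m_assoc[symmetric]\<close>)
qed

lemma sum_mult_right:
  assumes "subgroup K G" "k \<in> K"
  shows "(\<Sum>x\<in>K. F (x \<otimes> k)) = (\<Sum>x\<in>K. F x)"
proof -
  interpret K: subgroup K G by fact
  show ?thesis
    by (rule sum.reindex_bij_witness[where i = "\<lambda>x. x \<otimes> inv k" and j = "\<lambda>x. x \<otimes> k"])
       (use assms(2) in \<open>auto simp: m_assoc\<close>)
qed

text \<open>For a subgroup \<open>A\<close> of \<open>K\<close>, the functions on its right cosets
  in \<open>K\<close>, that is, on the vertices of one type in a link.\<close>

definition left_invariant :: "'a set \<Rightarrow> 'a set \<Rightarrow> ('a \<Rightarrow> real) \<Rightarrow> bool" where
  "left_invariant K A F \<longleftrightarrow> (\<forall>a\<in>A. \<forall>x\<in>K. F (a \<otimes> x) = F x)"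

text \<open>By scaling \<open>F\<close> and \<open>F'\<close>, this is equivalent to the bound \<open>c \<parallel>F\<parallel> \<parallel>F'\<parallel>\<close> on the inner product.\<close>
definition angle_le :: "'a set \<Rightarrow> 'a set \<Rightarrow> 'a set \<Rightarrow> real \<Rightarrow> bool" where
  "angle_le K A B c \<longleftrightarrow> (\<forall>F F'. left_invariant K A F \<longrightarrow> left_invariant K B F' \<longrightarrow>
     (\<Sum>x\<in>K. F x) = 0 \<longrightarrow> (\<Sum>x\<in>K. F' x) = 0 \<longrightarrow>
     (\<Sum>x\<in>K. F x * F' x) \<le> c / 2 * ((\<Sum>x\<in>K. (F x)\<^sup>2) + (\<Sum>x\<in>K. (F' x)\<^sup>2)))"

lemma angle_leD:
  assumes "angle_le K A B c" "left_invariant K A F" "left_invariant K B F'"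
    "(\<Sum>x\<in>K. F x) = 0" "(\<Sum>x\<in>K. F' x) = 0"
  shows "(\<Sum>x\<in>K. F x * F' x) \<le> c / 2 * ((\<Sum>x\<in>K. (F x)\<^sup>2) + (\<Sum>x\<in>K. (F' x)\<^sup>2))"
  using assms unfolding angle_le_def by blast

lemma angle_le_commute:
  assumes "angle_le K A B c"
  shows "angle_le K B A c"
  unfolding angle_le_def
proof (intro allI impI)
  fix F F' :: "'a \<Rightarrow> real"
  assume "left_invariant K B F" "left_invariant K A F'" "(\<Sum>x\<in>K. F x) = 0" "(\<Sum>x\<in>K. F' x) = 0"
  from angle_leD[OF assms this(2,1,4,3)]
  show "(\<Sum>x\<in>K. F x * F' x) \<le> c / 2 * ((\<Sum>x\<in>K. (F x)\<^sup>2) + (\<Sum>x\<in>K. (F' x)\<^sup>2))"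
    by (simp only: mult.commute[of "F _" "F' _"] add.commute[of "\<Sum>x\<in>K. (F x)\<^sup>2"])
qed

lemma angle_le_mono:
  assumes "angle_le K A B c" "c \<le> c'"
  shows "angle_le K A B c'"
  unfolding angle_le_def
proof (intro allI impI)
  fix F F' :: "'a \<Rightarrow> real"
  let ?N = "(\<Sum>x\<in>K. (F x)\<^sup>2) + (\<Sum>x\<in>K. (F' x)\<^sup>2)"
  assume "left_invariant K A F" "left_invariant K B F'" "(\<Sum>x\<in>K. F x) = 0" "(\<Sum>x\<in>K. F' x) = 0"
  then have "(\<Sum>x\<in>K. F x * F' x) \<le> c / 2 * ?N" by (rule angle_leD[OF assms(1)])
  also have "\<dots> \<le> c' / 2 * ?N"
    using assms(2) by (intro mult_right_mono add_nonneg_nonneg sum_nonneg) auto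
  finally show "(\<Sum>x\<in>K. F x * F' x) \<le> c' / 2 * ?N" .
qed

text \<open>The angle is applied to both functions after centring. This form is needed because a
  sum-zero function on \<open>K\<close> may have non-zero means on single cosets.\<close>

lemma angle_le_with_means:
  assumes "angle_le K A B c" "left_invariant K A F" "left_invariant K B F'"
    and K: "finite K" "K \<noteq> {}"
  shows "(\<Sum>x\<in>K. F x * F' x) \<le> (\<Sum>x\<in>K. F x) * (\<Sum>x\<in>K. F' x) / card K +
     c / 2 * (((\<Sum>x\<in>K. (F x)\<^sup>2) - (\<Sum>x\<in>K. F x)\<^sup>2 / card K) + ((\<Sum>x\<in>K. (F' x)\<^sup>2) - (\<Sum>x\<in>K. F' x)\<^sup>2 / card K))"
proof -
  define m m' where "m = (\<Sum>x\<in>K. F x) / card K" and "m' = (\<Sum>x\<in>K. F' x) / card K"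
  have n: "real (card K) > 0" using K by (simp add: card_gt_0_iff)
  have s: "(\<Sum>x\<in>K. F x) = m * card K" "(\<Sum>x\<in>K. F' x) = m' * card K"
    unfolding m_def m'_def using n by auto
  have "(\<Sum>x\<in>K. (F x - m) * (F' x - m')) \<le> c / 2 * ((\<Sum>x\<in>K. (F x - m)\<^sup>2) + (\<Sum>x\<in>K. (F' x - m')\<^sup>2))"
    by (rule angle_leD[OF assms(1)])
       (use assms(2,3) n in \<open>auto simp: left_invariant_def sum_subtractf s\<close>)
  moreover have "(\<Sum>x\<in>K. (F x - m) * (F' x - m')) = (\<Sum>x\<in>K. F x * F' x) - m * m' * card K"
    by (simp add: algebra_simps sum_subtractf sum.distrib s flip: sum_distrib_left)
  moreover have sq: "(\<Sum>x\<in>K. (f x - a)\<^sup>2) = (\<Sum>x\<in>K. (f x)\<^sup>2) - a\<^sup>2 * card K"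
    if "(\<Sum>x\<in>K. f x) = a * card K" for f and a :: real
  proof -
    have "(\<Sum>x\<in>K. (f x - a)\<^sup>2) = (\<Sum>x\<in>K. (f x)\<^sup>2) + card K * a\<^sup>2 - 2 * a * (\<Sum>x\<in>K. f x)"
      by (simp add: power2_diff sum_subtractf sum.distrib sum_distrib_left mult.assoc mult.left_commute[of 2 a] mult.commute[of _ a])
    then show ?thesis using that by (simp add: power2_eq_square)
  qed
  moreover have d1: "a * card K * (b * card K) / card K = a * b * card K" for a b :: real
    using n by (simp add: mult.assoc)
  moreover have d2: "(a * card K)\<^sup>2 / card K = a\<^sup>2 * card K" for a :: real
    using n by (simp add: power2_eq_square)
  ultimately show ?thesis unfolding sq[OF s(1)] sq[OF s(2)] s d1 d2 by argo
qed

text \<open>The orthogonal projection onto the functions constant on right cosets of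
  \<open>L\<close>.\<close>

definition coset_mean :: "'a set \<Rightarrow> ('a \<Rightarrow> real) \<Rightarrow> 'a \<Rightarrow> real" where
  "coset_mean L F x = (\<Sum>a\<in>L. F (a \<otimes> x)) / card L"

context
  fixes K L :: "'a set"
  assumes K: "subgroup K G" and finK: "finite K" and L: "subgroup L G" and LK: "L \<subseteq> K"
begin

lemma finite_sub: "finite L" using finK LK finite_subset by blast

lemma card_sub_pos: "real (card L) > 0"
  using finite_sub subgroup.one_closed[OF L] by (auto simp: card_gt_0_iff)

lemma left_invariant_coset_mean: "left_invariant K L (coset_mean L F)"
  unfolding left_invariant_def
proof (intro ballI)
  fix b x assume b: "b \<in> L" and x: "x \<in> K"
  have "(\<Sum>a\<in>L. F (a \<otimes> (b \<otimes> x))) = (\<Sum>a\<in>L. F (a \<otimes> b \<otimes> x))"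
    using b x subgroup.subset[OF K] LK by (intro sum.cong refl) (simp add: m_assoc subset_iff)
  also have "\<dots> = (\<Sum>a\<in>L. F (a \<otimes> x))"
    by (rule sum_mult_right[OF L b, of "\<lambda>a. F (a \<otimes> x)"])
  finally show "coset_mean L F (b \<otimes> x) = coset_mean L F x" unfolding coset_mean_def by simp
qed

lemma sum_coset_sum: "(\<Sum>x\<in>K. \<Sum>a\<in>L. F (a \<otimes> x)) = card L * (\<Sum>x\<in>K. F x)" for F :: "'a \<Rightarrow> real"
proof -
  have "(\<Sum>x\<in>K. \<Sum>a\<in>L. F (a \<otimes> x)) = (\<Sum>a\<in>L. \<Sum>x\<in>K. F (a \<otimes> x))" by (rule sum.swap)
  also have "\<dots> = (\<Sum>a\<in>L. \<Sum>x\<in>K. F x)"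
    using LK by (intro sum.cong refl sum_mult_left[OF K]) auto
  finally show ?thesis by simp
qed

lemma sum_coset_mean: "(\<Sum>x\<in>K. coset_mean L F x) = (\<Sum>x\<in>K. F x)"
  using sum_coset_sum[of F] card_sub_pos
  unfolding coset_mean_def sum_divide_distrib[symmetric] by simp

lemma inner_coset_mean: "(\<Sum>x\<in>K. F x * coset_mean L F x) = (\<Sum>x\<in>K. (coset_mean L F x)\<^sup>2)"
proof -
  have "card L * (\<Sum>x\<in>K. F x * coset_mean L F x)
      = (\<Sum>x\<in>K. \<Sum>a\<in>L. F (a \<otimes> x) * coset_mean L F (a \<otimes> x))"
    by (rule sum_coset_sum[symmetric])
  also have "\<dots> = (\<Sum>x\<in>K. \<Sum>a\<in>L. F (a \<otimes> x) * coset_mean L F x)"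
    using left_invariant_coset_mean[of F] unfolding left_invariant_def by (intro sum.cong refl) simp
  also have "\<dots> = (\<Sum>x\<in>K. (\<Sum>a\<in>L. F (a \<otimes> x)) * coset_mean L F x)"
    by (simp add: sum_distrib_right)
  also have "\<dots> = card L * (\<Sum>x\<in>K. (coset_mean L F x)\<^sup>2)"
    unfolding sum_distrib_left
    by (intro sum.cong refl) (use card_sub_pos in \<open>simp add: coset_mean_def power2_eq_square\<close>)
  finally show ?thesis using card_sub_pos by simp
qed

text \<open>The angle is tested on \<open>F\<close> and its projection: their inner product is the
  squared norm of the projection, and dividing the projection by \<open>c\<close> balances the two
  norms in the extremal case.\<close>

lemma sum_coset_mean_square_le:
  assumes "angle_le K A L c" "left_invariant K A F" "(\<Sum>x\<in>K. F x) = 0" "c > 0"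
  shows "(\<Sum>x\<in>K. (coset_mean L F x)\<^sup>2) \<le> c\<^sup>2 * (\<Sum>x\<in>K. (F x)\<^sup>2)"
proof -
  let ?P = "coset_mean L F" and ?S = "\<Sum>x\<in>K. (coset_mean L F x)\<^sup>2"
  have "(\<Sum>x\<in>K. F x * (?P x / c)) \<le> c / 2 * ((\<Sum>x\<in>K. (F x)\<^sup>2) + (\<Sum>x\<in>K. (?P x / c)\<^sup>2))"
    by (rule angle_leD[OF assms(1,2)])
       (use left_invariant_coset_mean[of F] sum_coset_mean[of F] assms(3) in
         \<open>auto simp: left_invariant_def simp flip: sum_divide_distrib\<close>)
  then have "?S / c \<le> c / 2 * ((\<Sum>x\<in>K. (F x)\<^sup>2) + ?S / c\<^sup>2)"
    by (simp add: power_divide inner_coset_mean flip: sum_divide_distrib)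
  then have "?S \<le> c * (c / 2 * ((\<Sum>x\<in>K. (F x)\<^sup>2) + ?S / c\<^sup>2))"
    using assms(4) by (simp add: divide_le_eq mult.commute)
  also have "\<dots> = c\<^sup>2 * (\<Sum>x\<in>K. (F x)\<^sup>2) / 2 + ?S / 2"
    using assms(4) by (simp add: field_simps power2_eq_square)
  finally show ?thesis by simp
qed

text \<open>Garland's method: localise the inner product to the cosets of \<open>L\<close>, where the local angle
  applies to the part orthogonal to the coset means.\<close>
lemma angle_le_localise:
  assumes loc: "angle_le L (L \<inter> A) (L \<inter> B) lam" and lam: "0 \<le> lam" "lam \<le> 1"
    and AL: "angle_le K A L c" and BL: "angle_le K B L c" and c: "c > 0"
  shows "angle_le K A B (lam + (1 - lam) * c\<^sup>2)"
  unfolding angle_le_def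
proof (intro allI impI)
  fix F F' :: "'a \<Rightarrow> real"
  assume F: "left_invariant K A F" "(\<Sum>x\<in>K. F x) = 0" and F': "left_invariant K B F'" "(\<Sum>x\<in>K. F' x) = 0"
  let ?P = "coset_mean L F" and ?P' = "coset_mean L F'" and ?m = "real (card L)"
  have in_K: "a \<otimes> x \<in> K" if "a \<in> L" "x \<in> K" for a x
    using that LK subgroup.m_closed[OF K] by auto
  have inv: "left_invariant L (L \<inter> C) (\<lambda>a. f (a \<otimes> x))" if "left_invariant K C f" "x \<in> K" for f x C
    unfolding left_invariant_def
  proof (intro ballI)
    fix b a assume b: "b \<in> L \<inter> C" and a: "a \<in> L"
    have "b \<otimes> a \<otimes> x = b \<otimes> (a \<otimes> x)"
      using a b that(2) subgroup.subset[OF K] LK by (intro m_assoc) auto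
    then show "f (b \<otimes> a \<otimes> x) = f (a \<otimes> x)"
      using that(1) b in_K[OF a that(2)] unfolding left_invariant_def by auto
  qed
  have L0: "L \<noteq> {}" using subgroup.one_closed[OF L] by auto
  have "(\<Sum>a\<in>L. F (a \<otimes> x) * F' (a \<otimes> x)) \<le> ?m * (?P x * ?P' x) +
      lam / 2 * (((\<Sum>a\<in>L. (F (a \<otimes> x))\<^sup>2) - ?m * (?P x)\<^sup>2) + ((\<Sum>a\<in>L. (F' (a \<otimes> x))\<^sup>2) - ?m * (?P' x)\<^sup>2))"
    if "x \<in> K" for x
    using angle_le_with_means[OF loc inv[OF F(1) that] inv[OF F'(1) that] finite_sub L0] card_sub_pos
    unfolding coset_mean_def by (simp add: field_simps power2_eq_square)
  then have "(\<Sum>x\<in>K. \<Sum>a\<in>L. F (a \<otimes> x) * F' (a \<otimes> x)) \<le> (\<Sum>x\<in>K. ?m * (?P x * ?P' x) +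
      lam / 2 * (((\<Sum>a\<in>L. (F (a \<otimes> x))\<^sup>2) - ?m * (?P x)\<^sup>2) + ((\<Sum>a\<in>L. (F' (a \<otimes> x))\<^sup>2) - ?m * (?P' x)\<^sup>2)))"
    by (rule sum_mono)
  also have "\<dots> = ?m * (\<Sum>x\<in>K. ?P x * ?P' x) +
      lam / 2 * (((\<Sum>x\<in>K. \<Sum>a\<in>L. (F (a \<otimes> x))\<^sup>2) - ?m * (\<Sum>x\<in>K. (?P x)\<^sup>2)) +
                 ((\<Sum>x\<in>K. \<Sum>a\<in>L. (F' (a \<otimes> x))\<^sup>2) - ?m * (\<Sum>x\<in>K. (?P' x)\<^sup>2)))"
    by (simp only: sum.distrib sum_subtractf flip: sum_distrib_left)
  also have "\<dots> = ?m * ((\<Sum>x\<in>K. ?P x * ?P' x) +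
      lam / 2 * (((\<Sum>x\<in>K. (F x)\<^sup>2) - (\<Sum>x\<in>K. (?P x)\<^sup>2)) + ((\<Sum>x\<in>K. (F' x)\<^sup>2) - (\<Sum>x\<in>K. (?P' x)\<^sup>2))))"
    unfolding sum_coset_sum[of "\<lambda>x. (F x)\<^sup>2"] sum_coset_sum[of "\<lambda>x. (F' x)\<^sup>2"]
    by (simp add: algebra_simps)
  finally have main: "(\<Sum>x\<in>K. F x * F' x) \<le> (\<Sum>x\<in>K. ?P x * ?P' x) +
      lam / 2 * (((\<Sum>x\<in>K. (F x)\<^sup>2) - (\<Sum>x\<in>K. (?P x)\<^sup>2)) + ((\<Sum>x\<in>K. (F' x)\<^sup>2) - (\<Sum>x\<in>K. (?P' x)\<^sup>2)))"
    unfolding sum_coset_sum[of "\<lambda>x. F x * F' x"] using card_sub_pos by simp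
  \<comment> \<open>The trivial bound suffices for the coset means, since the angles with
    \<open>L\<close> already shorten each projection by the factor \<open>c\<close>.\<close>
  have "(\<Sum>x\<in>K. ?P x * ?P' x) \<le> (\<Sum>x\<in>K. ((?P x)\<^sup>2 + (?P' x)\<^sup>2) / 2)"
  proof (rule sum_mono)
    fix x show "?P x * ?P' x \<le> ((?P x)\<^sup>2 + (?P' x)\<^sup>2) / 2"
      using sum_squares_bound[of "?P x" "?P' x"] by simp
  qed
  also have "\<dots> = ((\<Sum>x\<in>K. (?P x)\<^sup>2) + (\<Sum>x\<in>K. (?P' x)\<^sup>2)) / 2"
    by (simp add: sum.distrib flip: sum_divide_distrib)
  finally have "(\<Sum>x\<in>K. F x * F' x) \<le> ((\<Sum>x\<in>K. (?P x)\<^sup>2) + (\<Sum>x\<in>K. (?P' x)\<^sup>2)) / 2 +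
      lam / 2 * (((\<Sum>x\<in>K. (F x)\<^sup>2) - (\<Sum>x\<in>K. (?P x)\<^sup>2)) + ((\<Sum>x\<in>K. (F' x)\<^sup>2) - (\<Sum>x\<in>K. (?P' x)\<^sup>2)))"
    using main by linarith
  also have "\<dots> = (1 - lam) / 2 * ((\<Sum>x\<in>K. (?P x)\<^sup>2) + (\<Sum>x\<in>K. (?P' x)\<^sup>2)) +
      lam / 2 * ((\<Sum>x\<in>K. (F x)\<^sup>2) + (\<Sum>x\<in>K. (F' x)\<^sup>2))"
    by (simp add: field_simps)
  also have "\<dots> \<le> (1 - lam) / 2 * (c\<^sup>2 * (\<Sum>x\<in>K. (F x)\<^sup>2) + c\<^sup>2 * (\<Sum>x\<in>K. (F' x)\<^sup>2)) +
      lam / 2 * ((\<Sum>x\<in>K. (F x)\<^sup>2) + (\<Sum>x\<in>K. (F' x)\<^sup>2))"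
    using lam sum_coset_mean_square_le[OF AL F c] sum_coset_mean_square_le[OF BL F' c]
    by (intro add_right_mono mult_left_mono add_mono) auto
  also have "\<dots> = (lam + (1 - lam) * c\<^sup>2) / 2 * ((\<Sum>x\<in>K. (F x)\<^sup>2) + (\<Sum>x\<in>K. (F' x)\<^sup>2))"
    by (simp add: field_simps)
  finally show "(\<Sum>x\<in>K. F x * F' x) \<le> (lam + (1 - lam) * c\<^sup>2) / 2 * ((\<Sum>x\<in>K. (F x)\<^sup>2) + (\<Sum>x\<in>K. (F' x)\<^sup>2))" .
qed

end

text \<open>Translation by an element of \<open>A\<close> fixes \<open>F\<close>, and translation by
  an element of \<open>B\<close> moves it by at most twice its distance to \<open>F'\<close>. Along
  a product the displacements accumulate to a constant that depends on \<open>k\<close> but not on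
  the functions.\<close>

lemma almost_invariant_generate:
  assumes K: "subgroup K G" and A: "subgroup A G" "A \<subseteq> K" and B: "subgroup B G" "B \<subseteq> K"
    and k: "k \<in> generate G (A \<union> B)"
  shows "\<exists>C\<ge>0. \<forall>F F'. left_invariant K A F \<longrightarrow> left_invariant K B F' \<longrightarrow>
    (\<Sum>x\<in>K. (F (k \<otimes> x) - F x)\<^sup>2) \<le> C * (\<Sum>x\<in>K. (F x - F' x)\<^sup>2)"
proof -
  have two: "(a + b)\<^sup>2 \<le> 2 * a\<^sup>2 + 2 * b\<^sup>2" for a b :: real
    using sum_squares_bound[of a b] by (simp add: power2_sum)
  have gen: "(\<Sum>x\<in>K. (F (k \<otimes> x) - F x)\<^sup>2) \<le> 4 * (\<Sum>x\<in>K. (F x - F' x)\<^sup>2)"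
    if "k \<in> A \<union> B" "left_invariant K A F" "left_invariant K B F'" for F F' :: "'a \<Rightarrow> real" and k
  proof (cases "k \<in> A")
    case True
    then have "(\<Sum>x\<in>K. (F (k \<otimes> x) - F x)\<^sup>2) = 0"
      using that(2) by (simp add: left_invariant_def)
    then show ?thesis by (simp add: sum_nonneg)
  next
    case False
    then have kB: "k \<in> B" using that by auto
    have "(\<Sum>x\<in>K. (F (k \<otimes> x) - F x)\<^sup>2) \<le> (\<Sum>x\<in>K. 2 * (F (k \<otimes> x) - F' (k \<otimes> x))\<^sup>2 + 2 * (F x - F' x)\<^sup>2)"
    proof (rule sum_mono)
      fix x assume "x \<in> K"
      then have "F' (k \<otimes> x) = F' x" using kB that(3) by (simp add: left_invariant_def)
      then show "(F (k \<otimes> x) - F x)\<^sup>2 \<le> 2 * (F (k \<otimes> x) - F' (k \<otimes> x))\<^sup>2 + 2 * (F x - F' x)\<^sup>2"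
        using two[of "F (k \<otimes> x) - F' (k \<otimes> x)" "F' x - F x"] by (simp add: power2_commute)
    qed
    also have "\<dots> = 2 * (\<Sum>x\<in>K. (F (k \<otimes> x) - F' (k \<otimes> x))\<^sup>2) + 2 * (\<Sum>x\<in>K. (F x - F' x)\<^sup>2)"
      by (simp add: sum.distrib sum_distrib_left)
    also have "(\<Sum>x\<in>K. (F (k \<otimes> x) - F' (k \<otimes> x))\<^sup>2) = (\<Sum>x\<in>K. (F x - F' x)\<^sup>2)"
      using kB B(2) by (intro sum_mult_left[OF K, of k "\<lambda>y. (F y - F' y)\<^sup>2"]) auto
    finally show ?thesis by simp
  qed
  have sub: "generate G (A \<union> B) \<subseteq> K"
    using generate_subgroup_incl[OF _ K, of "A \<union> B"] A(2) B(2) by simp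
  have inK: "x \<in> K" if "x \<in> generate G (A \<union> B)" for x using that sub by auto
  show ?thesis using k
  proof (induction rule: generate.induct)
    case one
    have "(\<Sum>x\<in>K. (F (\<one> \<otimes> x) - F x)\<^sup>2) = 0" for F :: "'a \<Rightarrow> real"
      by (intro sum.neutral ballI) (simp add: subgroup.mem_carrier[OF K])
    then show ?case by (intro exI[of _ 0]) simp
  next
    case (incl h)
    then show ?case by (intro exI[of _ 4] conjI allI impI gen) auto
  next
    case (inv h)
    then have "inv h \<in> A \<union> B"
      using subgroup.m_inv_closed[OF A(1), of h] subgroup.m_inv_closed[OF B(1), of h] by auto
    then show ?case by (intro exI[of _ 4] conjI allI impI gen) auto
  next
    case (eng h k)
    from eng.IH(1) obtain C where C: "C \<ge> 0" "\<forall>F F'. left_invariant K A F \<longrightarrow> left_invariant K B F' \<longrightarrow>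
      (\<Sum>x\<in>K. (F (h \<otimes> x) - F x)\<^sup>2) \<le> C * (\<Sum>x\<in>K. (F x - F' x)\<^sup>2)" by (elim exE conjE)
    from eng.IH(2) obtain D where D: "D \<ge> 0" "\<forall>F F'. left_invariant K A F \<longrightarrow> left_invariant K B F' \<longrightarrow>
      (\<Sum>x\<in>K. (F (k \<otimes> x) - F x)\<^sup>2) \<le> D * (\<Sum>x\<in>K. (F x - F' x)\<^sup>2)" by (elim exE conjE)
    have "(\<Sum>x\<in>K. (F (h \<otimes> k \<otimes> x) - F x)\<^sup>2) \<le> (2 * C + 2 * D) * (\<Sum>x\<in>K. (F x - F' x)\<^sup>2)"
      if F: "left_invariant K A F" "left_invariant K B F'" for F F'
    proof -
      have "(\<Sum>x\<in>K. (F (h \<otimes> k \<otimes> x) - F x)\<^sup>2) \<le>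
          (\<Sum>x\<in>K. 2 * (F (h \<otimes> (k \<otimes> x)) - F (k \<otimes> x))\<^sup>2 + 2 * (F (k \<otimes> x) - F x)\<^sup>2)"
      proof (rule sum_mono)
        fix x assume "x \<in> K"
        then have "h \<otimes> k \<otimes> x = h \<otimes> (k \<otimes> x)"
          by (intro m_assoc subgroup.mem_carrier[OF K] inK[OF eng.hyps(1)] inK[OF eng.hyps(2)])
        then have "F (h \<otimes> k \<otimes> x) - F x = (F (h \<otimes> (k \<otimes> x)) - F (k \<otimes> x)) + (F (k \<otimes> x) - F x)"
          by simp
        then show "(F (h \<otimes> k \<otimes> x) - F x)\<^sup>2 \<le> 2 * (F (h \<otimes> (k \<otimes> x)) - F (k \<otimes> x))\<^sup>2 + 2 * (F (k \<otimes> x) - F x)\<^sup>2"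
          by (simp only: two)
      qed
      also have "\<dots> = 2 * (\<Sum>x\<in>K. (F (h \<otimes> (k \<otimes> x)) - F (k \<otimes> x))\<^sup>2) + 2 * (\<Sum>x\<in>K. (F (k \<otimes> x) - F x)\<^sup>2)"
        by (simp add: sum.distrib sum_distrib_left)
      also have "(\<Sum>x\<in>K. (F (h \<otimes> (k \<otimes> x)) - F (k \<otimes> x))\<^sup>2) = (\<Sum>x\<in>K. (F (h \<otimes> x) - F x)\<^sup>2)"
        by (rule sum_mult_left[OF K inK, of k "\<lambda>y. (F (h \<otimes> y) - F y)\<^sup>2"]) (use eng.hyps in auto)
      finally show ?thesis using C(2)[rule_format, OF F] D(2)[rule_format, OF F] by (simp add: algebra_simps)
    qed
    then show ?case using C(1) D(1) by (intro exI[of _ "2 * C + 2 * D"]) auto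
  qed
qed

text \<open>Averaged over all translates, the squared displacement of a sum-zero function is twice
  its squared norm, as the cross terms cancel. A sum-zero function that is invariant under
  \<open>A\<close> and nearly so under \<open>B\<close> is therefore small.\<close>

lemma poincare_generate:
  assumes K: "subgroup K G" "finite K" and A: "subgroup A G" "A \<subseteq> K" and B: "subgroup B G" "B \<subseteq> K"
    and gen: "K \<subseteq> generate G (A \<union> B)"
  shows "\<exists>M>0. \<forall>F F'. left_invariant K A F \<longrightarrow> left_invariant K B F' \<longrightarrow> (\<Sum>x\<in>K. F x) = 0 \<longrightarrow>
    (\<Sum>x\<in>K. (F x)\<^sup>2) \<le> M * (\<Sum>x\<in>K. (F x - F' x)\<^sup>2)"
proof -
  have "\<forall>k\<in>K. \<exists>C\<ge>0. \<forall>F F'. left_invariant K A F \<longrightarrow> left_invariant K B F' \<longrightarrow>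
    (\<Sum>x\<in>K. (F (k \<otimes> x) - F x)\<^sup>2) \<le> C * (\<Sum>x\<in>K. (F x - F' x)\<^sup>2)"
    using almost_invariant_generate[OF K(1) A B] gen by blast
  from bchoice[OF this] obtain C where "\<forall>k\<in>K. C k \<ge> 0 \<and> (\<forall>F F'. left_invariant K A F \<longrightarrow> left_invariant K B F' \<longrightarrow>
    (\<Sum>x\<in>K. (F (k \<otimes> x) - F x)\<^sup>2) \<le> C k * (\<Sum>x\<in>K. (F x - F' x)\<^sup>2))" by blast
  then have C0: "\<And>k. k \<in> K \<Longrightarrow> C k \<ge> 0" and
    C: "\<And>k F F'. k \<in> K \<Longrightarrow> left_invariant K A F \<Longrightarrow> left_invariant K B F' \<Longrightarrow>
    (\<Sum>x\<in>K. (F (k \<otimes> x) - F x)\<^sup>2) \<le> C k * (\<Sum>x\<in>K. (F x - F' x)\<^sup>2)"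
    by blast+
  define n where "n = real (card K)"
  have n: "n > 0" unfolding n_def using K subgroup.one_closed[OF K(1)] by (auto simp: card_gt_0_iff)
  \<comment> \<open>The added 1 keeps \<open>M\<close> positive even if all constants
    \<open>C k\<close> are zero.\<close>
  define M where "M = ((\<Sum>k\<in>K. C k) + 1) / (2 * n)"
  have M0: "M > 0" unfolding M_def using n C0 by (simp add: add_nonneg_pos sum_nonneg)
  have "(\<Sum>x\<in>K. (F x)\<^sup>2) \<le> M * (\<Sum>x\<in>K. (F x - F' x)\<^sup>2)"
    if F: "left_invariant K A F" "left_invariant K B F'" "(\<Sum>x\<in>K. F x) = 0" for F F'
  proof -
    let ?D = "\<Sum>x\<in>K. (F x - F' x)\<^sup>2" and ?S = "\<Sum>x\<in>K. (F x)\<^sup>2"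
    have cross: "(\<Sum>k\<in>K. \<Sum>x\<in>K. F (k \<otimes> x) * F x) = 0"
    proof -
      have "(\<Sum>k\<in>K. \<Sum>x\<in>K. F (k \<otimes> x) * F x) = (\<Sum>x\<in>K. (\<Sum>k\<in>K. F (k \<otimes> x)) * F x)"
        by (subst sum.swap) (simp add: sum_distrib_right)
      also have "\<dots> = (\<Sum>x\<in>K. 0)"
        by (intro sum.cong refl) (simp add: sum_mult_right[OF K(1), of _ F] F(3))
      finally show ?thesis by simp
    qed
    have "(\<Sum>k\<in>K. \<Sum>x\<in>K. (F (k \<otimes> x) - F x)\<^sup>2)
        = (\<Sum>k\<in>K. (\<Sum>x\<in>K. (F (k \<otimes> x))\<^sup>2) + ?S - 2 * (\<Sum>x\<in>K. F (k \<otimes> x) * F x))"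
      by (intro sum.cong refl) (simp add: power2_diff sum_subtractf sum.distrib sum_distrib_left mult.assoc)
    also have "\<dots> = (\<Sum>k\<in>K. ?S + ?S - 2 * (\<Sum>x\<in>K. F (k \<otimes> x) * F x))"
      by (intro sum.cong refl) (simp add: sum_mult_left[OF K(1), of _ "\<lambda>y. (F y)\<^sup>2"])
    also have "\<dots> = 2 * n * ?S"
      using cross by (simp add: sum_subtractf n_def flip: sum_distrib_left)
    finally have "2 * n * ?S \<le> (\<Sum>k\<in>K. C k * ?D)"
      using C[OF _ F(1,2)] by (metis (no_types, lifting) sum_mono)
    also have "\<dots> = (\<Sum>k\<in>K. C k) * ?D" by (simp add: sum_distrib_right)
    also have "\<dots> \<le> ((\<Sum>k\<in>K. C k) + 1) * ?D" by (intro mult_right_mono sum_nonneg) auto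
    finally show ?thesis unfolding M_def using n by (simp add: field_simps)
  qed
  then show ?thesis using M0 by blast
qed

text \<open>Adds the Poincare inequalities of \<open>F\<close> and \<open>F'\<close> and expands the
  squared distance. The resulting \<open>c\<close> depends on the whole group and is not controlled,
  but it starts the trickling down as soon as it is below 1.\<close>

lemma angle_le_generate:
  assumes K: "subgroup K G" "finite K" and A: "subgroup A G" "A \<subseteq> K" and B: "subgroup B G" "B \<subseteq> K"
    and gen: "K \<subseteq> generate G (A \<union> B)"
  shows "\<exists>c<1. angle_le K A B c"
proof -
  obtain M where M: "M > 0" "\<And>F F'. left_invariant K A F \<Longrightarrow> left_invariant K B F' \<Longrightarrow> (\<Sum>x\<in>K. F x) = 0 \<Longrightarrow>
    (\<Sum>x\<in>K. (F x)\<^sup>2) \<le> M * (\<Sum>x\<in>K. (F x - F' x)\<^sup>2)"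
    using poincare_generate[OF K A B gen] by blast
  obtain M' where M': "M' > 0" "\<And>F F'. left_invariant K B F \<Longrightarrow> left_invariant K A F' \<Longrightarrow> (\<Sum>x\<in>K. F x) = 0 \<Longrightarrow>
    (\<Sum>x\<in>K. (F x)\<^sup>2) \<le> M' * (\<Sum>x\<in>K. (F x - F' x)\<^sup>2)"
    using poincare_generate[OF K B A] gen by (auto simp: Un_commute)
  have "angle_le K A B (1 - 1 / (M + M'))"
    unfolding angle_le_def
  proof (intro allI impI)
    fix F F' :: "'a \<Rightarrow> real"
    let ?N = "(\<Sum>x\<in>K. (F x)\<^sup>2) + (\<Sum>x\<in>K. (F' x)\<^sup>2)" and ?I = "\<Sum>x\<in>K. F x * F' x"
    assume F: "left_invariant K A F" "left_invariant K B F'" "(\<Sum>x\<in>K. F x) = 0" "(\<Sum>x\<in>K. F' x) = 0"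
    have d: "(\<Sum>x\<in>K. (F x - F' x)\<^sup>2) = ?N - 2 * ?I"
      by (simp add: power2_diff sum_subtractf sum.distrib sum_distrib_left mult.assoc)
    have d': "(\<Sum>x\<in>K. (F' x - F x)\<^sup>2) = ?N - 2 * ?I" using d by (simp add: power2_commute)
    have "?N \<le> M * (?N - 2 * ?I) + M' * (?N - 2 * ?I)"
      using M(2)[OF F(1-3)] M'(2)[OF F(2,1,4)] unfolding d d' by (rule add_mono)
    then have "?N \<le> (M + M') * (?N - 2 * ?I)" by (simp add: algebra_simps)
    then have "?N / (M + M') \<le> ?N - 2 * ?I"
      using M(1) M'(1) by (simp add: pos_divide_le_eq mult.commute)
    then have "2 * ?I \<le> ?N - ?N / (M + M')" by linarith
    also have "\<dots> = (1 - 1 / (M + M')) * ?N" by (simp add: left_diff_distrib)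
    finally show "?I \<le> (1 - 1 / (M + M')) / 2 * ?N" by simp
  qed
  then show ?thesis using M(1) M'(1) by (intro exI[of _ "1 - 1 / (M + M')"]) auto
qed

text \<open>Oppenheim's trickling-down: the optimal common bound \<open>c\<close> satisfies
  \<open>c \<le> lam + (1 - lam) c\<^sup>2\<close>, i.e. \<open>(1 - c) ((1 - lam) c - lam) \<le> 0\<close>, and generation excludes \<open>c = 1\<close>.\<close>
lemma angle_le_trickle_down:
  assumes K: "subgroup K G" "finite K"
    and J: "finite J" "3 \<le> card J"
    and A: "\<And>i. i \<in> J \<Longrightarrow> subgroup (A i) G" "\<And>i. i \<in> J \<Longrightarrow> A i \<subseteq> K"
    and gen: "\<And>i j. i \<in> J \<Longrightarrow> j \<in> J \<Longrightarrow> i \<noteq> j \<Longrightarrow> K \<subseteq> generate G (A i \<union> A j)"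
    and loc: "\<And>i j l. i \<in> J \<Longrightarrow> j \<in> J \<Longrightarrow> l \<in> J \<Longrightarrow> i \<noteq> j \<Longrightarrow> i \<noteq> l \<Longrightarrow> j \<noteq> l \<Longrightarrow>
      angle_le (A l) (A l \<inter> A i) (A l \<inter> A j) lam"
    and lam: "0 < lam" "lam < 1"
    and ij: "i \<in> J" "j \<in> J" "i \<noteq> j"
  shows "angle_le K (A i) (A j) (lam / (1 - lam))"
proof -
  \<comment> \<open>Bounds valid for all pairs at once, because localising one pair at a third
    subgroup uses the bounds of the two other pairs. Requiring \<open>lam \<le> c\<close> keeps the
    infimum positive.\<close>
  define S where "S = {c. lam \<le> c \<and> (\<forall>i\<in>J. \<forall>j\<in>J. i \<noteq> j \<longrightarrow> angle_le K (A i) (A j) c)}"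
  define PJ where "PJ = {p \<in> J \<times> J. fst p \<noteq> snd p}"
  have "\<forall>p\<in>PJ. \<exists>c<1. angle_le K (A (fst p)) (A (snd p)) c"
    unfolding PJ_def using angle_le_generate[OF K] A gen by auto
  then obtain cf where cf: "\<And>p. p \<in> PJ \<Longrightarrow> cf p < 1" "\<And>p. p \<in> PJ \<Longrightarrow> angle_le K (A (fst p)) (A (snd p)) (cf p)"
    by metis
  have finPJ: "finite PJ" unfolding PJ_def using J(1) by simp
  define c0 where "c0 = Max (insert lam (cf ` PJ))"
  have c0: "c0 < 1" "lam \<le> c0" "\<And>p. p \<in> PJ \<Longrightarrow> cf p \<le> c0"
    unfolding c0_def using finPJ lam cf(1) by auto
  have "c0 \<in> S"
    unfolding S_def
  proof (intro CollectI conjI ballI impI)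
    fix i j assume "i \<in> J" "j \<in> J" "i \<noteq> j"
    then have "(i, j) \<in> PJ" unfolding PJ_def by simp
    from angle_le_mono[OF cf(2)[OF this] c0(3)[OF this]] show "angle_le K (A i) (A j) c0" by simp
  qed (fact c0(2))
  define c where "c = Inf S"
  have bdd: "bdd_below S" unfolding S_def by (intro bdd_belowI[of _ lam]) auto
  have c_lt: "c < 1" using cInf_lower[OF \<open>c0 \<in> S\<close> bdd] c0(1) unfolding c_def by simp
  have c_ge: "lam \<le> c" unfolding c_def by (rule cInf_greatest) (use \<open>c0 \<in> S\<close> in \<open>auto simp: S_def\<close>)
  \<comment> \<open>The infimum is itself a valid bound: divide by the squared norms, the case of
    zero norms being separate.\<close>
  have ang: "angle_le K (A i) (A j) c" if "i \<in> J" "j \<in> J" "i \<noteq> j" for i j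
    unfolding angle_le_def
  proof (intro allI impI)
    fix F F' :: "'a \<Rightarrow> real"
    let ?N = "(\<Sum>x\<in>K. (F x)\<^sup>2) + (\<Sum>x\<in>K. (F' x)\<^sup>2)" and ?I = "\<Sum>x\<in>K. F x * F' x"
    assume F: "left_invariant K (A i) F" "left_invariant K (A j) F'" "(\<Sum>x\<in>K. F x) = 0" "(\<Sum>x\<in>K. F' x) = 0"
    have I: "?I \<le> e / 2 * ?N" if "e \<in> S" for e
    proof -
      have "angle_le K (A i) (A j) e" using that \<open>i \<in> J\<close> \<open>j \<in> J\<close> \<open>i \<noteq> j\<close> unfolding S_def by auto
      from angle_leD[OF this F] show ?thesis .
    qed
    have "?N \<ge> 0" by (intro add_nonneg_nonneg sum_nonneg) auto
    then consider "?N = 0" | "?N > 0" by linarith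
    then show "?I \<le> c / 2 * ?N"
    proof cases
      case 1
      then show ?thesis using I[OF \<open>c0 \<in> S\<close>] by simp
    next
      case 2
      have "2 * ?I / ?N \<le> c" unfolding c_def
        by (rule cInf_greatest) (use \<open>c0 \<in> S\<close> I 2 in \<open>auto simp: pos_divide_le_eq mult.commute\<close>)
      then show ?thesis using 2 by (simp add: pos_divide_le_eq)
    qed
  qed
  have "lam + (1 - lam) * c\<^sup>2 \<in> S"
    unfolding S_def
  proof (intro CollectI conjI ballI impI)
    show "lam \<le> lam + (1 - lam) * c\<^sup>2" using lam by simp
    fix i j assume ij: "i \<in> J" "j \<in> J" "i \<noteq> j"
    \<comment> \<open>Three indices leave a third subgroup at which to localise.\<close>
    have "\<not> J \<subseteq> {i, j}"
      using J(2) card_mono[of "{i, j}" J] ij by auto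
    then obtain l where l: "l \<in> J" "l \<noteq> i" "l \<noteq> j" by auto
    show "angle_le K (A i) (A j) (lam + (1 - lam) * c\<^sup>2)"
      by (rule angle_le_localise[OF K A(1)[OF l(1)] A(2)[OF l(1)] loc[OF ij(1,2) l(1)]])
         (use ij l lam c_ge ang in auto)
  qed
  from cInf_lower[OF this bdd] have "c \<le> lam + (1 - lam) * c\<^sup>2" unfolding c_def .
  then have "(1 - c) * ((1 - lam) * c - lam) \<le> 0" by (simp add: algebra_simps power2_eq_square)
  then have "(1 - lam) * c \<le> lam" using c_lt by (simp add: mult_le_0_iff)
  then have "c \<le> lam / (1 - lam)" using lam by (simp add: pos_le_divide_eq mult.commute)
  then show ?thesis using angle_le_mono[OF ang[OF ij]] by simp
qed

text \<open>The hypothesis says that two distinct right cosets of \<open>B\<close> are joined by exactly one right coset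
  of \<open>A\<close>, or by none when they lie in the same right coset of \<open>M\<close>.\<close>
lemma angle_le_partial_plane:
  assumes K: "subgroup K G" "finite K" and A: "subgroup A G" "A \<subseteq> K" and B: "subgroup B G" "B \<subseteq> K"
    and M: "subgroup M G" "M \<subseteq> K"
    and bij: "bij_betw (\<lambda>(b', a, b). b' \<otimes> a \<otimes> b) (B \<times> (A - {\<one>}) \<times> B) (K - M)"
  shows "angle_le K A B (1 / sqrt (card A))"
proof (rule angle_le_commute, unfold angle_le_def, intro allI impI)
  fix F F' :: "'a \<Rightarrow> real"
  let ?S = "\<Sum>x\<in>K. (F x)\<^sup>2" and ?S' = "\<Sum>x\<in>K. (F' x)\<^sup>2" and ?P = "coset_mean A F"
  assume F: "left_invariant K B F" "(\<Sum>x\<in>K. F x) = 0" and F': "left_invariant K A F'" "(\<Sum>x\<in>K. F' x) = 0"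
  \<comment> \<open>The correlation of \<open>F\<close> with a translate. It is constant on double
    cosets of \<open>B\<close>, so \<open>bij\<close> expresses its sum over \<open>K - M\<close> by
    \<open>A\<close> without the identity. It sums to zero over \<open>K\<close> and to something
    non-negative over \<open>M\<close>; hence the projection of \<open>F\<close> for
    \<open>A\<close> keeps at most the fraction \<open>1 / card A\<close> of its squared
    norm.\<close>
  define T where "T k = (\<Sum>x\<in>K. F x * F (k \<otimes> x))" for k
  have inC: "x \<in> carrier G" if "x \<in> K" for x using that subgroup.subset[OF K(1)] by auto
  have T_B: "T (b' \<otimes> a \<otimes> b) = T a" if "b' \<in> B" "a \<in> A" "b \<in> B" for a b b'
  proof -
    have mem: "b \<in> K" "b' \<in> K" "a \<in> K" using that A B by auto
    have "T (b' \<otimes> a \<otimes> b) = (\<Sum>x\<in>K. F (b \<otimes> x) * F (a \<otimes> (b \<otimes> x)))"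
      unfolding T_def
    proof (intro sum.cong refl)
      fix x assume x: "x \<in> K"
      have "b' \<otimes> a \<otimes> b \<otimes> x = b' \<otimes> (a \<otimes> (b \<otimes> x))" using mem x inC by (simp add: m_assoc)
      moreover have "a \<otimes> (b \<otimes> x) \<in> K" using mem x subgroup.m_closed[OF K(1)] by simp
      ultimately show "F x * F (b' \<otimes> a \<otimes> b \<otimes> x) = F (b \<otimes> x) * F (a \<otimes> (b \<otimes> x))"
        using F(1) that x unfolding left_invariant_def by simp
    qed
    also have "\<dots> = T a"
      unfolding T_def by (rule sum_mult_left[OF K(1) mem(1), of "\<lambda>y. F y * F (a \<otimes> y)"])
    finally show ?thesis .
  qed
  have "(\<Sum>k\<in>K - M. T k) = (\<Sum>(b', a, b)\<in>B \<times> (A - {\<one>}) \<times> B. T (b' \<otimes> a \<otimes> b))"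
    by (subst sum.reindex_bij_betw[OF bij, symmetric]) (simp add: case_prod_unfold)
  also have "\<dots> = (\<Sum>(b', a, b)\<in>B \<times> (A - {\<one>}) \<times> B. T a)"
    by (intro sum.cong refl) (use T_B in auto)
  also have "\<dots> = (\<Sum>b'\<in>B. \<Sum>a\<in>A - {\<one>}. \<Sum>b\<in>B. T a)"
    by (simp only: sum.cartesian_product)
  also have "\<dots> = (real (card B))\<^sup>2 * (\<Sum>a\<in>A - {\<one>}. T a)"
    by (simp add: sum_distrib_left power2_eq_square mult.assoc)
  finally have sumT: "(\<Sum>k\<in>K - M. T k) = (real (card B))\<^sup>2 * (\<Sum>a\<in>A - {\<one>}. T a)" .
  have sum_T: "(\<Sum>a\<in>L. T a) = card L * (\<Sum>x\<in>K. (coset_mean L F x)\<^sup>2)"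
    if L: "subgroup L G" "L \<subseteq> K" for L
  proof -
    have "(\<Sum>a\<in>L. T a) = (\<Sum>x\<in>K. F x * (\<Sum>a\<in>L. F (a \<otimes> x)))"
      unfolding T_def by (subst sum.swap) (simp add: sum_distrib_left)
    also have "\<dots> = (\<Sum>x\<in>K. card L * (F x * coset_mean L F x))"
      unfolding coset_mean_def using card_sub_pos[OF K L] by (intro sum.cong refl) simp
    finally show ?thesis using inner_coset_mean[OF K L, of F] by (simp flip: sum_distrib_left)
  qed
  have "(\<Sum>k\<in>K. T k) = 0"
  proof -
    have "coset_mean K F x = 0" if "x \<in> K" for x
      unfolding coset_mean_def using sum_mult_right[OF K(1) that, of F] F(2) by simp
    then show ?thesis using sum_T[OF K(1)] by simp
  qed
  moreover have "(\<Sum>k\<in>K. T k) = (\<Sum>k\<in>K - M. T k) + (\<Sum>k\<in>M. T k)"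
    by (rule sum.subset_diff[OF M(2) K(2)])
  moreover have "(\<Sum>k\<in>M. T k) \<ge> 0"
    unfolding sum_T[OF M] by (simp add: sum_nonneg)
  ultimately have "(real (card B))\<^sup>2 * (\<Sum>a\<in>A - {\<one>}. T a) \<le> 0" using sumT by linarith
  then have "(\<Sum>a\<in>A - {\<one>}. T a) \<le> 0" using card_sub_pos[OF K B] by (simp add: mult_le_0_iff)
  moreover have "(\<Sum>a\<in>A. T a) = (\<Sum>a\<in>A - {\<one>}. T a) + T \<one>"
    using sum.subset_diff[of "{\<one>}" A T] finite_sub[OF K A] subgroup.one_closed[OF A(1)] by simp
  moreover have "T \<one> = ?S"
    unfolding T_def by (intro sum.cong refl) (simp add: inC power2_eq_square)
  ultimately have PS: "card A * (\<Sum>x\<in>K. (?P x)\<^sup>2) \<le> ?S" using sum_T[OF A] by simp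
  \<comment> \<open>The weight in the arithmetic-geometric inequality below, chosen to match the
    ratio of the two norms.\<close>
  define s where "s = sqrt (card A)"
  have s: "s > 0" "s\<^sup>2 = card A" unfolding s_def using card_sub_pos[OF K A] by auto
  have "card A * (\<Sum>x\<in>K. F x * F' x) = (\<Sum>x\<in>K. \<Sum>a\<in>A. F (a \<otimes> x) * F' (a \<otimes> x))"
    by (rule sum_coset_sum[OF K A, of "\<lambda>y. F y * F' y", symmetric])
  also have "\<dots> = (\<Sum>x\<in>K. card A * (?P x * F' x))"
    using F'(1) card_sub_pos[OF K A] unfolding left_invariant_def coset_mean_def
    by (intro sum.cong refl) (simp flip: sum_distrib_right)
  finally have "(\<Sum>x\<in>K. F x * F' x) = (\<Sum>x\<in>K. ?P x * F' x)"
    using card_sub_pos[OF K A] by (simp flip: sum_distrib_left)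
  also have "\<dots> \<le> (\<Sum>x\<in>K. s / 2 * (?P x)\<^sup>2 + 1 / (2 * s) * (F' x)\<^sup>2)"
  proof (rule sum_mono)
    fix x
    have "0 \<le> (s * ?P x - F' x)\<^sup>2" by simp
    then have le: "2 * s * (?P x * F' x) \<le> s\<^sup>2 * (?P x)\<^sup>2 + (F' x)\<^sup>2"
      by (simp add: power2_diff power_mult_distrib mult.assoc)
    show "?P x * F' x \<le> s / 2 * (?P x)\<^sup>2 + 1 / (2 * s) * (F' x)\<^sup>2"
    proof -
      have "?P x * F' x = 2 * s * (?P x * F' x) / (2 * s)" using s(1) by simp
      also have "\<dots> \<le> (s\<^sup>2 * (?P x)\<^sup>2 + (F' x)\<^sup>2) / (2 * s)"
        using s(1) by (intro divide_right_mono[OF le]) simp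
      also have "\<dots> = s / 2 * (?P x)\<^sup>2 + 1 / (2 * s) * (F' x)\<^sup>2"
        using s(1) by (simp add: add_divide_distrib power2_eq_square)
      finally show ?thesis .
    qed
  qed
  also have "\<dots> = s / 2 * (\<Sum>x\<in>K. (?P x)\<^sup>2) + 1 / (2 * s) * ?S'"
    by (simp only: sum.distrib sum_distrib_left)
  also have "\<dots> \<le> s / 2 * (?S / s\<^sup>2) + 1 / (2 * s) * ?S'"
    using PS s card_sub_pos[OF K A]
    by (intro add_right_mono mult_left_mono) (auto simp: pos_le_divide_eq mult.commute)
  also have "s / 2 * (?S / s\<^sup>2) = 1 / s / 2 * ?S" using s(1) by (simp add: power2_eq_square)
  also have "1 / s / 2 * ?S + 1 / (2 * s) * ?S' = 1 / s / 2 * (?S + ?S')" by (simp add: distrib_left)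
  finally show "(\<Sum>x\<in>K. F x * F' x) \<le> 1 / sqrt (card A) / 2 * (?S + ?S')" unfolding s_def .
qed

end

section \<open>Groups with commuting retractions\<close>

locale retracted_group = group G for G (structure) +
  fixes d :: nat and U :: "nat \<Rightarrow> 'a set" and \<rho> :: "nat \<Rightarrow> 'a \<Rightarrow> 'a"
  assumes finite_carrier: "finite (carrier G)"
    and U_carrier: "\<And>i. i \<le> d \<Longrightarrow> U i \<subseteq> carrier G"
    and U_generate: "carrier G \<subseteq> generate G (\<Union>i\<in>{..d}. U i)"
    and retr_hom: "\<And>i. i \<le> d \<Longrightarrow> \<rho> i \<in> hom G G"
    and retr_commute: "\<And>i j x. i \<le> d \<Longrightarrow> j \<le> d \<Longrightarrow> x \<in> carrier G \<Longrightarrow> \<rho> i (\<rho> j x) = \<rho> j (\<rho> i x)"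
    and retr_idem: "\<And>i x. i \<le> d \<Longrightarrow> x \<in> carrier G \<Longrightarrow> \<rho> i (\<rho> i x) = \<rho> i x"
    and retr_fix: "\<And>i j u. i \<le> d \<Longrightarrow> j \<le> d \<Longrightarrow> i \<noteq> j \<Longrightarrow> u \<in> U j \<Longrightarrow> \<rho> i u = u"
    and retr_kill: "\<And>i u. i \<le> d \<Longrightarrow> u \<in> U i \<Longrightarrow> \<rho> i u = \<one>"
begin

text \<open>The intersection of the subgroups H_i with \<open>i\<close> in \<open>S\<close>. As
  \<open>\<rho> i\<close> is idempotent, its image H_i is also its set of fixed points.\<close>

definition stab :: "nat set \<Rightarrow> 'a set" where
  "stab S = {x \<in> carrier G. \<forall>i\<in>S. \<rho> i x = x}"

lemma retr_closed: "i \<le> d \<Longrightarrow> x \<in> carrier G \<Longrightarrow> \<rho> i x \<in> carrier G"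
  by (rule hom_in_carrier[OF retr_hom])

lemma retr_mult: "i \<le> d \<Longrightarrow> x \<in> carrier G \<Longrightarrow> y \<in> carrier G \<Longrightarrow> \<rho> i (x \<otimes> y) = \<rho> i x \<otimes> \<rho> i y"
  by (rule hom_mult[OF retr_hom])

lemma retr_one: "i \<le> d \<Longrightarrow> \<rho> i \<one> = \<one>"
  using hom_one[OF retr_hom is_group is_group] .

lemma retr_inv: "i \<le> d \<Longrightarrow> x \<in> carrier G \<Longrightarrow> \<rho> i (inv x) = inv (\<rho> i x)"
  using group_hom.hom_inv[OF group_hom.intro[OF is_group is_group group_hom_axioms.intro[OF retr_hom]]] .

lemma subgroup_stab:
  assumes "S \<subseteq> {..d}"
  shows "subgroup (stab S) G"
proof
  show "stab S \<subseteq> carrier G" unfolding stab_def by auto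
  have le: "i \<le> d" if "i \<in> S" for i using assms that by auto
  show "\<one> \<in> stab S" unfolding stab_def using retr_one le by simp
  show "x \<otimes> y \<in> stab S" if "x \<in> stab S" "y \<in> stab S" for x y
    using that retr_mult le unfolding stab_def by simp
  show "inv x \<in> stab S" if "x \<in> stab S" for x
    using that retr_inv le unfolding stab_def by simp
qed

lemma stab_Int: "stab S \<inter> stab T = stab (S \<union> T)"
  unfolding stab_def by auto

lemma stab_mono: "S \<subseteq> T \<Longrightarrow> stab T \<subseteq> stab S"
  unfolding stab_def by auto

lemma finite_stab: "finite (stab S)"
  using finite_carrier unfolding stab_def by auto

text \<open>In a product of generators, \<open>\<rho> k\<close> deletes those of index
  \<open>k\<close> and leaves the others.\<close>

lemma retr_generate:
  assumes J: "J \<subseteq> {..d}" and k: "k \<le> d" and x: "x \<in> generate G (\<Union>i\<in>J. U i)"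
  shows "\<rho> k x \<in> generate G (\<Union>i\<in>J - {k}. U i)"
proof -
  let ?H = "generate G (\<Union>i\<in>J - {k}. U i)"
  have sub: "(\<Union>i\<in>J. U i) \<subseteq> carrier G" using J U_carrier by blast
  have H: "subgroup ?H G" using J U_carrier by (intro generate_is_subgroup) blast
  have gen: "\<rho> k h \<in> ?H" if h: "h \<in> (\<Union>i\<in>J. U i)" for h
  proof -
    obtain i where i: "i \<in> J" "h \<in> U i" using h by auto
    show ?thesis
    proof (cases "i = k")
      case True
      then show ?thesis using retr_kill[OF k] i generate.one by auto
    next
      case False
      then have "\<rho> k h = h" using retr_fix[OF k, of i h] i J by auto
      then show ?thesis using False i by (auto intro: generate.incl)
    qed
  qed
  from x show ?thesis
  proof (induction rule: generate.induct)
    case one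
    then show ?case using retr_one[OF k] generate.one by simp
  next
    case (incl h)
    then show ?case by (rule gen)
  next
    case (inv h)
    then have "h \<in> carrier G" using sub by auto
    then show ?case using gen[OF inv] retr_inv[OF k] subgroup.m_inv_closed[OF H] by simp
  next
    case (eng x y)
    then have "x \<in> carrier G" "y \<in> carrier G" using generate_in_carrier[OF sub] by auto
    then show ?case using eng.IH retr_mult[OF k] subgroup.m_closed[OF H] by simp
  qed
qed

text \<open>An element fixed by a retraction equals its image, from which the generators of that
  index have been deleted; this is repeated for each index in \<open>S\<close>.\<close>

lemma stab_generate:
  assumes "S \<subseteq> {..d}"
  shows "stab S \<subseteq> generate G (\<Union>i\<in>{..d} - S. U i)"
proof -
  have "finite S" by (rule finite_subset[OF assms finite_atMost])
  then show ?thesis using assms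
  proof (induction S)
    case empty
    then show ?case using U_generate unfolding stab_def by auto
  next
    case (insert k S)
    show ?case
    proof
      fix x assume x: "x \<in> stab (insert k S)"
      then have "x \<in> generate G (\<Union>i\<in>{..d} - S. U i)"
        using insert stab_mono[of S "insert k S"] by auto
      then have "\<rho> k x \<in> generate G (\<Union>i\<in>({..d} - S) - {k}. U i)"
        using insert.prems by (intro retr_generate) auto
      moreover have "({..d} - S) - {k} = {..d} - insert k S" by auto
      moreover have "\<rho> k x = x" using x unfolding stab_def by auto
      ultimately show "x \<in> generate G (\<Union>i\<in>{..d} - insert k S. U i)" by simp
    qed
  qed
qed

lemma U_stab:
  assumes "S \<subseteq> {..d}" "i \<in> {..d} - S"
  shows "U i \<subseteq> stab S"
proof
  fix u assume u: "u \<in> U i"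
  have "\<rho> j u = u" if "j \<in> S" for j using retr_fix[of j i u] u that assms by auto
  then show "u \<in> stab S" unfolding stab_def using U_carrier[of i] u assms by auto
qed

text \<open>Connectedness of the link between the types \<open>i\<close> and \<open>j\<close>: as
  these differ, every generator with index outside \<open>S\<close> is fixed by one of the two
  additional retractions.\<close>

lemma stab_generate_two:
  assumes S: "S \<subseteq> {..d}" and ij: "i \<in> {..d} - S" "j \<in> {..d} - S" "i \<noteq> j"
  shows "stab S \<subseteq> generate G (stab (insert i S) \<union> stab (insert j S))"
proof -
  have "(\<Union>l\<in>{..d} - S. U l) \<subseteq> stab (insert i S) \<union> stab (insert j S)"
  proof (rule UN_least)
    fix l assume l: "l \<in> {..d} - S"
    show "U l \<subseteq> stab (insert i S) \<union> stab (insert j S)"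
    proof (cases "l = i")
      case True
      then have "U l \<subseteq> stab (insert j S)" using S ij by (intro U_stab) auto
      then show ?thesis by auto
    next
      case False
      then have "U l \<subseteq> stab (insert i S)" using S ij l by (intro U_stab) auto
      then show ?thesis by auto
    qed
  qed
  then show ?thesis using stab_generate[OF S] mono_generate by blast
qed

lemma stab_all: "stab {..d} = {\<one>}"
proof -
  have "stab {..d} \<subseteq> generate G (\<Union>i\<in>{..d} - {..d}. U i)" by (rule stab_generate) (rule subset_refl)
  then have "stab {..d} \<subseteq> generate G {}" by (simp only: Diff_cancel UN_empty)
  moreover have "generate G {} = {\<one>}" by (rule generate_empty)
  moreover have "\<one> \<in> stab {..d}" using subgroup.one_closed[OF subgroup_stab[of "{..d}"]] by simp
  ultimately show ?thesis by auto
qed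

text \<open>As lam / (1 - lam) is the reciprocal of 1 / lam - 1, each further free type lowers the
  denominator by one, starting from \<open>r\<close> at two free types. The condition on
  \<open>r\<close> keeps every intermediate bound below 1.\<close>

lemma angle_le_stab:
  assumes base: "\<And>S s t. S \<subseteq> {..d} \<Longrightarrow> {..d} - S = {s, t} \<Longrightarrow> s \<noteq> t \<Longrightarrow>
      angle_le (stab S) (stab (insert s S)) (stab (insert t S)) (1 / r)"
    and r: "r > real d"
    and S: "S \<subseteq> {..d}" and m: "card ({..d} - S) = m + 2"
    and st: "s \<in> {..d} - S" "t \<in> {..d} - S" "s \<noteq> t"
  shows "angle_le (stab S) (stab (insert s S)) (stab (insert t S)) (1 / (r - real m))"
  using S m st
proof (induction m arbitrary: S s t)
  case 0
  have "{s, t} \<subseteq> {..d} - S" using 0(3,4) by blast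
  moreover have "card {s, t} = card ({..d} - S)" using 0(2,5) by simp
  ultimately have "{..d} - S = {s, t}" by (metis card_subset_eq finite_Diff finite_atMost)
  from base[OF 0(1) this 0(5)] show ?case by simp
next
  case (Suc m)
  let ?J = "{..d} - S"
  have "card ?J \<le> card {..d}" by (intro card_mono) auto
  then have m: "real m + 2 \<le> real d" using Suc.prems(2) by simp
  let ?lam = "1 / (r - real m)"
  have lam: "0 < ?lam" "?lam < 1" using r m by (auto simp: divide_simps)
  have ins: "insert i S \<subseteq> {..d}" if "i \<in> ?J" for i using that Suc.prems by auto
  have "angle_le (stab S) (stab (insert s S)) (stab (insert t S)) (?lam / (1 - ?lam))"
  proof (rule angle_le_trickle_down[where J = ?J and A = "\<lambda>i. stab (insert i S)"])
    show "subgroup (stab S) G" "finite (stab S)" using subgroup_stab Suc.prems finite_stab by auto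
    show "3 \<le> card ?J" using Suc.prems by simp
    show "subgroup (stab (insert i S)) G" if "i \<in> ?J" for i using subgroup_stab[OF ins[OF that]] .
    show "stab (insert i S) \<subseteq> stab S" for i by (rule stab_mono) auto
    show "stab S \<subseteq> generate G (stab (insert i S) \<union> stab (insert j S))"
      if "i \<in> ?J" "j \<in> ?J" "i \<noteq> j" for i j
      using stab_generate_two[OF Suc.prems(1) that] .
    fix i j l assume ijl: "i \<in> ?J" "j \<in> ?J" "l \<in> ?J" "i \<noteq> j" "i \<noteq> l" "j \<noteq> l"
    have Int: "stab (insert l S) \<inter> stab (insert k S) = stab (insert k (insert l S))" for k
      unfolding stab_Int by (rule arg_cong[where f = stab]) auto
    have "{..d} - insert l S = ?J - {l}" by auto
    then have "card ({..d} - insert l S) = m + 2" using Suc.prems(2) ijl(3) by simp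
    then show "angle_le (stab (insert l S)) (stab (insert l S) \<inter> stab (insert i S))
        (stab (insert l S) \<inter> stab (insert j S)) ?lam"
      unfolding Int using ijl by (intro Suc.IH ins) auto
  next
    show "finite ?J" by simp
  qed (fact lam Suc.prems)+
  moreover have "?lam / (1 - ?lam) = 1 / (r - real (Suc m))" using lam r m by (simp add: field_simps)
  ultimately show ?case by simp
qed

text \<open>If \<open>y\<close> lies in \<open>H\<^sub>k H\<^sub>i\<close> then \<open>\<rho>\<^sub>i\<close> moves \<open>y\<close> into \<open>H\<^sub>i\<close> within the coset \<open>H\<^sub>k y\<close>; as the
  retractions commute, this can be done for all \<open>i\<close> in turn.\<close>
lemma common_coset_representative:
  assumes k: "k \<le> d" and y: "y \<in> carrier G" and T: "T \<subseteq> {..d}"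
    and fact: "\<And>i. i \<in> T \<Longrightarrow> \<exists>a\<in>stab {k}. \<exists>b\<in>stab {i}. y = a \<otimes> b"
  shows "\<exists>e\<in>stab T. e \<otimes> inv y \<in> stab {k}"
proof -
  have "finite T" by (rule finite_subset[OF T finite_atMost])
  then show ?thesis using T fact
  proof (induction T)
    case empty
    have "y \<otimes> inv y \<in> stab {k}" using y subgroup.one_closed[OF subgroup_stab[of "{k}"]] k by simp
    moreover have "y \<in> stab {}" using y unfolding stab_def by simp
    ultimately show ?case by (rule bexI)
  next
    case (insert i T)
    then obtain e where e: "e \<in> stab T" "e \<otimes> inv y \<in> stab {k}" by auto
    obtain a b where ab: "a \<in> stab {k}" "b \<in> stab {i}" "y = a \<otimes> b" using insert.prems(2)[of i] by auto
    have i: "i \<le> d" using insert.prems by auto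
    have car: "e \<in> carrier G" "a \<in> carrier G" "b \<in> carrier G" using e ab unfolding stab_def by auto
    have Hk: "subgroup (stab {k}) G" using k by (intro subgroup_stab) auto
    \<comment> \<open>\<open>e\<close> keeps a factorisation in H_k H_i although it differs from
      \<open>y\<close>: only the left factor has changed, within H_k.\<close>
    define a' where "a' = e \<otimes> inv y \<otimes> a"
    have a': "a' \<in> stab {k}" unfolding a'_def using subgroup.m_closed[OF Hk] e(2) ab(1) by simp
    have a'c: "a' \<in> carrier G" using a' unfolding stab_def by auto
    have "e = a' \<otimes> b"
      unfolding a'_def ab(3) using car by (simp add: m_assoc inv_mult_group)
    then have re: "\<rho> i e = \<rho> i a' \<otimes> b" using retr_mult[OF i a'c car(3)] ab(2) unfolding stab_def by simp
    have ra: "\<rho> i a' \<in> stab {k}"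
      using a' retr_closed[OF i a'c] retr_commute[OF k i a'c] unfolding stab_def by simp
    have "\<rho> i e \<in> stab (insert i T)"
    proof -
      have "\<rho> j (\<rho> i e) = \<rho> i e" if "j \<in> T" for j
        using retr_commute[of j i e] that insert.prems(1) i e(1) car(1) unfolding stab_def by auto
      then show ?thesis using retr_closed[OF i car(1)] retr_idem[OF i car(1)] unfolding stab_def by auto
    qed
    moreover have "\<rho> i e \<otimes> inv y = \<rho> i a' \<otimes> inv a"
      unfolding re ab(3) using car retr_closed[OF i a'c] by (simp add: m_assoc inv_mult_group) (simp add: m_assoc[symmetric])
    then have "\<rho> i e \<otimes> inv y \<in> stab {k}"
      using subgroup.m_closed[OF Hk ra subgroup.m_inv_closed[OF Hk ab(1)]] by simp
    ultimately show ?case by blast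
  qed
qed

text \<open>The vertices are right cosets tagged with their type. They are injected into the natural
  numbers because the graphs have to live there.\<close>

lemma exists_vertex_encoding:
  "\<exists>v :: nat \<Rightarrow> 'a \<Rightarrow> nat. \<forall>i\<le>d. \<forall>j\<le>d. \<forall>x\<in>carrier G. \<forall>y\<in>carrier G.
     v i x = v j y \<longleftrightarrow> i = j \<and> x \<otimes> inv y \<in> stab {i}"
proof -
  define P where "P = (\<lambda>(i, x). (i, stab {i} #> x)) ` ({..d} \<times> carrier G)"
  have "finite P" unfolding P_def using finite_carrier by auto
  then obtain e :: "nat \<times> 'a set \<Rightarrow> nat" where e: "inj_on e P"
    using finite_imp_inj_to_nat_seg by blast
  have "e (i, stab {i} #> x) = e (j, stab {j} #> y) \<longleftrightarrow> i = j \<and> x \<otimes> inv y \<in> stab {i}"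
    if "i \<le> d" "j \<le> d" "x \<in> carrier G" "y \<in> carrier G" for i j x y
  proof -
    have H: "subgroup (stab {i}) G" using that by (intro subgroup_stab) auto
    have "e (i, stab {i} #> x) = e (j, stab {j} #> y) \<longleftrightarrow> i = j \<and> stab {i} #> x = stab {i} #> y"
      using that by (subst inj_on_eq_iff[OF e]) (auto simp: P_def)
    also have "stab {i} #> x = stab {i} #> y \<longleftrightarrow> x \<otimes> inv y \<in> stab {i}"
    proof
      assume "stab {i} #> x = stab {i} #> y"
      then have "x \<in> stab {i} #> y" using rcos_self[OF that(3) H] by simp
      then obtain h where h: "h \<in> stab {i}" "x = h \<otimes> y" unfolding r_coset_def by auto
      have "h \<in> carrier G" using h(1) unfolding stab_def by auto
      then have "x \<otimes> inv y = h" using h(2) that(4) by (simp add: m_assoc)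
      then show "x \<otimes> inv y \<in> stab {i}" using h(1) by simp
    next
      assume a: "x \<otimes> inv y \<in> stab {i}"
      have "x = x \<otimes> inv y \<otimes> y" using that by (simp add: m_assoc)
      then have "x \<in> stab {i} #> y" unfolding r_coset_def using a by auto
      then show "stab {i} #> x = stab {i} #> y" using repr_independence[OF _ that(4) H] by simp
    qed
    finally show ?thesis .
  qed
  then show ?thesis by (intro exI[of _ "\<lambda>i x. e (i, stab {i} #> x)"]) blast
qed

text \<open>With right cosets as vertices, the residue of type \<open>S\<close> at \<open>x\<close>
  is \<open>stab S\<close> translated by \<open>x\<close>. Its size is therefore independent of
  \<open>x\<close>, and angles in the group become angles in links.\<close>

theorem chamber_system:
  assumes v: "\<forall>i\<le>d. \<forall>j\<le>d. \<forall>x\<in>carrier G. \<forall>y\<in>carrier G.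
      v i x = v j y \<longleftrightarrow> i = j \<and> x \<otimes> inv y \<in> stab {i}"
    and h: "\<And>S. S \<subseteq> {..d} \<Longrightarrow> card (stab S) = h (card S)"
    and base: "\<And>S s t. S \<subseteq> {..d} \<Longrightarrow> {..d} - S = {s, t} \<Longrightarrow> s \<noteq> t \<Longrightarrow>
      angle_le (stab S) (stab (insert s S)) (stab (insert t S)) (1 / r)"
    and r: "r > real d + 1"
  shows "chamber_system (carrier G) d v h (1 / (r - real d))"
proof -
  have v_iff: "v i x = v i y \<longleftrightarrow> x \<otimes> inv y \<in> stab {i}" if "i \<le> d" "x \<in> carrier G" "y \<in> carrier G" for i x y
    using v that by simp
  have residue: "{y \<in> carrier G. \<forall>i\<in>S. v i y = v i x} = (\<lambda>a. a \<otimes> x) ` stab S"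
    if S: "S \<subseteq> {..d}" and x: "x \<in> carrier G" for S x
  proof (intro equalityI subsetI)
    fix y assume "y \<in> {y \<in> carrier G. \<forall>i\<in>S. v i y = v i x}"
    then have y: "y \<in> carrier G" "\<And>i. i \<in> S \<Longrightarrow> y \<otimes> inv x \<in> stab {i}"
      using v_iff[of _ y x] S x by auto
    then have "y \<otimes> inv x \<in> stab S" using x unfolding stab_def by auto
    moreover have "y = y \<otimes> inv x \<otimes> x" using x y by (simp add: m_assoc)
    ultimately show "y \<in> (\<lambda>a. a \<otimes> x) ` stab S" by auto
  next
    fix y assume "y \<in> (\<lambda>a. a \<otimes> x) ` stab S"
    then obtain a where a: "a \<in> stab S" "y = a \<otimes> x" by auto
    then have ac: "a \<in> carrier G" unfolding stab_def by auto
    then have "y \<otimes> inv x = a" using a x by (simp add: m_assoc)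
    moreover have "a \<in> stab {i}" if "i \<in> S" for i using a(1) that unfolding stab_def by auto
    ultimately show "y \<in> {y \<in> carrier G. \<forall>i\<in>S. v i y = v i x}"
      using v_iff[of _ y x] S x a ac by auto
  qed
  have inj: "inj_on (\<lambda>a. a \<otimes> x) (stab S)" if "x \<in> carrier G" for S x
    using that unfolding stab_def by (auto intro!: inj_onI)
  show ?thesis
  proof
    show "finite (carrier G)" by (rule finite_carrier)
    show "carrier G \<noteq> {}" by auto
    show "i = j" if "i \<le> d" "j \<le> d" "x \<in> carrier G" "y \<in> carrier G" "v i x = v j y" for i j x y
      using v that by blast
    show "card {y \<in> carrier G. \<forall>i\<in>S. v i y = v i x} = h (card S)"
      if "S \<subseteq> {..d}" "x \<in> carrier G" for S x
      unfolding residue[OF that] using card_image[OF inj[OF that(2), of S]] h[OF that(1)] by simp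
    have "h (card {..d}) = card {\<one>}" using h[OF order_refl] unfolding stab_all by (rule sym)
    then show "h (d + 1) = 1" by simp
    show "1 / (r - real d) < 1" using r by simp
  next
    fix T :: "nat set" and g
    assume T: "T \<subseteq> {..d}" and g: "\<And>i. i \<in> T \<Longrightarrow> g i \<in> carrier G"
      and pair: "\<And>i j. i \<in> T \<Longrightarrow> j \<in> T \<Longrightarrow> \<exists>z\<in>carrier G. v i z = v i (g i) \<and> v j z = v j (g j)"
    have "finite T" by (rule finite_subset[OF T finite_atMost])
    then show "\<exists>z\<in>carrier G. \<forall>i\<in>T. v i z = v i (g i)" using T g pair
    proof (induction T)
      case empty
      then show ?case by auto
    next
      case (insert k T)
      have "\<exists>z\<in>carrier G. \<forall>i\<in>T. v i z = v i (g i)"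
        by (rule insert.IH) (use insert.prems in auto)
      then obtain z0 where z0: "z0 \<in> carrier G" "\<And>i. i \<in> T \<Longrightarrow> v i z0 = v i (g i)" by auto
      have k: "k \<le> d" and gk: "g k \<in> carrier G" and Td: "T \<subseteq> {..d}" using insert.prems by auto
      \<comment> \<open>\<open>z0\<close> already meets the cosets for \<open>T\<close>. For each
        \<open>i\<close>, a chamber common to the types \<open>i\<close> and \<open>k\<close>
        factors \<open>?y\<close> in H_k H_i; the common representative \<open>e\<close> then
        carries \<open>z0\<close> into the coset for \<open>k\<close> without leaving the
        others.\<close>
      let ?y = "g k \<otimes> inv z0"
      have "\<exists>e\<in>stab T. e \<otimes> inv ?y \<in> stab {k}"
      proof (rule common_coset_representative[OF k _ Td])
        show "?y \<in> carrier G" using z0 gk by simp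
        fix i assume i: "i \<in> T"
        then have id: "i \<le> d" using Td by auto
        obtain z where z: "z \<in> carrier G" "v i z = v i (g i)" "v k z = v k (g k)"
          using insert.prems(3)[of i k] i by auto
        have "g k \<otimes> inv z \<in> stab {k}" using v_iff[OF k gk z(1)] z(3) by simp
        moreover have "z \<otimes> inv z0 \<in> stab {i}" using v_iff[OF id z(1) z0(1)] z(2) z0(2)[OF i] by simp
        moreover have "?y = g k \<otimes> inv z \<otimes> (z \<otimes> inv z0)"
          using gk z(1) z0(1) by (simp add: m_assoc inv_solve_left)
        ultimately show "\<exists>a\<in>stab {k}. \<exists>b\<in>stab {i}. ?y = a \<otimes> b" by blast
      qed
      then obtain e where e: "e \<in> stab T" "e \<otimes> inv ?y \<in> stab {k}" by auto
      have ec: "e \<in> carrier G" using e(1) unfolding stab_def by auto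
      have "v i (e \<otimes> z0) = v i (g i)" if i: "i \<in> T" for i
      proof -
        have "e \<otimes> z0 \<otimes> inv z0 = e" using ec z0(1) by (simp add: m_assoc)
        moreover have "e \<in> stab {i}" using e(1) i unfolding stab_def by auto
        ultimately have "v i (e \<otimes> z0) = v i z0" using v_iff[of i "e \<otimes> z0" z0] ec z0(1) i Td by auto
        then show ?thesis using z0(2)[OF i] by simp
      qed
      moreover have "v k (e \<otimes> z0) = v k (g k)"
        using e(2) v_iff[OF k, of "e \<otimes> z0" "g k"] ec z0(1) gk by (simp add: inv_mult_group m_assoc)
      ultimately show ?case using ec z0(1) by (intro bexI[of _ "e \<otimes> z0"]) auto
    qed
  next
    fix S x s t and F F' :: "nat \<Rightarrow> real"
    assume S: "S \<subseteq> {..d}" and x: "x \<in> carrier G" and st: "s \<in> {..d} - S" "t \<in> {..d} - S" "s \<noteq> t"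
    let ?R = "{y \<in> carrier G. \<forall>i\<in>S. v i y = v i x}" and ?K = "stab S" and ?c = "1 / (r - real d)"
    define f f' where "f a = F (v s (a \<otimes> x))" and "f' a = F' (v t (a \<otimes> x))" for a
    have reindex: "(\<Sum>y\<in>?R. p y) = (\<Sum>a\<in>?K. p (a \<otimes> x))" for p :: "'a \<Rightarrow> real"
      unfolding residue[OF S x] by (rule sum.reindex[OF inj[OF x], unfolded o_def])
    have K: "subgroup ?K G" by (rule subgroup_stab[OF S])
    have K0: "?K \<noteq> {}" using subgroup.one_closed[OF K] by auto
    have li: "left_invariant ?K (stab (insert i S)) (\<lambda>a. p (v i (a \<otimes> x)))"
      if i: "i \<in> {..d} - S" for i and p :: "nat \<Rightarrow> real"
      unfolding left_invariant_def
    proof (intro ballI)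
      fix b a assume b: "b \<in> stab (insert i S)" and a: "a \<in> stab S"
      then have car: "a \<in> carrier G" "b \<in> carrier G" unfolding stab_def by auto
      have "b \<otimes> a \<otimes> x \<otimes> inv (a \<otimes> x) = b"
        using car x by (simp add: m_assoc inv_mult_group) (simp add: m_assoc[symmetric])
      moreover have "b \<in> stab {i}" using b unfolding stab_def by auto
      ultimately show "p (v i (b \<otimes> a \<otimes> x)) = p (v i (a \<otimes> x))"
        using v_iff[of i "b \<otimes> a \<otimes> x" "a \<otimes> x"] i car x by simp
    qed
    have "card {s, t} \<le> card ({..d} - S)" using st by (intro card_mono) auto
    then obtain m where m: "card ({..d} - S) = m + 2"
      using st(3) by (metis card_2_iff le_Suc_ex add.commute)
    have "card ({..d} - S) \<le> card {..d}" by (intro card_mono) auto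
    then have md: "real m \<le> real d" using m by simp
    have "r > real d" using r by simp
    from angle_le_stab[OF base this S m st]
    have "angle_le ?K (stab (insert s S)) (stab (insert t S)) (1 / (r - real m))" .
    then have "angle_le ?K (stab (insert s S)) (stab (insert t S)) ?c"
      by (rule angle_le_mono) (use md r in \<open>simp add: frac_le\<close>)
    from angle_le_with_means[OF this li[OF st(1), of F] li[OF st(2), of F'] finite_stab K0]
    have "(\<Sum>a\<in>?K. f a * f' a) \<le> (\<Sum>a\<in>?K. f a) * (\<Sum>a\<in>?K. f' a) / card ?K +
      ?c / 2 * (((\<Sum>a\<in>?K. (f a)\<^sup>2) - (\<Sum>a\<in>?K. f a)\<^sup>2 / card ?K) + ((\<Sum>a\<in>?K. (f' a)\<^sup>2) - (\<Sum>a\<in>?K. f' a)\<^sup>2 / card ?K))"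
      unfolding f_def f'_def .
    also have "\<dots> \<le> (\<Sum>a\<in>?K. f a) * (\<Sum>a\<in>?K. f' a) / card ?K +
      ?c / 2 * ((\<Sum>a\<in>?K. (f a)\<^sup>2) + (\<Sum>a\<in>?K. (f' a)\<^sup>2))"
      using r by (intro add_left_mono mult_left_mono add_mono) auto
    finally show "(\<Sum>y\<in>?R. F (v s y) * F' (v t y)) \<le> (\<Sum>y\<in>?R. F (v s y)) * (\<Sum>y\<in>?R. F' (v t y)) / h (card S) +
      ?c / 2 * ((\<Sum>y\<in>?R. (F (v s y))\<^sup>2) + (\<Sum>y\<in>?R. (F' (v t y))\<^sup>2))"
      unfolding reindex h[OF S, symmetric] f_def f'_def .
  qed
qed

end

section \<open>The truncated word group\<close>

text \<open>Periodic words in which equal letters are at least d + 1 apart, so that they are killed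
  only by the length bound. Letters are prefixed because the step rule of \<open>elems\<close>
  multiplies from the left.\<close>

fun cyclic_word :: "nat \<Rightarrow> nat \<Rightarrow> nat list" where
  "cyclic_word d 0 = []"
| "cyclic_word d (Suc k) = (k mod Suc d) # cyclic_word d k"

lemma length_cyclic_word [simp]: "length (cyclic_word d k) = k"
  by (induction k) auto

lemma nth_cyclic_word: "j < k \<Longrightarrow> cyclic_word d k ! j = (k - 1 - j) mod Suc d"
proof (induction k arbitrary: j)
  case (Suc k)
  then show ?case by (cases j) auto
qed simp

text \<open>\<open>R\<close> is a finite subring of a domain and hence a field
  (\<open>R_divide\<close>). By \<open>2 \<le> d\<close>, surviving words in two letters have length
  at most 2; by \<open>d \<le> L\<close>, the length bound does not affect words that omit a
  letter.\<close>

locale word_group =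
  fixes d L :: nat and R :: "'f :: idom set"
  assumes d_ge: "2 \<le> d" and d_le_L: "d \<le> L"
    and finite_R: "finite R" and R_0: "0 \<in> R" and R_1: "1 \<in> R"
    and R_add: "\<And>x y. x \<in> R \<Longrightarrow> y \<in> R \<Longrightarrow> x + y \<in> R"
    and R_mult: "\<And>x y. x \<in> R \<Longrightarrow> y \<in> R \<Longrightarrow> x * y \<in> R"
    and R_minus: "\<And>x. x \<in> R \<Longrightarrow> - x \<in> R"
begin

text \<open>The monomials that stay non-zero. They are closed under factors, so the others span an
  ideal.\<close>

definition words :: "nat list set" where
  "words = {w. set w \<subseteq> {..d} \<and> length w \<le> L \<and>
     (\<forall>i j. i < j \<longrightarrow> j < length w \<longrightarrow> j \<le> i + d \<longrightarrow> w ! i \<noteq> w ! j)}"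

text \<open>An element of the algebra is represented by its coefficient function; this is the
  product.\<close>

definition conv :: "(nat list \<Rightarrow> 'f) \<Rightarrow> (nat list \<Rightarrow> 'f) \<Rightarrow> nat list \<Rightarrow> 'f" where
  "conv f g w = (if w \<in> words then \<Sum>k\<le>length w. f (take k w) * g (drop k w) else 0)"

text \<open>The element 1 + a x_i; hence \<open>gen 0 0\<close> is the identity.\<close>

definition gen :: "nat \<Rightarrow> 'f \<Rightarrow> nat list \<Rightarrow> 'f" where
  "gen i a w = (if w = [] then 1 else if w = [i] then a else 0)"

abbreviation unit :: "nat list \<Rightarrow> 'f" where
  "unit \<equiv> gen 0 0"

text \<open>Products of the elements 1 + a x_i suffice for a group: x_i squares to zero, so 1 - a
  x_i is inverse to 1 + a x_i.\<close>

inductive_set elems :: "(nat list \<Rightarrow> 'f) set" where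
  unit: "unit \<in> elems"
| step: "i \<le> d \<Longrightarrow> a \<in> R \<Longrightarrow> g \<in> elems \<Longrightarrow> conv (gen i a) g \<in> elems"

definition grp :: "(nat list \<Rightarrow> 'f) monoid" where
  "grp = \<lparr>carrier = elems, monoid.mult = conv, one = unit\<rparr>"

definition kill :: "nat \<Rightarrow> (nat list \<Rightarrow> 'f) \<Rightarrow> nat list \<Rightarrow> 'f" where
  "kill i f w = (if i \<in> set w then 0 else f w)"

lemma unit_apply: "unit w = (if w = [] then 1 else 0)"
  unfolding gen_def by auto

lemma gen_zero: "gen i 0 = unit"
  unfolding gen_def by auto

section \<open>Words that survive the truncation\<close>

lemma words_nth_neq: "w \<in> words \<Longrightarrow> i < j \<Longrightarrow> j < length w \<Longrightarrow> j \<le> i + d \<Longrightarrow> w ! i \<noteq> w ! j"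
  unfolding words_def by simp

lemma words_letters: "w \<in> words \<Longrightarrow> set w \<subseteq> {..d}"
  unfolding words_def by simp

lemma words_take:
  assumes "w \<in> words"
  shows "take k w \<in> words"
proof -
  have "length w \<le> L" using assms unfolding words_def by simp
  then show ?thesis
    using words_letters[OF assms] set_take_subset[of k w] words_nth_neq[OF assms]
    unfolding words_def by (simp add: subset_trans)
qed

lemma words_drop:
  assumes "w \<in> words"
  shows "drop k w \<in> words"
proof -
  have "w ! (k + i) \<noteq> w ! (k + j)" if "i < j" "j < length w - k" "j \<le> i + d" for i j
    using words_nth_neq[OF assms, of "k + i" "k + j"] that by simp
  moreover have "length w \<le> L" using assms unfolding words_def by simp
  ultimately show ?thesis
    using words_letters[OF assms] set_drop_subset[of k w] unfolding words_def by (simp add: subset_trans)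
qed

lemma Nil_words [simp]: "[] \<in> words"
  unfolding words_def by simp

lemma singleton_words: "i \<le> d \<Longrightarrow> [i] \<in> words"
  unfolding words_def using d_ge d_le_L by auto

lemma pair_words: "i \<le> d \<Longrightarrow> j \<le> d \<Longrightarrow> i \<noteq> j \<Longrightarrow> [i, j] \<in> words"
  unfolding words_def using d_ge d_le_L by (auto simp: less_Suc_eq)

lemma words_repeat: "i # i # w \<notin> words"
  using words_nth_neq[of "i # i # w" 0 1] d_ge by auto

text \<open>The first \<open>d + 1\<close> letters of a longer word are distinct, so every letter occurs among them.\<close>
lemma length_word_avoiding:
  assumes w: "w \<in> words" and t: "t \<le> d" "t \<notin> set w"
  shows "length w \<le> d"
proof (rule ccontr)
  assume "\<not> length w \<le> d"
  then have len: "d < length w" by simp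
  have "inj_on ((!) w) {..d}"
  proof (rule inj_onI)
    fix i j assume ij: "i \<in> {..d}" "j \<in> {..d}" "w ! i = w ! j"
    then show "i = j"
      using words_nth_neq[OF w, of i j] words_nth_neq[OF w, of j i] len
      by (cases i j rule: linorder_cases) auto
  qed
  then have "card ((!) w ` {..d}) = d + 1" by (simp add: card_image)
  moreover have "(!) w ` {..d} \<subseteq> {..d} - {t}"
  proof
    fix x assume "x \<in> (!) w ` {..d}"
    then have "x \<in> set w" using len by auto
    then show "x \<in> {..d} - {t}" using words_letters[OF w] t(2) by auto
  qed
  then have "card ((!) w ` {..d}) \<le> card ({..d} - {t})" by (intro card_mono) auto
  ultimately show False using t(1) by simp
qed

lemma finite_words: "finite words"
proof -
  have "words \<subseteq> {w. set w \<subseteq> {..d} \<and> length w \<le> L}" unfolding words_def by auto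
  then show ?thesis using finite_lists_length_le[of "{..d}" L] finite_subset by auto
qed

lemma cyclic_word_words:
  assumes "k \<le> L"
  shows "cyclic_word d k \<in> words"
proof -
  have "set (cyclic_word d k) \<subseteq> {..d}" by (induction k) (auto simp: less_Suc_eq_le[symmetric])
  moreover have "cyclic_word d k ! i \<noteq> cyclic_word d k ! j" if ij: "i < j" "j < k" "j \<le> i + d" for i j
  proof
    assume "cyclic_word d k ! i = cyclic_word d k ! j"
    then have "(k - 1 - i) mod Suc d = (k - 1 - j) mod Suc d" using nth_cyclic_word ij by auto
    then have "Suc d dvd (k - 1 - i) - (k - 1 - j)" using ij by (intro mod_eq_dvd_iff_nat[THEN iffD1]) auto
    moreover have "(k - 1 - i) - (k - 1 - j) = j - i" using ij by simp
    ultimately have "Suc d \<le> j - i" using ij by (intro dvd_imp_le) auto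
    then show False using ij by simp
  qed
  ultimately show ?thesis using assms unfolding words_def by auto
qed

section \<open>The group law\<close>

lemma conv_gen:
  "conv (gen i a) g w = (if w \<in> words then g w + (case w of [] \<Rightarrow> 0 | j # w' \<Rightarrow> if j = i then a * g w' else 0) else 0)"
proof (cases w)
  case Nil
  then show ?thesis unfolding conv_def gen_def by simp
next
  case (Cons j w')
  have "(\<Sum>k\<le>length w. gen i a (take k w) * g (drop k w)) = (\<Sum>k\<in>{0, 1}. gen i a (take k w) * g (drop k w))"
    by (rule sum.mono_neutral_right) (auto simp: Cons gen_def take_Cons' split: if_splits)
  then show ?thesis unfolding conv_def by (simp add: Cons gen_def)
qed

text \<open>Both sides sum over two cut positions in \<open>w\<close>; the word test in the inner
  product always succeeds because factors of words are words.\<close>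

lemma conv_assoc: "conv (conv f g) h = conv f (conv g h)"
proof
  fix w
  show "conv (conv f g) h w = conv f (conv g h) w"
  proof (cases "w \<in> words")
    case True
    let ?n = "length w"
    have "conv (conv f g) h w = (\<Sum>k\<le>?n. \<Sum>l\<le>k. f (take l w) * g (drop l (take k w)) * h (drop k w))"
      using True unfolding conv_def by (auto simp: words_take sum_distrib_right min_def intro!: sum.cong)
    also have "\<dots> = (\<Sum>(k, l)\<in>(SIGMA k:{..?n}. {..k}). f (take l w) * g (drop l (take k w)) * h (drop k w))"
      by (rule sum.Sigma) auto
    also have "\<dots> = (\<Sum>(l, m)\<in>(SIGMA l:{..?n}. {..?n - l}). f (take l w) * g (take m (drop l w)) * h (drop m (drop l w)))"
      by (rule sum.reindex_bij_witness[where i = "\<lambda>(l, m). (l + m, l)" and j = "\<lambda>(k, l). (l, k - l)"])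
         (auto simp: drop_take add.commute)
    also have "\<dots> = (\<Sum>l\<le>?n. \<Sum>m\<le>?n - l. f (take l w) * g (take m (drop l w)) * h (drop m (drop l w)))"
      by (rule sum.Sigma[symmetric]) auto
    also have "\<dots> = conv f (conv g h) w"
      using True unfolding conv_def by (auto simp: words_drop sum_distrib_left mult.assoc intro!: sum.cong)
    finally show ?thesis .
  qed (simp add: conv_def)
qed

lemma elems_support: "f \<in> elems \<Longrightarrow> w \<notin> words \<Longrightarrow> f w = 0"
  by (induction rule: elems.induct) (auto simp: unit_apply conv_gen)

lemma elems_Nil: "f \<in> elems \<Longrightarrow> f [] = 1"
  by (induction rule: elems.induct) (auto simp: unit_apply conv_gen)

lemma elems_R: "f \<in> elems \<Longrightarrow> f w \<in> R"
  by (induction arbitrary: w rule: elems.induct)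
     (auto simp: unit_apply conv_gen R_0 R_1 R_add R_mult split: list.split)

lemma conv_unit_left: "f \<in> elems \<Longrightarrow> conv unit f = f"
  by (rule ext) (auto simp: conv_gen elems_support split: list.split)

lemma conv_elems: "f \<in> elems \<Longrightarrow> g \<in> elems \<Longrightarrow> conv f g \<in> elems"
  by (induction rule: elems.induct) (auto simp: conv_unit_left conv_assoc intro: elems.step)

lemma conv_gen_unit: "i \<le> d \<Longrightarrow> conv (gen i a) unit = gen i a"
  by (rule ext) (auto simp: conv_gen unit_apply gen_def singleton_words split: list.split)

lemma gen_elems: "i \<le> d \<Longrightarrow> a \<in> R \<Longrightarrow> gen i a \<in> elems"
  using elems.step[OF _ _ elems.unit] conv_gen_unit by metis

lemma conv_gen_gen: "i \<le> d \<Longrightarrow> conv (gen i a) (gen i b) = gen i (a + b)"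
  by (rule ext)
     (auto simp: conv_gen gen_def singleton_words words_repeat split: list.split)

lemma elems_left_inverse: "f \<in> elems \<Longrightarrow> \<exists>g\<in>elems. conv g f = unit"
proof (induction rule: elems.induct)
  case unit
  then show ?case using conv_unit_left elems.unit by blast
next
  case (step i a f)
  then obtain g where g: "g \<in> elems" "conv g f = unit" by auto
  have m: "gen i (- a) \<in> elems" using step gen_elems R_minus by auto
  have "conv (conv g (gen i (- a))) (conv (gen i a) f) = conv g (conv (conv (gen i (- a)) (gen i a)) f)"
    by (simp add: conv_assoc)
  also have "conv (gen i (- a)) (gen i a) = unit"
    using conv_gen_gen[OF step.hyps(1), of "- a" a] gen_zero[of i] by (simp only: add.left_inverse)
  also have "conv g (conv unit f) = unit"
    by (simp only: conv_unit_left[OF step.hyps(3)] g(2))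
  finally show ?case using conv_elems[OF g(1) m] by blast
qed

sublocale group grp
  by (rule groupI)
     (auto simp: grp_def elems.unit conv_elems conv_assoc conv_unit_left elems_left_inverse)

lemma grp_simps [simp]: "carrier grp = elems" "mult grp = conv" "one grp = unit"
  unfolding grp_def by auto

text \<open>The monomials containing \<open>t\<close> span an ideal, and discarding them is the
  quotient by it: a product of words contains \<open>t\<close> iff one of the factors does.\<close>

lemma kill_conv: "kill t (conv f g) = conv (kill t f) (kill t g)"
proof
  fix w
  show "kill t (conv f g) w = conv (kill t f) (kill t g) w"
  proof (cases "t \<in> set w")
    case True
    then have "t \<in> set (take k w) \<or> t \<in> set (drop k w)" for k
      by (metis Un_iff append_take_drop_id set_append)
    then have "kill t f (take k w) * kill t g (drop k w) = 0" for k unfolding kill_def by auto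
    then show ?thesis using True unfolding conv_def by (simp add: kill_def)
  next
    case False
    then have "t \<notin> set (take k w)" "t \<notin> set (drop k w)" for k by (meson in_set_takeD in_set_dropD)+
    then show ?thesis using False unfolding conv_def kill_def by simp
  qed
qed

lemma kill_gen: "kill t (gen i a) = (if t = i then unit else gen i a)"
  by (rule ext) (auto simp: kill_def gen_def)

lemma kill_unit: "kill t unit = unit"
  by (rule ext) (auto simp: kill_def unit_apply)

lemma kill_elems: "f \<in> elems \<Longrightarrow> kill t f \<in> elems"
  by (induction rule: elems.induct)
     (auto simp: kill_unit kill_conv kill_gen elems.unit conv_unit_left intro: elems.step)

lemma finite_elems: "finite elems"
proof -
  have "finite {f. \<forall>w. (w \<in> words \<longrightarrow> f w \<in> R) \<and> (w \<notin> words \<longrightarrow> f w = 0)}"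
    by (rule finite_set_of_finite_funs[OF finite_words finite_R])
  then show ?thesis by (rule rev_finite_subset) (auto simp: elems_R elems_support)
qed

definition gens :: "nat \<Rightarrow> (nat list \<Rightarrow> 'f) set" where
  "gens i = gen i ` R"

sublocale retracted_group grp d gens kill
proof
  show "finite (carrier grp)" using finite_elems by simp
  show "gens i \<subseteq> carrier grp" if "i \<le> d" for i using gen_elems that unfolding gens_def by auto
  show "carrier grp \<subseteq> generate grp (\<Union>i\<in>{..d}. gens i)"
  proof
    fix f assume "f \<in> carrier grp"
    then have "f \<in> elems" by simp
    then show "f \<in> generate grp (\<Union>i\<in>{..d}. gens i)"
    proof (induction rule: elems.induct)
      case unit
      then show ?case using generate.one[of grp] by simp
    next
      case (step i a f)
      then have "gen i a \<in> generate grp (\<Union>i\<in>{..d}. gens i)"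
        by (intro generate.incl) (auto simp: gens_def)
      from generate.eng[OF this step.IH] show ?case by simp
    qed
  qed
  show "kill i \<in> hom grp grp" for i by (rule homI) (auto simp: kill_elems kill_conv)
  show "kill i (kill j f) = kill j (kill i f)" for i j f unfolding kill_def by auto
  show "kill i (kill i f) = kill i f" for i f unfolding kill_def by auto
  show "kill i u = u" if "i \<noteq> j" "u \<in> gens j" for i j u using that kill_gen unfolding gens_def by auto
  show "kill i u = \<one>\<^bsub>grp\<^esub>" if "u \<in> gens i" for i u using that kill_gen unfolding gens_def by auto
qed

section \<open>The groups on one and two letters\<close>

lemma stab_iff: "f \<in> stab S \<longleftrightarrow> f \<in> elems \<and> (\<forall>w. set w \<inter> S \<noteq> {} \<longrightarrow> f w = 0)"
proof -
  have "kill i f = f \<longleftrightarrow> (\<forall>w. i \<in> set w \<longrightarrow> f w = 0)" for i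
    unfolding kill_def by (auto simp: fun_eq_iff)
  then show ?thesis unfolding stab_def by auto
qed

text \<open>The relation survives left multiplication by 1 + a x_i. It removes one of the four
  coefficients of the group on two letters, which thereby is the Heisenberg group over
  \<open>R\<close>.\<close>

lemma elems_commutator: "f \<in> elems \<Longrightarrow> s \<le> d \<Longrightarrow> t \<le> d \<Longrightarrow> s \<noteq> t \<Longrightarrow> f [s, t] + f [t, s] = f [s] * f [t]"
proof (induction rule: elems.induct)
  case (step i a f)
  then show ?case
    using elems_Nil[OF step.hyps(3)]
    by (auto simp: conv_gen pair_words singleton_words algebra_simps)
qed (auto simp: unit_apply)

text \<open>Three consecutive positions carry distinct letters, because
  \<open>2 \<le> d\<close>.\<close>

lemma word_two_letters:
  assumes w: "w \<in> words" and st: "set w \<subseteq> {s, t}"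
  shows "w \<in> {[], [s], [t], [s, t], [t, s]}"
proof -
  have nth: "w ! i \<noteq> w ! j" if "i < j" "j < length w" "j \<le> i + d" for i j
    using words_nth_neq[OF w that] .
  have mem: "w ! i \<in> {s, t}" if "i < length w" for i using st that nth_mem by blast
  have "length w < 3"
  proof (rule ccontr)
    assume "\<not> length w < 3"
    then have l: "0 < length w" "1 < length w" "2 < length w" by linarith+
    then have "w ! 0 \<noteq> w ! 1" "w ! 0 \<noteq> w ! 2" "w ! 1 \<noteq> w ! 2"
      using d_ge nth[of 0 1] nth[of 0 2] nth[of 1 2] by auto
    moreover have "w ! 0 \<in> {s, t}" "w ! 1 \<in> {s, t}" "w ! 2 \<in> {s, t}"
      using l by (simp_all only: mem)
    ultimately show False by auto
  qed
  then consider "length w = 0" | "length w = 1" | "length w = 2" by linarith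
  then show ?thesis
  proof cases
    case 2
    then obtain x where "w = [x]" by (auto simp: length_Suc_conv)
    then show ?thesis using st by auto
  next
    case 3
    then obtain x y where xy: "w = [x, y]" by (auto simp: length_Suc_conv numeral_2_eq_2)
    then have "x \<noteq> y" using words_repeat[of x "[]"] w by auto
    then show ?thesis using st xy by auto
  qed simp
qed

lemma stab_one_letter:
  assumes S: "S \<subseteq> {..d}" and st: "{..d} - S = {s}"
  shows "stab S = gen s ` R"
proof (intro equalityI subsetI)
  have s: "s \<le> d" "s \<notin> S" using st by auto
  fix f assume f: "f \<in> stab S"
  then have fe: "f \<in> elems" unfolding stab_iff by auto
  have "f w = gen s (f [s]) w" for w
  proof (cases "w \<in> words \<and> set w \<inter> S = {}")
    case True
    then have "set w \<subseteq> {s}" using st words_letters by blast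
    then have "w \<in> {[], [s]}" using word_two_letters[of w s s] True words_repeat[of s "[]"] by auto
    then show ?thesis using elems_Nil[OF fe] unfolding gen_def by auto
  next
    case False
    then have "w \<noteq> []" "w \<noteq> [s]" using s singleton_words by auto
    then show ?thesis using False f fe elems_support unfolding gen_def stab_iff by auto
  qed
  then have "f = gen s (f [s])" by (rule ext)
  then show "f \<in> gen s ` R" using elems_R[OF fe] by blast
next
  have s: "s \<le> d" "s \<notin> S" using st by auto
  fix f assume "f \<in> gen s ` R"
  then show "f \<in> stab S" using gen_elems s unfolding stab_iff by (auto simp: gen_def split: if_splits)
qed

lemma inj_gen: "inj (gen i)"
proof (rule injI)
  fix a b assume "gen i a = gen i b"
  then have "gen i a [i] = gen i b [i]" by simp
  then show "a = b" by (simp add: gen_def)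
qed

text \<open>Finite integral domains are fields: an injective multiplication is onto.\<close>

lemma R_divide:
  assumes "a \<in> R" "a \<noteq> 0" "b \<in> R"
  shows "\<exists>x\<in>R. x * a = b"
proof -
  have "inj_on (\<lambda>x. x * a) R" using assms by (auto intro!: inj_onI)
  then have "(\<lambda>x. x * a) ` R = R"
    by (intro endo_inj_surj finite_R) (use assms R_mult in auto)
  then have "b \<in> (\<lambda>x. x * a) ` R" using assms(3) by simp
  then show ?thesis by auto
qed

text \<open>The two subgroups are copies of the additive group of \<open>R\<close> inside the
  Heisenberg group. Outside the kernel \<open>?M\<close> of the coefficient at \<open>[t]\<close>,
  an element is uniquely a product b' a b, because that coefficient is invertible.\<close>

lemma angle_le_two_letters:
  assumes S: "S \<subseteq> {..d}" and I: "{..d} - S = {s, t}" and st: "s \<noteq> t"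
  shows "angle_le (stab S) (stab (insert s S)) (stab (insert t S)) (1 / sqrt (card R))"
proof -
  have le: "s \<le> d" "t \<le> d" "s \<notin> S" "t \<notin> S" using I by auto
  have IS: "insert s S \<subseteq> {..d}" "insert t S \<subseteq> {..d}" using S le by auto
  \<comment> \<open>Adding \<open>s\<close> to \<open>S\<close> leaves the letter \<open>t\<close>,
    so the two letters swap roles.\<close>
  have A: "stab (insert s S) = gen t ` R" by (rule stab_one_letter[OF IS(1)]) (use I st le in auto)
  have B: "stab (insert t S) = gen s ` R" by (rule stab_one_letter[OF IS(2)]) (use I st le in auto)
  let ?K = "stab S" and ?M = "{f \<in> stab S. f [t] = 0}"
  let ?prod = "\<lambda>b' a b. conv (conv (gen s b') (gen t a)) (gen s b)"
  have K: "subgroup ?K grp" by (rule subgroup_stab[OF S])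
  have conv_t: "conv f g [t] = f [t] + g [t]" if "f \<in> elems" "g \<in> elems" for f g
    unfolding conv_def using singleton_words[OF le(2)] elems_Nil[OF that(1)] elems_Nil[OF that(2)]
    by (simp add: atMost_Suc)
  have M: "subgroup ?M grp"
  proof
    show "?M \<subseteq> carrier grp" using subgroup.subset[OF K] by auto
    show "\<one>\<^bsub>grp\<^esub> \<in> ?M" using subgroup.one_closed[OF K] by (simp add: unit_apply)
    show "f \<otimes>\<^bsub>grp\<^esub> g \<in> ?M" if "f \<in> ?M" "g \<in> ?M" for f g
      using that subgroup.m_closed[OF K, of f g] conv_t[of f g] unfolding stab_iff by auto
    fix f assume f: "f \<in> ?M"
    then have fe: "f \<in> elems" "inv\<^bsub>grp\<^esub> f \<in> elems" using inv_closed[of f] unfolding stab_iff by auto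
    have "conv (inv\<^bsub>grp\<^esub> f) f [t] = 0" using l_inv[of f] fe by (simp add: unit_apply)
    then have "(inv\<^bsub>grp\<^esub> f) [t] = 0" using conv_t[OF fe(2,1)] f by simp
    then show "inv\<^bsub>grp\<^esub> f \<in> ?M" using f subgroup.m_inv_closed[OF K, of f] by simp
  qed
  \<comment> \<open>These values are later read backwards: \<open>a\<close> at \<open>[t]\<close>,
    then \<open>b'\<close> at \<open>[s, t]\<close> by division, then \<open>b\<close> at
    \<open>[s]\<close>. The value at \<open>[t, s]\<close> is forced by
    \<open>elems_commutator\<close>.\<close>
  have prod_val: "?prod b' a b [] = 1" "?prod b' a b [s] = b' + b" "?prod b' a b [t] = a"
      "?prod b' a b [s, t] = b' * a" "?prod b' a b [t, s] = a * b" for b' a b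
    unfolding conv_assoc using st le
    by (auto simp: conv_gen singleton_words pair_words) (auto simp: gen_def)
  have prod_stab: "?prod b' a b \<in> ?K" if "b' \<in> R" "a \<in> R" "b \<in> R" for b' a b
  proof -
    have "gen s x \<in> ?K" "gen t x \<in> ?K" if "x \<in> R" for x
      using A B that stab_mono[of S "insert s S"] stab_mono[of S "insert t S"] by auto
    then show ?thesis using that subgroup.m_closed[OF K] by simp
  qed
  have K_eqI: "f = g" if "f \<in> ?K" "g \<in> ?K" "f [s] = g [s]" "f [t] = g [t]" "f [s, t] = g [s, t]" "f [t, s] = g [t, s]" for f g
  proof
    fix w
    show "f w = g w"
    proof (cases "w \<in> words \<and> set w \<inter> S = {}")
      case True
      then have "set w \<subseteq> {s, t}" using I words_letters by blast
      then have "w \<in> {[], [s], [t], [s, t], [t, s]}" using word_two_letters True by auto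
      then show ?thesis using that elems_Nil[of f] elems_Nil[of g] unfolding stab_iff by auto
    next
      case False
      then have "f w = 0" "g w = 0"
        using that(1,2) elems_support[of f w] elems_support[of g w] unfolding stab_iff by auto
      then show ?thesis by simp
    qed
  qed
  have bij: "bij_betw (\<lambda>(b', a, b). ?prod b' a b) (R \<times> (R - {0}) \<times> R) (?K - ?M)"
    unfolding bij_betw_def
  proof (intro conjI)
    show "inj_on (\<lambda>(b', a, b). ?prod b' a b) (R \<times> (R - {0}) \<times> R)"
    proof (rule inj_onI)
      fix x y assume xy: "x \<in> R \<times> (R - {0}) \<times> R" "y \<in> R \<times> (R - {0}) \<times> R"
        and eq: "(case x of (b', a, b) \<Rightarrow> ?prod b' a b) = (case y of (b', a, b) \<Rightarrow> ?prod b' a b)"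
      obtain b' a b c' a1 c where x: "x = (b', a, b)" and y: "y = (c', a1, c)" by (metis prod_cases3)
      have eq': "?prod b' a b = ?prod c' a1 c" using eq x y by simp
      have "a = a1" using prod_val(3)[of b' a b] unfolding eq' prod_val by simp
      moreover have "b' + b = c' + c" using prod_val(2)[of b' a b] unfolding eq' prod_val by simp
      moreover have "b' * a = c' * a1" using prod_val(4)[of b' a b] unfolding eq' prod_val by simp
      moreover have "a \<noteq> 0" using xy(1) x by simp
      ultimately show "x = y" unfolding x y by simp
    qed
    show "(\<lambda>(b', a, b). ?prod b' a b) ` (R \<times> (R - {0}) \<times> R) = ?K - ?M"
    proof (intro equalityI subsetI)
      fix f assume "f \<in> (\<lambda>(b', a, b). ?prod b' a b) ` (R \<times> (R - {0}) \<times> R)"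
      then obtain b' a b where "b' \<in> R" "a \<in> R" "a \<noteq> 0" "b \<in> R" "f = ?prod b' a b" by auto
      then show "f \<in> ?K - ?M" using prod_stab prod_val(3) by auto
    next
      fix f assume f: "f \<in> ?K - ?M"
      then have fK: "f \<in> ?K" and ft: "f [t] \<noteq> 0" by auto
      have fe: "f \<in> elems" using fK unfolding stab_iff by simp
      obtain x where x: "x \<in> R" "x * f [t] = f [s, t]" using R_divide[OF elems_R[OF fe] ft elems_R[OF fe]] by blast
      define y where "y = f [s] - x"
      have y: "y \<in> R" unfolding y_def using R_add[OF elems_R[OF fe] R_minus[OF x(1)]] by simp
      have "f [t, s] = f [t] * y"
        using elems_commutator[OF fe le(1,2) st] x(2) unfolding y_def by (simp add: algebra_simps)
      then have "f = ?prod x (f [t]) y"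
        using x(2) by (intro K_eqI[OF fK prod_stab[OF x(1) elems_R[OF fe] y]]) (simp_all add: prod_val y_def)
      moreover have "(x, f [t], y) \<in> R \<times> (R - {0}) \<times> R" using x(1) y ft elems_R[OF fe] by auto
      ultimately show "f \<in> (\<lambda>(b', a, b). ?prod b' a b) ` (R \<times> (R - {0}) \<times> R)"
        by (intro image_eqI[where x = "(x, f [t], y)"]) auto
    qed
  qed
  let ?D = "gen s ` R \<times> (gen t ` R - {unit}) \<times> gen s ` R"
  let ?q = "map_prod (gen s) (map_prod (gen t) (gen s))"
  have gen_minus: "gen t ` R - {unit} = gen t ` (R - {0})"
    unfolding gen_zero[of t, symmetric] image_set_diff[OF inj_gen] by simp
  have D: "?D = ?q ` (R \<times> (R - {0}) \<times> R)"
    unfolding gen_minus by (rule map_prod_surj_on[OF refl map_prod_surj_on[OF refl refl], symmetric])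
  have inj_q: "inj_on ?q (R \<times> (R - {0}) \<times> R)"
    by (intro map_prod_inj_on inj_on_subset[OF inj_gen] subset_UNIV)
  have "bij_betw (\<lambda>(b', a, b). conv (conv b' a) b) ?D (?K - ?M)"
    unfolding D by (rule bij_betw_comp_iff[OF inj_on_imp_bij_betw[OF inj_q], THEN iffD2])
      (use bij in \<open>simp add: o_def case_prod_unfold map_prod_def\<close>)
  then have "angle_le ?K (gen t ` R) (gen s ` R) (1 / sqrt (card (gen t ` R)))"
    using K finite_stab subgroup_stab[OF IS(1)] subgroup_stab[OF IS(2)] M
      stab_mono[of S "insert s S"] stab_mono[of S "insert t S"]
    unfolding A B by (intro angle_le_partial_plane[where M = ?M]) auto
  moreover have "card (gen t ` R) = card R" by (rule card_image[OF inj_on_subset[OF inj_gen]]) simp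
  ultimately show ?thesis unfolding A B by simp
qed

section \<open>Permuting the letters\<close>

definition relabel :: "(nat \<Rightarrow> nat) \<Rightarrow> (nat list \<Rightarrow> 'f) \<Rightarrow> nat list \<Rightarrow> 'f" where
  "relabel p f w = f (map p w)"

lemma map_words:
  assumes p: "p permutes {..d}"
  shows "map p w \<in> words \<longleftrightarrow> w \<in> words"
proof -
  have "set (map p w) \<subseteq> {..d} \<longleftrightarrow> set w \<subseteq> {..d}"
    using permutes_in_image[OF p] by auto
  moreover have "p x = p y \<longleftrightarrow> x = y" for x y using permutes_inj[OF p] by (auto simp: inj_def)
  then have "(map p w) ! i \<noteq> (map p w) ! j \<longleftrightarrow> w ! i \<noteq> w ! j" if "i < j" "j < length w" for i j
    using that by simp
  ultimately show ?thesis unfolding words_def by (auto simp del: set_map)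
qed

lemma relabel_conv: "p permutes {..d} \<Longrightarrow> relabel p (conv f g) = conv (relabel p f) (relabel p g)"
  by (rule ext) (simp add: relabel_def conv_def map_words take_map drop_map)

lemma relabel_gen:
  assumes p: "p permutes {..d}"
  shows "relabel p (gen (p i) a) = gen i a"
proof -
  have "p x = p y \<longleftrightarrow> x = y" for x y using permutes_inj[OF p] by (auto simp: inj_def)
  then show ?thesis by (auto simp: relabel_def gen_def fun_eq_iff)
qed

lemma relabel_elems:
  assumes p: "p permutes {..d}"
  shows "f \<in> elems \<Longrightarrow> relabel p f \<in> elems"
proof (induction rule: elems.induct)
  case unit
  have "relabel p unit = unit" by (auto simp: relabel_def unit_apply fun_eq_iff)
  then show ?case by (simp add: elems.unit)
next
  case (step i a f)
  obtain j where j: "i = p j" using permutes_surj[OF p] by (metis surjD)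
  then have "j \<le> d" using permutes_in_image[OF p, of j] step.hyps by simp
  then show ?case using step j by (simp add: relabel_conv[OF p] relabel_gen[OF p] elems.step)
qed

lemma exists_permutation_image:
  assumes "S \<subseteq> {..d}" "T \<subseteq> {..d}" "card S = card T"
  shows "\<exists>p. p permutes {..d} \<and> p ` S = T"
proof -
  have fin: "finite S" "finite T" using assms finite_subset[of _ "{..d}"] by auto
  obtain f where f: "bij_betw f S T" using finite_same_card_bij[OF fin assms(3)] by auto
  have "card ({..d} - S) = card ({..d} - T)" using assms fin by (simp add: card_Diff_subset)
  then obtain g where g: "bij_betw g ({..d} - S) ({..d} - T)" 
    using finite_same_card_bij[of "{..d} - S" "{..d} - T"] by auto
  define p where "p x = (if x \<in> S then f x else if x \<in> {..d} then g x else x)" for x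
  have pS: "bij_betw p S T" using f by (rule bij_betw_cong[THEN iffD1, rotated]) (simp add: p_def)
  have "bij_betw p ({..d} - S) ({..d} - T)" using g by (rule bij_betw_cong[THEN iffD1, rotated]) (simp add: p_def)
  from bij_betw_combine[OF pS this] have "bij_betw p {..d} {..d}"
    using assms by (simp add: Un_absorb1 Int_Diff)
  then have "p permutes {..d}" using assms by (intro bij_imp_permutes) (auto simp: p_def)
  then show ?thesis using pS unfolding bij_betw_def by blast
qed

text \<open>Relabelling is pullback along \<open>p\<close>, so it maps \<open>stab T\<close> into
  \<open>stab S\<close> when \<open>p\<close> takes \<open>S\<close> to \<open>T\<close>.\<close>

lemma card_stab_le:
  assumes "S \<subseteq> {..d}" "T \<subseteq> {..d}" "card S = card T"
  shows "card (stab T) \<le> card (stab S)"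
proof -
  obtain p where p: "p permutes {..d}" "p ` S = T" using exists_permutation_image[OF assms] by auto
  have inj: "inj_on (relabel p) (stab T)"
  proof (rule inj_onI, rule ext)
    fix f g w assume "relabel p f = relabel p g"
    then have "relabel p f (map (inv_into UNIV p) w) = relabel p g (map (inv_into UNIV p) w)" by simp
    moreover have "p \<circ> inv_into UNIV p = id" using permutes_inv_o[OF p(1)] by simp
    ultimately show "f w = g w" unfolding relabel_def by simp
  qed
  have "relabel p f \<in> stab S" if "f \<in> stab T" for f
  proof -
    have f: "f \<in> elems" "\<And>w. set w \<inter> T \<noteq> {} \<Longrightarrow> f w = 0" using that unfolding stab_iff by auto
    have "relabel p f w = 0" if w: "set w \<inter> S \<noteq> {}" for w
    proof -
      have "set (map p w) \<inter> T \<noteq> {}" using w p(2) by auto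
      then show ?thesis unfolding relabel_def by (rule f(2))
    qed
    then show ?thesis unfolding stab_iff using relabel_elems[OF p(1) f(1)] by simp
  qed
  then show ?thesis by (intro card_inj_on_le[OF inj _ finite_stab]) auto
qed

lemma card_stab_eq:
  assumes "S \<subseteq> {..d}" "T \<subseteq> {..d}" "card S = card T"
  shows "card (stab T) = card (stab S)"
  using card_stab_le[OF assms] card_stab_le[OF assms(2,1)] assms(3) by simp

text \<open>The partial products of the elements 1 + x_i along the periodic word are distinct: the
  k-th vanishes on words longer than k but is 1 on the periodic word of length k. This linear bound
  is enough.\<close>

lemma card_elems_ge: "L < card elems"
proof -
  define e where "e k = rec_nat unit (\<lambda>k f. conv (gen (k mod Suc d) 1) f) k" for k
  have e0: "e 0 = unit" and eS: "e (Suc k) = conv (gen (k mod Suc d) 1) (e k)" for k unfolding e_def by auto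
  have elem: "e k \<in> elems" for k
    by (induction k) (auto simp: e0 eS elems.unit R_1 less_Suc_eq_le[symmetric] intro!: elems.step)
  have long: "e k w = 0" if "k < length w" for k w
    using that by (induction k arbitrary: w) (auto simp: e0 eS unit_apply conv_gen split: list.split)
  have top: "e k (cyclic_word d k) = 1" if "k \<le> L" for k
    using that
  proof (induction k)
    case (Suc k)
    then show ?case using cyclic_word_words[OF Suc.prems] long[of k "cyclic_word d (Suc k)"]
      by (simp add: eS conv_gen del: cyclic_word.simps) (simp add: conv_gen)
  qed (simp add: e0 unit_apply)
  have neq: "e k \<noteq> e l" if "k < l" "l \<le> L" for k l
    using long[of k "cyclic_word d l"] top[of l] that by auto
  have "inj_on e {..L}"
  proof (rule inj_onI)
    fix k l assume "k \<in> {..L}" "l \<in> {..L}" "e k = e l"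
    then show "k = l" using neq[of k l] neq[of l k] by (cases k l rule: linorder_cases) auto
  qed
  then have "card {..L} \<le> card elems" using elem finite_elems by (intro card_inj_on_le) auto
  then show ?thesis by simp
qed

end

text \<open>For \<open>t\<close> in \<open>S\<close>, both truncations allow the same words without
  \<open>t\<close>. Killing \<open>t\<close> thus turns products of one group into products of the
  other, and it fixes every element of the stabiliser.\<close>

lemma word_group_stab_subset:
  assumes "word_group d L R" "word_group d L' R" and S: "S \<subseteq> {..d}" "S \<noteq> {}"
  shows "retracted_group.stab (word_group.grp d L R) word_group.kill S
    \<subseteq> retracted_group.stab (word_group.grp d L' R) word_group.kill S"
proof -
  interpret A: word_group d L R by fact
  interpret B: word_group d L' R by fact
  obtain t where t: "t \<in> S" "t \<le> d" using S by auto
  have words: "w \<in> A.words \<longleftrightarrow> w \<in> B.words" if "t \<notin> set w" for w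
    using A.length_word_avoiding[of w t] B.length_word_avoiding[of w t] that t A.d_le_L B.d_le_L
    unfolding A.words_def B.words_def by auto
  have kill_conv: "A.kill t (A.conv f g) = B.conv (A.kill t f) (A.kill t g)" for f g
  proof
    fix w
    show "A.kill t (A.conv f g) w = B.conv (A.kill t f) (A.kill t g) w"
    proof (cases "t \<in> set w")
      case True
      then have "A.kill t (A.conv f g) w = 0" "B.kill t (B.conv f g) w = 0" unfolding A.kill_def by auto
      then show ?thesis using B.kill_conv[of t f g] by simp
    next
      case False
      then have "A.conv (A.kill t f) (A.kill t g) w = B.conv (A.kill t f) (A.kill t g) w"
        unfolding A.conv_def B.conv_def using words by simp
      then show ?thesis using A.kill_conv[of t f g] by simp
    qed
  qed
  have kill: "A.kill t f \<in> B.elems" if "f \<in> A.elems" for f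
    using that
  proof (induction rule: A.elems.induct)
    case unit
    then show ?case by (simp add: A.kill_unit B.elems.unit)
  next
    case (step i a f)
    then show ?case
      by (auto simp: kill_conv A.kill_gen B.conv_unit_left intro: B.elems.step)
  qed
  show ?thesis
  proof
    fix f assume f: "f \<in> A.stab S"
    then have "A.kill t f = f" using t unfolding A.stab_def by auto
    then have "f \<in> B.elems" using kill[of f] f unfolding A.stab_iff by auto
    then show "f \<in> B.stab S" using f unfolding A.stab_iff B.stab_iff by auto
  qed
qed

section \<open>The expander graphs\<close>

context word_group
begin

definition stab_size :: "nat \<Rightarrow> nat" where
  "stab_size k = card (stab {..<k})"

text \<open>The degrees \<open>deg\<close> of the chamber system, stated without its vertex encoding
  so that they can be compared for different \<open>L\<close>. Only positive arguments of
  \<open>stab_size\<close> occur.\<close>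

definition degree_seq :: "nat \<Rightarrow> nat" where
  "degree_seq i = (d - i) * (stab_size (Suc i) div stab_size (Suc (Suc i)))"

lemma card_stab_size:
  assumes "S \<subseteq> {..d}"
  shows "card (stab S) = stab_size (card S)"
proof -
  have "card S \<le> card {..d}" using assms by (intro card_mono) auto
  then have "{..<card S} \<subseteq> {..d}" by auto
  from card_stab_eq[OF this assms] show ?thesis unfolding stab_size_def by simp
qed

lemma expander_graph:
  assumes r: "sqrt (card R) > real d + 1" and lam: "1 / (sqrt (card R) - real d) \<le> lam"
  shows "\<exists>V E. graph V E \<and> multi_regular V E (map degree_seq [0..<d]) \<and>
      local_spectral_expander V E lam \<and> L < stab_size 1 * card V"
    and "sorted_wrt (>) (map degree_seq [0..<d])"
    and "i < d \<Longrightarrow> 0 < degree_seq i"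
proof -
  obtain v :: "nat \<Rightarrow> (nat list \<Rightarrow> 'f) \<Rightarrow> nat" where v: "\<forall>i\<le>d. \<forall>j\<le>d. \<forall>x\<in>carrier grp. \<forall>y\<in>carrier grp.
     v i x = v j y \<longleftrightarrow> i = j \<and> x \<otimes>\<^bsub>grp\<^esub> inv\<^bsub>grp\<^esub> y \<in> stab {i}"
    using exists_vertex_encoding by (elim exE)
  interpret C: chamber_system "carrier grp" d v stab_size "1 / (sqrt (card R) - real d)"
    by (rule chamber_system[OF v card_stab_size angle_le_two_letters r])
  have deg: "C.deg = degree_seq"
    unfolding C.deg_def C.ratio_def degree_seq_def by (rule ext) simp
  have "stab {..<0} = elems" unfolding stab_def by simp
  then have "L < stab_size 1 * card C.verts"
    using C.card_verts_ge card_elems_ge unfolding stab_size_def[of 0] by simp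
  then show "\<exists>V E. graph V E \<and> multi_regular V E (map degree_seq [0..<d]) \<and>
      local_spectral_expander V E lam \<and> L < stab_size 1 * card V"
    using C.graph C.multi_regular[OF order_refl] C.local_spectral_expander[OF lam] unfolding deg by blast
  show "sorted_wrt (>) (map degree_seq [0..<d])"
    using C.deg_decreasing unfolding deg by (simp add: sorted_wrt_iff_nth_less)
  show "0 < degree_seq i" if "i < d" using C.deg_pos[OF that] unfolding deg .
qed

end

text \<open>Positivity of \<open>k\<close> excludes the whole group, whose order is unbounded in
  \<open>L\<close>.\<close>

lemma stab_size_independent:
  assumes "word_group d L R" "word_group d L' R" and k: "0 < k" "k \<le> d + 1"
  shows "word_group.stab_size d L R k = word_group.stab_size d L' R k"
proof -
  have "{..<k} \<subseteq> {..d}" "{..<k} \<noteq> {}" using k by auto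
  from word_group_stab_subset[OF assms(1,2) this] word_group_stab_subset[OF assms(2,1) this]
  show ?thesis
    unfolding word_group.stab_size_def[OF assms(1)] word_group.stab_size_def[OF assms(2)] by simp
qed

theorem mainTheorem1:
  fixes lam :: real and n :: nat
  assumes "lam > 0" and "n \<ge> 1"
  shows "\<exists>(ds :: nat list) (V :: nat \<Rightarrow> nat set) (E :: nat \<Rightarrow> nat set set).
           length ds = n \<and> sorted_wrt (>) ds \<and> (\<forall>d\<in>set ds. d > 0) \<and>
           (\<forall>s\<ge>1. graph (V s) (E s) \<and> multi_regular (V s) (E s) ds \<and>
                   local_spectral_expander (V s) (E s) lam) \<and>
           filterlim (\<lambda>s. card (V s)) at_top sequentially"
proof -
  \<comment> \<open>One more than \<open>n\<close>, which gives \<open>2 \<le> d\<close> also for n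
    = 1; the last of the \<open>d\<close> degrees is dropped in \<open>ds\<close>.\<close>
  define d where "d = Suc n"
  \<comment> \<open>Once sqrt (card R) is at least \<open>b\<close>, it exceeds d + 1, and 1 / (sqrt
    (card R) - d) is at most \<open>lam\<close>.\<close>
  define b where "b = real d + 2 + 1 / lam"
  have b: "b > 0" unfolding b_def using assms(1) by (simp add: add_pos_pos)
  obtain R :: "bit alg_closure set" where R: "finite R" "nat \<lceil>b\<^sup>2\<rceil> \<le> card R" "0 \<in> R" "1 \<in> R"
    "\<forall>x\<in>R. \<forall>y\<in>R. x + y \<in> R \<and> x * y \<in> R" "\<forall>x\<in>R. - x \<in> R"
    using exists_finite_subfield[of "nat \<lceil>b\<^sup>2\<rceil>"] by blast
  have "b\<^sup>2 \<le> card R" using R(2) by linarith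
  then have rb: "b \<le> sqrt (card R)" using b by (simp add: real_le_rsqrt)
  have r: "sqrt (card R) > real d + 1" using rb assms(1) unfolding b_def
    by (smt (verit) zero_less_divide_1_iff)
  have "1 / lam \<le> sqrt (card R) - real d" using rb unfolding b_def by simp
  then have "1 \<le> lam * (sqrt (card R) - real d)"
    using assms(1) by (simp add: pos_divide_le_eq mult.commute)
  then have lam: "1 / (sqrt (card R) - real d) \<le> lam"
    using r by (simp add: pos_divide_le_eq)
  \<comment> \<open>The truncation length \<open>d + s\<close> never falls below \<open>d\<close>,
    and \<open>s\<close> becomes the index of the sequence.\<close>
  have W: "word_group d (d + s) R" for s
    unfolding word_group_def using R assms(2) unfolding d_def by auto
  define ds where "ds = map (word_group.degree_seq d d R) [0..<n]"
  have W0: "word_group d d R" using W[of 0] by simp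
  have deg: "word_group.degree_seq d (d + s) R i = word_group.degree_seq d d R i" if "i < d" for s i
    unfolding word_group.degree_seq_def[OF W] word_group.degree_seq_def[OF W0]
    using stab_size_independent[OF W W0, of "Suc i"] stab_size_independent[OF W W0, of "Suc (Suc i)"] that by simp
  have ds: "map (word_group.degree_seq d (d + s) R) [0..<d] = ds @ [word_group.degree_seq d d R n]" for s
  proof -
    have "map (word_group.degree_seq d (d + s) R) [0..<d] = map (word_group.degree_seq d d R) [0..<d]"
      using deg by (intro map_cong) auto
    then show ?thesis unfolding ds_def d_def by simp
  qed
  define h1 where "h1 = word_group.stab_size d d R 1"
  have "\<exists>V E. graph V E \<and> multi_regular V E ds \<and> local_spectral_expander V E lam \<and> s < h1 * card V" for s
  proof -
    obtain V E where VE: "graph V E" "multi_regular V E (ds @ [word_group.degree_seq d d R n])"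
      "local_spectral_expander V E lam" "d + s < word_group.stab_size d (d + s) R 1 * card V"
      using word_group.expander_graph(1)[OF W r lam, of s] unfolding ds by (elim exE conjE)
    have "multi_regular V E ds"
      unfolding multi_regular_def
    proof (intro allI impI)
      fix i C assume i: "i < length ds" and C: "clique V E C \<and> card C = i"
      then have "induced_regular (joint_nbhd V E C) E ((ds @ [word_group.degree_seq d d R n]) ! i)"
        using VE(2) unfolding multi_regular_def by simp
      then show "induced_regular (joint_nbhd V E C) E (ds ! i)" using i by (simp add: nth_append)
    qed
    moreover have "s < h1 * card V" using VE(4) stab_size_independent[OF W W0, of 1 s] unfolding h1_def by simp
    ultimately show ?thesis using VE by blast
  qed
  then have "\<forall>s. \<exists>p. graph (fst p) (snd p) \<and> multi_regular (fst p) (snd p) ds \<and>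
      local_spectral_expander (fst p) (snd p) lam \<and> s < h1 * card (fst p)" by simp
  then obtain p where p: "\<forall>s. graph (fst (p s)) (snd (p s)) \<and> multi_regular (fst (p s)) (snd (p s)) ds \<and>
      local_spectral_expander (fst (p s)) (snd (p s)) lam \<and> s < h1 * card (fst (p s))"
    by (rule choice[THEN exE])
  define V E where "V s = fst (p s)" and "E s = snd (p s)" for s
  have VE: "graph (V s) (E s)" "multi_regular (V s) (E s) ds"
    "local_spectral_expander (V s) (E s) lam" "s < h1 * card (V s)" for s
    using p unfolding V_def E_def by simp_all
  have "filterlim (\<lambda>s. card (V s)) at_top sequentially"
    unfolding filterlim_at_top eventually_sequentially
  proof (intro allI exI impI)
    fix Z s assume "h1 * Z \<le> s"
    from le_less_trans[OF this VE(4)[of s]] have "h1 * Z < h1 * card (V s)" .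
    then show "Z \<le> card (V s)" by simp
  qed
  moreover have "sorted_wrt (>) ds"
    using word_group.expander_graph(2)[OF W r lam, of 0] unfolding ds sorted_wrt_append by simp
  moreover have "\<forall>i\<in>set ds. i > 0"
    using word_group.expander_graph(3)[OF W0 r lam] unfolding ds_def d_def by auto
  moreover have "length ds = n" unfolding ds_def by simp
  ultimately show ?thesis using VE(1-3)
    by (intro exI[of _ ds] exI[of _ V] exI[of _ E] conjI allI impI)
qed

end
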